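(* For any family of parameters $\{\beta,\alpha_n\}_{n\ge1}\subset R$, there exists a unique transverse Markov trace $(\tau_n)_{n\ge1}$ on $(BMW_n)_{n\ge1}$ such that $\tau_2(e_1)=\beta$ and $\tau_n(1)=\alpha_n$ for all $n\ge1$.
   Context: Let $R=\mathbb{C}[a^{\pm1},q^{\pm1},(q-q^{-1})^{\pm1}]$. The Birman-Murakami-Wenzl algebra $BMW_n$ ($n\ge 2$) is the $R$-algebra generated by invertible elements $s_1,\dots,s_{n-1}$ subject to the relations $s_is_j=s_js_i$ for $|i-j|\ge 2$, $s_is_{i+1}s_i=s_{i+1}s_is_{i+1}$ for $1\le i\le n-2$, and, with $e_i:=\frac{s_i^{-1}-s_i}{q-q^{-1}}+1$, the relations $e_is_i=a^{-1}e_i$ for $1\le i\le n-1$, and $e_is_{i+1}e_i=a\,e_i$ and $e_is_{i+1}^{-1}e_i=a^{-1}e_i$ for $1\le i\le n-2$. Set $BMW_1=R$. The algebra $BMW_n$ is identified with its image in $BMW_{n+1}$ under the algebra embedding $s_i\mapsto s_i$ ($i=1,\dots,n-1$). A transverse Markov trace on $(BMW_n)_{n\ge1}$ is a family $(\tau_n)_{n\ge1}$ of $R$-linear maps $\tau_n:BMW_n\to R$ such that, for all $n\ge1$ and $u,v\in BMW_n$: (trace property) $\tau_n(uv)=\tau_n(vu)$; (positive stabilization property) $\tau_{n+1}(us_nv)=a\,\tau_n(uv)$. *)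

theory Defs
  imports
    "HOL-Library.Poly_Mapping"
    "HOL-Library.FuncSet"
    "HOL-Computational_Algebra.Polynomial"
    "HOL-Computational_Algebra.Fraction_Field"
    "HOL-Algebra.QuotRing"
begin

section \<open>The coefficient ring\<close>

text \<open>In the fraction field of \<open>\<complex>[q][a]\<close> the inner polynomial variable is \<open>q\<close>, the outer one is \<open>a\<close>.\<close>

type_synonym ratfun = "complex poly poly fract"

definition const_rf :: "complex \<Rightarrow> ratfun" where
  "const_rf c = Fract [:[:c:]:] 1"

definition a_rf :: ratfun where
  "a_rf = Fract [:0, 1:] 1"

definition q_rf :: ratfun where
  "q_rf = Fract [:[:0, 1:]:] 1"

inductive_set coeff_set :: "ratfun set" where
  const: "const_rf c \<in> coeff_set"
| a: "a_rf \<in> coeff_set"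
| a_inv: "inverse a_rf \<in> coeff_set"
| q: "q_rf \<in> coeff_set"
| q_inv: "inverse q_rf \<in> coeff_set"
| z: "q_rf - inverse q_rf \<in> coeff_set"
| z_inv: "inverse (q_rf - inverse q_rf) \<in> coeff_set"
| add: "x \<in> coeff_set \<Longrightarrow> y \<in> coeff_set \<Longrightarrow> x + y \<in> coeff_set"
| mult: "x \<in> coeff_set \<Longrightarrow> y \<in> coeff_set \<Longrightarrow> x * y \<in> coeff_set"

lemma const_rf_simps:
  "const_rf 0 = 0" "const_rf 1 = 1" "const_rf (- 1) = - 1"
  by (simp_all add: const_rf_def Zero_fract_def One_fract_def eq_fract one_pCons)

lemma coeff_set_0: "0 \<in> coeff_set"
  using coeff_set.const[of 0] by (simp add: const_rf_simps)

lemma coeff_set_1: "1 \<in> coeff_set"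
  using coeff_set.const[of 1] by (simp add: const_rf_simps)

lemma coeff_set_uminus: "x \<in> coeff_set \<Longrightarrow> - x \<in> coeff_set"
  using coeff_set.mult[OF coeff_set.const[of "- 1"], of x] by (simp add: const_rf_simps)

lemma coeff_set_diff: "x \<in> coeff_set \<Longrightarrow> y \<in> coeff_set \<Longrightarrow> x - y \<in> coeff_set"
  using coeff_set.add[OF _ coeff_set_uminus, of x y] by simp

text \<open>The ring \<open>R = \<complex>[a\<^sup>\<plusminus>\<^sup>1, q\<^sup>\<plusminus>\<^sup>1, (q - q\<^sup>-\<^sup>1)\<^sup>\<plusminus>\<^sup>1]\<close>.\<close>

typedef coeff = coeff_set
  using coeff_set_0 by blast

setup_lifting type_definition_coeff

instantiation coeff :: idom
begin

lift_definition zero_coeff :: coeff is 0 by (rule coeff_set_0)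
lift_definition one_coeff :: coeff is 1 by (rule coeff_set_1)
lift_definition plus_coeff :: "coeff \<Rightarrow> coeff \<Rightarrow> coeff" is "(+)" by (rule coeff_set.add)
lift_definition times_coeff :: "coeff \<Rightarrow> coeff \<Rightarrow> coeff" is "(*)" by (rule coeff_set.mult)
lift_definition uminus_coeff :: "coeff \<Rightarrow> coeff" is uminus by (rule coeff_set_uminus)
lift_definition minus_coeff :: "coeff \<Rightarrow> coeff \<Rightarrow> coeff" is "(-)" by (rule coeff_set_diff)

instance by standard (transfer; simp add: algebra_simps)+

end

lift_definition a_par :: coeff is a_rf by (rule coeff_set.a)
lift_definition a_par_inv :: coeff is "inverse a_rf" by (rule coeff_set.a_inv)
lift_definition q_par :: coeff is q_rf by (rule coeff_set.q)
lift_definition q_par_inv :: coeff is "inverse q_rf" by (rule coeff_set.q_inv)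
lift_definition z_par_inv :: coeff is "inverse (q_rf - inverse q_rf)" by (rule coeff_set.z_inv)

lemma q_rf_square_ne_1: "q_rf * q_rf \<noteq> 1"
  by (simp add: q_rf_def One_fract_def eq_fract one_pCons)

lemma a_par_inverse: "a_par * a_par_inv = 1"
  by transfer (simp add: a_rf_def One_fract_def eq_fract)

lemma q_par_inverse: "q_par * q_par_inv = 1"
  by transfer (simp add: q_rf_def One_fract_def eq_fract)

lemma z_par_inverse: "(q_par - q_par_inv) * z_par_inv = 1"
proof (transfer, rule right_inverse)
  have "q_rf \<noteq> 0" by (simp add: q_rf_def Zero_fract_def eq_fract)
  then show "q_rf - inverse q_rf \<noteq> 0"
    using q_rf_square_ne_1 by (metis eq_iff_diff_eq_0 right_inverse)
qed

section \<open>Free algebras\<close>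

datatype letter = Gen nat | Inv nat

primrec letter_index :: "letter \<Rightarrow> nat" where
  "letter_index (Gen i) = i"
| "letter_index (Inv i) = i"

text \<open>Words form a monoid under concatenation, written additively because the convolution product
  of \<^theory>\<open>HOL-Library.Poly_Mapping\<close> expects an additive monoid of exponents.\<close>

datatype word = Word (letters: "letter list")

instantiation word :: monoid_add
begin

definition zero_word :: word where "0 = Word []"

definition plus_word :: "word \<Rightarrow> word \<Rightarrow> word" where
  "u + v = Word (letters u @ letters v)"

instance by standard (simp_all add: zero_word_def plus_word_def)

end

type_synonym free = "word \<Rightarrow>\<^sub>0 coeff"

definition scalar :: "coeff \<Rightarrow> free" where
  "scalar c = Poly_Mapping.single 0 c"

definition s_gen :: "nat \<Rightarrow> free" where
  "s_gen i = Poly_Mapping.single (Word [Gen i]) 1"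

definition s_inv :: "nat \<Rightarrow> free" where
  "s_inv i = Poly_Mapping.single (Word [Inv i]) 1"

definition e_gen :: "nat \<Rightarrow> free" where
  "e_gen i = scalar z_par_inv * (s_inv i - s_gen i) + 1"

definition words :: "nat \<Rightarrow> word set" where
  "words n = {w. \<forall>x \<in> set (letters w). 1 \<le> letter_index x \<and> letter_index x < n}"

text \<open>The free associative \<open>R\<close>-algebra on symbols \<open>s\<^sub>i, s\<^sub>i\<^sup>-\<^sup>1\<close> with \<open>1 \<le> i \<le> n - 1\<close>;
  it is \<open>R\<close> itself for \<open>n = 1\<close>.\<close>

definition free_alg :: "nat \<Rightarrow> free ring" where
  "free_alg n = \<lparr>carrier = {f. Poly_Mapping.keys f \<subseteq> words n},
     mult = (*), one = 1, zero = 0, add = (+)\<rparr>"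

section \<open>The Birman-Murakami-Wenzl algebras\<close>

text \<open>Each relation \<open>l = r\<close> is recorded as \<open>l - r\<close>.\<close>

definition bmw_rel :: "nat \<Rightarrow> free set" where
  "bmw_rel n =
     {s_gen i * s_inv i - 1 | i. 1 \<le> i \<and> i < n}
   \<union> {s_inv i * s_gen i - 1 | i. 1 \<le> i \<and> i < n}
   \<union> {s_gen i * s_gen j - s_gen j * s_gen i | i j.
        1 \<le> i \<and> i < n \<and> 1 \<le> j \<and> j < n \<and> 2 \<le> \<bar>int i - int j\<bar>}
   \<union> {s_gen i * s_gen (i + 1) * s_gen i - s_gen (i + 1) * s_gen i * s_gen (i + 1) | i.
        1 \<le> i \<and> i + 1 < n}
   \<union> {e_gen i * s_gen i - scalar a_par_inv * e_gen i | i. 1 \<le> i \<and> i < n}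
   \<union> {e_gen i * s_gen (i + 1) * e_gen i - scalar a_par * e_gen i | i. 1 \<le> i \<and> i + 1 < n}
   \<union> {e_gen i * s_inv (i + 1) * e_gen i - scalar a_par_inv * e_gen i | i. 1 \<le> i \<and> i + 1 < n}"

definition bmw_ideal :: "nat \<Rightarrow> free set" where
  "bmw_ideal n = genideal (free_alg n) (bmw_rel n)"

definition bmw :: "nat \<Rightarrow> free set ring" where
  "bmw n = free_alg n Quot bmw_ideal n"

definition bmw_class :: "nat \<Rightarrow> free \<Rightarrow> free set" where
  "bmw_class n f = bmw_ideal n +>\<^bsub>free_alg n\<^esub> f"

definition bmw_s :: "nat \<Rightarrow> nat \<Rightarrow> free set" where
  "bmw_s n i = bmw_class n (s_gen i)"

definition bmw_e :: "nat \<Rightarrow> nat \<Rightarrow> free set" where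
  "bmw_e n i = bmw_class n (e_gen i)"

definition bmw_scale :: "nat \<Rightarrow> coeff \<Rightarrow> free set \<Rightarrow> free set" where
  "bmw_scale n c x = bmw_class n (scalar c) \<otimes>\<^bsub>bmw n\<^esub> x"

text \<open>The homomorphism \<open>BMW\<^sub>n \<rightarrow> BMW\<^sub>n\<^sub>+\<^sub>1\<close> with \<open>s\<^sub>i \<mapsto> s\<^sub>i\<close>: it sends a class to the class
  containing it.\<close>

definition bmw_incl :: "nat \<Rightarrow> free set \<Rightarrow> free set" where
  "bmw_incl n x = bmw_ideal (n + 1) <+>\<^bsub>free_alg (n + 1)\<^esub> x"

section \<open>Transverse Markov traces\<close>

text \<open>Families of maps are extensional (also in the index, which starts at \<open>1\<close>), so that
  uniqueness of a family is equality of functions.\<close>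

definition transverse_markov_trace :: "(nat \<Rightarrow> free set \<Rightarrow> coeff) \<Rightarrow> bool" where
  "transverse_markov_trace \<tau> \<longleftrightarrow>
     \<tau> \<in> (\<Pi>\<^sub>E n\<in>{1..}. carrier (bmw n) \<rightarrow>\<^sub>E UNIV) \<and>
     (\<forall>n\<ge>1. \<forall>u\<in>carrier (bmw n). \<forall>v\<in>carrier (bmw n).
        \<tau> n (u \<oplus>\<^bsub>bmw n\<^esub> v) = \<tau> n u + \<tau> n v) \<and>
     (\<forall>n\<ge>1. \<forall>c. \<forall>u\<in>carrier (bmw n). \<tau> n (bmw_scale n c u) = c * \<tau> n u) \<and>
     (\<forall>n\<ge>1. \<forall>u\<in>carrier (bmw n). \<forall>v\<in>carrier (bmw n).
        \<tau> n (u \<otimes>\<^bsub>bmw n\<^esub> v) = \<tau> n (v \<otimes>\<^bsub>bmw n\<^esub> u)) \<and>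
     (\<forall>n\<ge>1. \<forall>u\<in>carrier (bmw n). \<forall>v\<in>carrier (bmw n).
        \<tau> (n + 1) (bmw_incl n u \<otimes>\<^bsub>bmw (n + 1)\<^esub> bmw_s (n + 1) n \<otimes>\<^bsub>bmw (n + 1)\<^esub> bmw_incl n v)
          = a_par * \<tau> n (u \<otimes>\<^bsub>bmw n\<^esub> v))"

section \<open>Well-definedness\<close>

lemma words_0: "0 \<in> words n"
  by (simp add: words_def zero_word_def)

lemma words_plus: "u \<in> words n \<Longrightarrow> v \<in> words n \<Longrightarrow> u + v \<in> words n"
  by (auto simp: words_def plus_word_def)

lemma words_mono: "m \<le> n \<Longrightarrow> words m \<subseteq> words n"
  by (force simp: words_def)

lemma free_alg_simps:
  "f \<in> carrier (free_alg n) \<longleftrightarrow> Poly_Mapping.keys f \<subseteq> words n"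
  "f \<otimes>\<^bsub>free_alg n\<^esub> g = f * g" "f \<oplus>\<^bsub>free_alg n\<^esub> g = f + g"
  "\<one>\<^bsub>free_alg n\<^esub> = 1" "\<zero>\<^bsub>free_alg n\<^esub> = 0"
  by (simp_all add: free_alg_def)

lemma free_alg_mult_closed:
  "f \<in> carrier (free_alg n) \<Longrightarrow> g \<in> carrier (free_alg n) \<Longrightarrow> f * g \<in> carrier (free_alg n)"
  using keys_mult[of f g] words_plus unfolding free_alg_simps by blast

lemma free_alg_add_closed:
  "f \<in> carrier (free_alg n) \<Longrightarrow> g \<in> carrier (free_alg n) \<Longrightarrow> f + g \<in> carrier (free_alg n)"
  using keys_add[of f g] unfolding free_alg_simps by blast

lemma free_alg_uminus_closed:
  "f \<in> carrier (free_alg n) \<Longrightarrow> - f \<in> carrier (free_alg n)"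
  unfolding free_alg_simps by (simp add: keys_minus)

lemma free_alg_diff_closed:
  "f \<in> carrier (free_alg n) \<Longrightarrow> g \<in> carrier (free_alg n) \<Longrightarrow> f - g \<in> carrier (free_alg n)"
  using free_alg_add_closed[OF _ free_alg_uminus_closed, of f n g] by simp

lemma scalar_closed: "scalar c \<in> carrier (free_alg n)"
  by (simp add: free_alg_simps scalar_def words_0)

lemma one_closed: "1 \<in> carrier (free_alg n)"
  using scalar_closed[of 1 n] by (simp add: scalar_def)

lemma s_gen_closed: "1 \<le> i \<Longrightarrow> i < n \<Longrightarrow> s_gen i \<in> carrier (free_alg n)"
  by (simp add: free_alg_simps s_gen_def words_def)

lemma s_inv_closed: "1 \<le> i \<Longrightarrow> i < n \<Longrightarrow> s_inv i \<in> carrier (free_alg n)"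
  by (simp add: free_alg_simps s_inv_def words_def)

lemma e_gen_closed: "1 \<le> i \<Longrightarrow> i < n \<Longrightarrow> e_gen i \<in> carrier (free_alg n)"
  unfolding e_gen_def
  by (intro free_alg_add_closed free_alg_mult_closed free_alg_diff_closed
      scalar_closed one_closed s_gen_closed s_inv_closed)

lemma free_alg_mono: "m \<le> n \<Longrightarrow> carrier (free_alg m) \<subseteq> carrier (free_alg n)"
  using words_mono[of m n] by (auto simp: free_alg_simps)

lemma bmw_rel_subset: "bmw_rel n \<subseteq> carrier (free_alg n)"
  by (auto simp: bmw_rel_def intro!: free_alg_diff_closed free_alg_mult_closed
      scalar_closed one_closed s_gen_closed s_inv_closed e_gen_closed)

lemma bmw_rel_mono: "m \<le> n \<Longrightarrow> bmw_rel m \<subseteq> bmw_rel n"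
  unfolding bmw_rel_def
  by (intro Un_mono Collect_mono impI; elim exE conjE; (intro exI conjI)?;
      (assumption | erule (1) less_le_trans))

lemma free_alg_ring: "ring (free_alg n)"
proof (rule ringI)
  show "abelian_group (free_alg n)"
  proof (rule abelian_groupI)
    fix x assume "x \<in> carrier (free_alg n)"
    then show "\<exists>y\<in>carrier (free_alg n). y \<oplus>\<^bsub>free_alg n\<^esub> x = \<zero>\<^bsub>free_alg n\<^esub>"
      by (intro bexI[of _ "- x"]) (auto simp: free_alg_simps(2-) free_alg_uminus_closed)
  qed (auto simp: free_alg_simps(2-) free_alg_add_closed ac_simps, simp add: free_alg_simps)
  show "Group.monoid (free_alg n)"
    by unfold_locales
      (auto simp: free_alg_simps(2-) free_alg_mult_closed one_closed mult.assoc)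
qed (auto simp: free_alg_simps(2-) algebra_simps)

lemma bmw_ideal_ideal: "ideal (bmw_ideal n) (free_alg n)"
  unfolding bmw_ideal_def by (rule ring.genideal_ideal[OF free_alg_ring bmw_rel_subset])

lemma bmw_ring: "ring (bmw n)"
  unfolding bmw_def by (rule ideal.quotient_is_ring[OF bmw_ideal_ideal])

lemma bmw_class_hom: "bmw_class n \<in> ring_hom (free_alg n) (bmw n)"
  using ideal.rcos_ring_hom[OF bmw_ideal_ideal, of n] by (simp add: bmw_def bmw_class_def[abs_def])

lemma bmw_carrier: "carrier (bmw n) = bmw_class n ` carrier (free_alg n)"
  by (auto simp: bmw_def FactRing_def A_RCOSETS_def' bmw_class_def)

lemma bmw_ideal_mono:
  assumes "m \<le> n"
  shows "bmw_ideal m \<subseteq> bmw_ideal n"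
proof -
  interpret I: ideal "bmw_ideal n" "free_alg n" by (rule bmw_ideal_ideal)
  interpret M: ring "free_alg m" by (rule free_alg_ring)
  let ?J = "bmw_ideal n \<inter> carrier (free_alg m)"
  have sub: "carrier (free_alg m) \<subseteq> carrier (free_alg n)"
    using assms by (rule free_alg_mono)
  have inv: "\<ominus>\<^bsub>free_alg m\<^esub> x = - x" if "x \<in> carrier (free_alg m)" for x
    by (rule M.minus_equality) (use that in \<open>auto simp: free_alg_simps(2-) free_alg_uminus_closed\<close>)
  have inv': "\<ominus>\<^bsub>free_alg n\<^esub> x = - x" if "x \<in> carrier (free_alg n)" for x
    by (rule I.minus_equality) (use that in \<open>auto simp: free_alg_simps(2-) free_alg_uminus_closed\<close>)
  have "ideal ?J (free_alg m)"
  proof (rule idealI[OF free_alg_ring])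
    show "subgroup ?J (add_monoid (free_alg m))"
    proof (rule M.add.subgroupI)
      show "?J \<noteq> {}"
        using additive_subgroup.zero_closed[OF I.is_additive_subgroup] M.zero_closed
        by (auto simp: free_alg_simps(2-))
    next
      fix x assume x: "x \<in> ?J"
      have "- x \<in> bmw_ideal n"
        using additive_subgroup.a_inv_closed[OF I.is_additive_subgroup, of x] inv'[of x] x sub by auto
      then show "\<ominus>\<^bsub>free_alg m\<^esub> x \<in> ?J"
        using x inv[of x] by (auto simp: free_alg_uminus_closed)
    next
      fix x y assume "x \<in> ?J" "y \<in> ?J"
      then show "x \<oplus>\<^bsub>free_alg m\<^esub> y \<in> ?J"
        using additive_subgroup.a_closed[OF I.is_additive_subgroup, of x y] by (auto simp: free_alg_simps(2-) free_alg_add_closed)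
    qed auto
  next
    fix x y assume "x \<in> ?J" "y \<in> carrier (free_alg m)"
    then show "y \<otimes>\<^bsub>free_alg m\<^esub> x \<in> ?J" "x \<otimes>\<^bsub>free_alg m\<^esub> y \<in> ?J"
      using I.I_l_closed[of x y] I.I_r_closed[of x y] sub
      by (auto simp: free_alg_simps(2-) free_alg_mult_closed)
  qed
  moreover have "bmw_rel m \<subseteq> ?J"
    using bmw_rel_mono[OF assms] bmw_rel_subset[of m]
      ring.genideal_self[OF free_alg_ring bmw_rel_subset, of n]
    by (auto simp: bmw_ideal_def)
  ultimately have "bmw_ideal m \<subseteq> ?J"
    unfolding bmw_ideal_def[of m] by (rule M.genideal_minimal)
  then show ?thesis by blast
qed

lemma bmw_class_eq: "bmw_class n f = {x + f | x. x \<in> bmw_ideal n}"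
  by (auto simp: bmw_class_def a_r_coset_def' free_alg_simps(2-))

lemma bmw_incl_class: "bmw_incl n (bmw_class n f) = bmw_class (n + 1) f"
proof -
  interpret I: ideal "bmw_ideal (n + 1)" "free_alg (n + 1)" by (rule bmw_ideal_ideal)
  interpret M: ideal "bmw_ideal n" "free_alg n" by (rule bmw_ideal_ideal)
  have zero: "0 \<in> bmw_ideal n"
    using additive_subgroup.zero_closed[OF M.is_additive_subgroup]
    unfolding free_alg_simps .
  have plus: "x + y \<in> bmw_ideal (n + 1)" if "x \<in> bmw_ideal (n + 1)" "y \<in> bmw_ideal n" for x y
    using additive_subgroup.a_closed[OF I.is_additive_subgroup, of x y] that bmw_ideal_mono[of n "n + 1"]
    unfolding free_alg_simps by auto
  show ?thesis
  proof (intro equalityI subsetI)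
    fix g assume "g \<in> bmw_incl n (bmw_class n f)"
    then obtain x y where "x \<in> bmw_ideal (n + 1)" "y \<in> bmw_ideal n" "g = x + (y + f)"
      unfolding bmw_incl_def set_add_def' bmw_class_eq free_alg_simps by blast
    then show "g \<in> bmw_class (n + 1) f"
      unfolding bmw_class_eq using plus by (metis (mono_tags, lifting) add.assoc mem_Collect_eq)
  next
    fix g assume "g \<in> bmw_class (n + 1) f"
    then obtain x where "x \<in> bmw_ideal (n + 1)" "g = x + (0 + f)"
      unfolding bmw_class_eq by auto
    then show "g \<in> bmw_incl n (bmw_class n f)"
      unfolding bmw_incl_def set_add_def' bmw_class_eq free_alg_simps using zero by blast
  qed
qed

lemma bmw_class_simps:
  assumes "f \<in> carrier (free_alg n)" "g \<in> carrier (free_alg n)"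
  shows "bmw_class n f \<otimes>\<^bsub>bmw n\<^esub> bmw_class n g = bmw_class n (f * g)"
    and "bmw_class n f \<oplus>\<^bsub>bmw n\<^esub> bmw_class n g = bmw_class n (f + g)"
  using ring_hom_mult[OF bmw_class_hom assms] ring_hom_add[OF bmw_class_hom assms]
  by (simp_all add: free_alg_simps(2-))

lemma bmw_one: "\<one>\<^bsub>bmw n\<^esub> = bmw_class n 1"
  using ring_hom_one[OF bmw_class_hom, of n] by (simp add: free_alg_simps(2-))

lemma bmw_incl_hom: "bmw_incl n \<in> ring_hom (bmw n) (bmw (n + 1))"
proof -
  define m where "m = n + 1"
  have sub: "f \<in> carrier (free_alg m)" if "f \<in> carrier (free_alg n)" for f
    using that free_alg_mono[of n m] by (auto simp: m_def)
  have incl: "bmw_incl n (bmw_class n f) = bmw_class m f" for f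
    unfolding m_def by (rule bmw_incl_class)
  have "bmw_incl n \<in> ring_hom (bmw n) (bmw m)"
  proof (rule ring_hom_memI)
    fix x assume "x \<in> carrier (bmw n)"
    then obtain f where f: "f \<in> carrier (free_alg n)" "x = bmw_class n f"
      unfolding bmw_carrier by blast
    show "bmw_incl n x \<in> carrier (bmw m)"
      unfolding bmw_carrier f(2) incl using f(1) sub by blast
    fix y assume "y \<in> carrier (bmw n)"
    then obtain g where g: "g \<in> carrier (free_alg n)" "y = bmw_class n g"
      unfolding bmw_carrier by blast
    show "bmw_incl n (x \<otimes>\<^bsub>bmw n\<^esub> y) = bmw_incl n x \<otimes>\<^bsub>bmw m\<^esub> bmw_incl n y"
      "bmw_incl n (x \<oplus>\<^bsub>bmw n\<^esub> y) = bmw_incl n x \<oplus>\<^bsub>bmw m\<^esub> bmw_incl n y"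
      unfolding f(2) g(2) incl bmw_class_simps[OF f(1) g(1)]
        bmw_class_simps[OF sub[OF f(1)] sub[OF g(1)]] by (rule refl)+
  next
    show "bmw_incl n \<one>\<^bsub>bmw n\<^esub> = \<one>\<^bsub>bmw m\<^esub>"
      unfolding bmw_one incl by (rule refl)
  qed
  then show ?thesis unfolding m_def .
qed

lemma bmw_incl_s: "bmw_incl n (bmw_s n i) = bmw_s (n + 1) i"
  unfolding bmw_s_def by (rule bmw_incl_class)

lemma scalar_commute: "scalar c * f = f * scalar c"
proof (induction f rule: update_induct)
  case const
  then show ?case by simp
next
  case (update f k v)
  have "Poly_Mapping.update k v f = f + Poly_Mapping.single k v"
    using update.hyps
    by (intro poly_mapping_eqI)
      (auto simp: lookup_update lookup_add lookup_single when_def in_keys_iff)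
  then show ?case
    using update.IH
    by (simp add: scalar_def mult_single distrib_left distrib_right mult.commute[of c v])
qed

lemma bmw_scale_class:
  "f \<in> carrier (free_alg n) \<Longrightarrow> bmw_scale n c (bmw_class n f) = bmw_class n (scalar c * f)"
  unfolding bmw_scale_def by (rule bmw_class_simps(1)[OF scalar_closed])

end

(* Modulo the ideals, commutators and the stabilization rule, every element of the algebras BMW_n
   reduces to an R-linear combination of the symbols 1_n (n >= 1) and e_1 in BMW_2; this gives
   uniqueness.  It uses BMW_(n+1) = A + A s_n A + A e_n A with A = BMW_n, the move of strands by
   conjugation with s_l ... s_n, and e_n = e_n e_(n-1) e_n, e_(n-1) e_n = e_(n-1) s_n s_(n-1).

   Existence amounts to the linear independence of these symbols, which is detected by quantum traces
   over the complex numbers.  The R-matrices of GL_N give traces for every a that kill e_1 and send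
   1_n to x^n for infinitely many x, so all coefficients of the 1_n vanish; the R-matrices of O_2M
   with a = q^(2M-1) send e_1 to a nonzero number, so the coefficient of e_1 vanishes at Zariski
   densely many points (a, q).  The braid relation for these R-matrices needs checking on weakly
   decreasing basis vectors only: since cups and caps slide through crossings, the set of vectors on
   which it holds is stable under both operators. *)

theory Submission
  imports Defs
begin

text \<open>Stabilization links \<open>BMW_(n+1)\<close> to \<open>BMW_n\<close> only across an
  occurrence of \<open>s_n\<close>. For an element of \<open>BMW_n\<close> read in
  \<open>BMW_(n+1)\<close> no relation removes the idle last strand; this is why all values at
  \<open>1\<close> are free parameters, and why induction on \<open>n\<close> alone cannot work.
  What decreases instead is the width of the block of strands \<open>l, ..., m\<close> that ends at
  the last strand \<open>m\<close> and carries all generators: conjugation moves an idle last strand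
  to the left end of the block, which narrows it while \<open>m\<close> stays fixed. Such reductions
  involve choices, so they form a relation, and its single-valuedness is the whole existence
  problem. Two results for one element are formal combinations on which all traces agree. Neither
  family of traces suffices alone. In type O the parameter \<open>a\<close> is tied to
  \<open>q\<close>, and the values at \<open>e_1\<close> and at the \<open>1_n\<close> occur
  together. In type GL the parameter \<open>a\<close> is only a scaling of the trace, and the values
  at the \<open>1_n\<close> are powers of one number, so the relation becomes a polynomial with
  infinitely many roots; but \<open>e_1\<close> is invisible. Once the other coefficients are gone,
  a nonzero value at \<open>e_1\<close> is all that type O has to supply.\<close>

section \<open>R-matrices of type GL and O\<close>

text \<open>The index set \<open>J\<close> is either closed under negation (orthogonal case, \<open>- i\<close> is the index dual to
  \<open>i\<close>) or disjoint from its negative (general linear case); in the latter case \<open>T\<close>, \<open>TT\<close> and \<open>dd\<close> are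
  void. The weights \<open>t\<close> are those of the cup and the cap, \<open>d\<close> is the diagonal of the quantum trace.\<close>

locale bmw_rmatrix =
  fixes J :: "int set" and q qi a ai z :: "'k::field" and t d :: "int \<Rightarrow> 'k"
  assumes fin: "finite J" and nz: "0 \<notin> J"
    and sym: "i \<in> J \<Longrightarrow> - i \<in> J \<Longrightarrow> k \<in> J \<Longrightarrow> - k \<in> J"
    and qq: "q * qi = 1" and aa: "a * ai = 1" and z_def: "z = q - qi"
    and tt: "i \<in> J \<Longrightarrow> t i * t (- i) = 1"
    and T: "k \<in> J \<Longrightarrow> - k \<in> J \<Longrightarrow>
      z * (\<Sum>j\<in>{j\<in>J. j < k}. t j * t j) = qi * (t k * t k) + (if k > 0 then z else 0) - ai"
    and TT: "k \<in> J \<Longrightarrow> - k \<in> J \<Longrightarrow> z * (\<Sum>j\<in>J. t j * t j) = a - ai + z"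
    and dd: "i \<in> J \<Longrightarrow> - i \<in> J \<Longrightarrow> d i * d (- i) = 1"
    and D: "i \<in> J \<Longrightarrow> q * d i + z * (\<Sum>j\<in>{j\<in>J. i < j}. d j)
      - (if - i \<in> J \<and> i < 0 then z * (t i * t i * d (- i)) else 0) = a"
begin

text \<open>Operators act on functions of basis indices: \<open>s f i j\<close> is the value of the linear form \<open>f\<close> at the
  image of \<open>v\<^sub>i \<otimes> v\<^sub>j\<close> under the R-matrix.\<close>

definition s :: "(int \<Rightarrow> int \<Rightarrow> 'k) \<Rightarrow> int \<Rightarrow> int \<Rightarrow> 'k" where
  "s f i j = (if j = - i then qi * f (- i) i + (if i < 0 then z * f i (- i) else 0)
      - z * t i * (\<Sum>k\<in>{k\<in>J. k < - i}. t k * f k (- k))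
    else if i = j then q * f i i else f j i + (if i < j then z * f i j else 0))"

text \<open>Rank one: the cap with value \<open>t i\<close> on \<open>v_i \<otimes> v_(- i)\<close>,
  followed by the cup with the same weights, written on linear forms.\<close>

definition e :: "(int \<Rightarrow> int \<Rightarrow> 'k) \<Rightarrow> int \<Rightarrow> int \<Rightarrow> 'k" where
  "e f i j = (if j = - i then t i * (\<Sum>k\<in>J. t k * f k (- k)) else 0)"

text \<open>On forms the order of composition is reversed: \<open>s2 (s1 g)\<close> evaluates
  \<open>g\<close> after the R-matrix has acted on positions 2, 3 and then on positions 1,
  2.\<close>

abbreviation (input) s1 where "s1 F \<equiv> \<lambda>i j k. s (\<lambda>x y. F x y k) i j"
abbreviation (input) s2 where "s2 F \<equiv> \<lambda>i j k. s (F i) j k"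
abbreviation (input) e1 where "e1 F \<equiv> \<lambda>i j k. e (\<lambda>x y. F x y k) i j"
abbreviation (input) e2 where "e2 F \<equiv> \<lambda>i j k. e (F i) j k"

lemma J0: "i \<in> J \<Longrightarrow> i \<noteq> 0" using nz by auto

text \<open>Difference of the closed forms \<open>T\<close> at \<open>m\<close> and at
  \<open>i\<close>; removing the term at \<open>i\<close> itself turns \<open>qi\<close> into
  \<open>q\<close>, because \<open>q = z + qi\<close>.\<close>

lemma range_sum:
  assumes "i \<in> J" "- i \<in> J" "m \<in> J"
  shows "z * (\<Sum>k\<in>{k\<in>J. i < k \<and> k < m}. t k * t k) =
    (if i < m then qi * (t m * t m) + (if m > 0 then z else 0) - q * (t i * t i) - (if i > 0 then z else 0) else 0)"
proof (cases "i < m")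
  case True
  have *: "{j\<in>J. j < m} = insert i ({j\<in>J. j < i} \<union> {k\<in>J. i < k \<and> k < m})"
    using assms True by auto
  have "(\<Sum>j\<in>{j\<in>J. j < m}. t j * t j) = t i * t i +
     ((\<Sum>j\<in>{j\<in>J. j < i}. t j * t j) + (\<Sum>k\<in>{k\<in>J. i < k \<and> k < m}. t k * t k))"
    unfolding * by (subst sum.insert) (use fin in \<open>auto intro!: sum.union_disjoint\<close>)
  then have "z * (\<Sum>j\<in>{j\<in>J. j < m}. t j * t j) = z * (t i * t i) +
     (z * (\<Sum>j\<in>{j\<in>J. j < i}. t j * t j) + z * (\<Sum>k\<in>{k\<in>J. i < k \<and> k < m}. t k * t k))"
    by (simp add: algebra_simps)
  moreover have "q * (t i * t i) = z * (t i * t i) + qi * (t i * t i)"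
    by (simp add: z_def algebra_simps)
  ultimately show ?thesis
    using T[of i] T[of m] sym[of i m] assms True by simp
next
  case False
  then have *: "{k\<in>J. i < k \<and> k < m} = {}" by auto
  show ?thesis using False unfolding * by simp
qed

section \<open>Naturality: strands slide through caps and cups\<close>

lemma s_cap1:
  fixes G :: "int \<Rightarrow> 'k"
  assumes "x \<in> J" "y \<in> J" "c \<in> J"
  defines "g \<equiv> \<lambda>x y c. if c = - y then t y * G x else 0"
  shows "s1 g x y c = (if y = - x then (if c = - x then qi * t x * G (- x) else 0)
       + (if c = x \<and> x < 0 then z * t (- x) * G x else 0)
       - (if c < - x then z * t x * G c else 0)
     else if x = y then (if c = - x then q * t x * G x else 0)
     else (if c = - x then t x * G y else 0) + (if c = - y \<and> x < y then z * t y * G x else 0))"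
proof -
  \<comment> \<open>The cap on positions 2 and 3 sees only the term \<open>k = c\<close>, whose
    weights cancel by \<open>tt\<close>.\<close>
  have "(\<Sum>k\<in>{k\<in>J. k < - x}. t k * g k (- k) c) = (\<Sum>k\<in>{k\<in>J. k < - x}. if k = c then G c else 0)"
    using tt by (intro sum.cong) (auto simp: g_def mult.assoc[symmetric])
  also have "\<dots> = (if c < - x then G c else 0)"
    using fin assms by (subst sum.delta) auto
  finally show ?thesis using J0[of x] assms(1-3)
    by (auto simp: s_def g_def)
qed

text \<open>In terms of vectors this is \<open>cap_23 R_12 R_23 = cap_12\<close>. The long sum in
  the outer \<open>s\<close> enters only for \<open>l = - j\<close>; its quadratic part there is a
  range sum of the \<open>t k * t k\<close>, for which \<open>range_sum\<close> gives a closed form,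
  and what remains is a comparison of \<open>i\<close> with \<open>j\<close> and
  \<open>- j\<close>.\<close>

lemma cap_natural:
  fixes G :: "int \<Rightarrow> 'k"
  assumes J: "i \<in> J" "j \<in> J" "l \<in> J"
  defines "g \<equiv> \<lambda>x y c. if c = - y then t y * G x else 0"
  shows "s2 (s1 g) i j l = (if j = - i then t i * G l else 0)"
proof (cases "l = - j")
  case l: True
  have mi: "- i \<in> J" "- j \<in> J" using sym[of j i] l J by auto
  have ti: "t (- i) * t i = 1" "t i * t (- i) = 1" using tt[of i] J by (auto simp: mult.commute)
  have tj: "t (- j) * t j = 1" "t j * t (- j) = 1" using tt[of j] J by (auto simp: mult.commute)
  have "(\<Sum>k\<in>{k\<in>J. k < - j}. t k * s1 g i k (- k)) =
     (\<Sum>k\<in>{k\<in>J. k < - j}. (if i < k then z * (t k * t k) * G i else 0)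
       + (if k = i then q * (t i * t i) * G i else 0) - (if k = - i then (if i < 0 then z * G i else 0) else 0))"
  proof (rule sum.cong[OF refl])
    fix k assume k: "k \<in> {k\<in>J. k < - j}"
    then have kJ: "k \<in> J" "- k \<in> J" using sym[OF J(1) mi(1)] by auto
    show "t k * s1 g i k (- k) = (if i < k then z * (t k * t k) * G i else 0)
       + (if k = i then q * (t i * t i) * G i else 0) - (if k = - i then (if i < 0 then z * G i else 0) else 0)"
      using kJ J ti J0[of i] J0[of k] unfolding g_def s_cap1[OF J(1) kJ(1) kJ(2)]
      apply (auto simp: algebra_simps)
      done
  qed
  also have "\<dots> = z * (\<Sum>k\<in>{k\<in>J. i < k \<and> k < - j}. t k * t k) * G i
      + (if i < - j then q * (t i * t i) * G i else 0) - (if - i < - j \<and> i < 0 then z * G i else 0)"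
  proof -
    have "(\<Sum>k\<in>{k\<in>J. k < - j}. (if i < k then z * (t k * t k) * G i else 0)) =
      (\<Sum>k\<in>{k\<in>J. i < k \<and> k < - j}. z * (t k * t k) * G i)"
      using fin by (intro sum.mono_neutral_cong_right) auto
    then show ?thesis
      using fin J mi by (simp add: sum.distrib sum_subtractf sum.delta sum_distrib_left sum_distrib_right)
  qed
  finally have S: "(\<Sum>k\<in>{k\<in>J. k < - j}. t k * s1 g i k (- k)) =
     (if i < - j then qi * (t (- j) * t (- j)) + (if - j > 0 then z else 0)
          - (if i > 0 then z else 0) else 0) * G i
       - (if - i < - j \<and> i < 0 then z * G i else 0)"
    unfolding range_sum[OF J(1) mi] by (auto simp: algebra_simps)
  have h1: "s1 g i (- j) j = (if - j = - i then (if j = - i then qi * t i * G (- i) else 0)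
       + (if j = i \<and> i < 0 then z * t (- i) * G i else 0)
       - (if j < - i then z * t i * G j else 0)
     else if i = - j then (if j = - i then q * t i * G i else 0)
     else (if j = - i then t i * G (- j) else 0) + (if i < - j then z * t (- j) * G i else 0))"
    using s_cap1[OF J(1) mi(2) J(2), of G] by (simp add: g_def)
  have h2: "s1 g i j (- j) = (if j = - i then (if j = i then qi * t i * G (- i) else 0)
       + (if - j = i \<and> i < 0 then z * t (- i) * G i else 0)
       - (if - j < - i then z * t i * G (- j) else 0)
     else if i = j then (if - j = - i then q * t i * G i else 0)
     else (if - j = - i then t i * G j else 0) + (if i < j then z * t j * G i else 0))"
    using s_cap1[OF J(1) J(2) mi(2), of G] by (simp add: g_def)
  have *: "s2 (s1 g) i j l = qi * s1 g i (- j) j + (if j < 0 then z * s1 g i j (- j) else 0) 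
     - z * t j * (\<Sum>k\<in>{k\<in>J. k < - j}. t k * s1 g i k (- k))"
    by (simp add: s_def[of "s1 g i"] l)
  have "q * (qi * x) = x" "qi * (q * x) = x" for x
    using qq by (simp_all add: mult.assoc[symmetric] mult.commute)
  note qq' = this
  have tj': "t j * (t (- j) * x) = x" "t (- j) * (t j * x) = x" for x
    using tj by (simp_all add: mult.assoc[symmetric])
  have ti': "t i * (t (- i) * x) = x" "t (- i) * (t i * x) = x" for x
    using ti by (simp_all add: mult.assoc[symmetric])
  note i0 = J0[OF J(1)] and j0 = J0[OF J(2)]
  consider "j = - i" | "j = i" "i < 0" | "j = i" "i > 0" | "j \<noteq> i" "j \<noteq> - i" "i < - j" | "j \<noteq> i" "j \<noteq> - i" "- j < i"
    using i0 by linarith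
  then show ?thesis
  proof cases
    case 1
    then show ?thesis unfolding S h1 h2 * using i0 l by (simp add: qq' algebra_simps)
  next
    case 2
    then show ?thesis unfolding S h1 h2 * using i0 l ti ti' by (simp add: z_def qq' algebra_simps)
  next
    case 3
    then show ?thesis unfolding S h1 h2 * using i0 l ti by (simp add: qq' algebra_simps)
  next
    case 4
    then show ?thesis unfolding S h1 h2 * using i0 j0 l tj tj' by (auto simp: qq' algebra_simps)
  next
    case 5
    then show ?thesis unfolding S h1 h2 * using i0 j0 l by (auto simp: algebra_simps)
  qed
next
  case l: False
  show ?thesis
    unfolding s_def[of "s1 g i"]
    using s_cap1[OF J(1) J(2) J(3), of G] s_cap1[OF J(1) J(3) J(2), of G]
      s_cap1[OF J(1) J(2) J(2), of G] J0[of i] J0[of j] J0[of l] J l qq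
    by (auto simp: g_def)
qed

text \<open>The matrix of the R-matrix. Its symmetry is visible because \<open>x < - i\<close> is
  symmetric in \<open>x\<close> and \<open>i\<close>; it allows \<open>s\<close> to be transposed
  and commuting sums to be exchanged.\<close>

definition K :: "int \<Rightarrow> int \<Rightarrow> int \<Rightarrow> int \<Rightarrow> 'k" where
  "K i j x y = (if j = - i then
       (if x = - i \<and> y = i then qi else 0) + (if i < 0 \<and> x = i \<and> y = - i then z else 0)
       - (if y = - x \<and> x < - i then z * t i * t x else 0)
     else if i = j then (if x = i \<and> y = i then q else 0)
     else (if x = j \<and> y = i then 1 else 0) + (if i < j \<and> x = i \<and> y = j then z else 0))"

lemma K_sym: "K i j x y = K x y i j"
  unfolding K_def by (auto simp: mult_ac)

lemma sum_delta2:
  assumes "x0 \<in> J" "y0 \<in> J"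
  shows "(\<Sum>x\<in>J. \<Sum>y\<in>J. (if x = x0 \<and> y = y0 then c else 0) * f x y) = (c * f x0 y0 :: 'k)"
proof -
  have "(\<Sum>x\<in>J. \<Sum>y\<in>J. (if x = x0 \<and> y = y0 then c else 0) * f x y) =
    (\<Sum>x\<in>J. if x = x0 then c * f x0 y0 else 0)"
  proof (rule sum.cong[OF refl])
    fix x
    have "(\<Sum>y\<in>J. (if x = x0 \<and> y = y0 then c else 0) * f x y) =
       (\<Sum>y\<in>J. if y = y0 then (if x = x0 then c * f x0 y0 else 0) else 0)"
      by (rule sum.cong) auto
    then show "(\<Sum>y\<in>J. (if x = x0 \<and> y = y0 then c else 0) * f x y) = (if x = x0 then c * f x0 y0 else 0)"
      using fin assms by simp
  qed
  then show ?thesis using fin assms by simp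
qed

lemma s_kernel:
  assumes "i \<in> J" "j \<in> J"
  shows "s f i j = (\<Sum>x\<in>J. \<Sum>y\<in>J. K i j x y * f x y)"
proof (cases "j = - i")
  case j: True
  have "(\<Sum>x\<in>J. \<Sum>y\<in>J. (if y = - x \<and> x < - i then z * t i * t x else 0) * f x y) =
     (\<Sum>x\<in>J. if x < - i then z * t i * t x * f x (- x) else 0)"
  proof (rule sum.cong[OF refl])
    fix x assume x: "x \<in> J"
    have "(\<Sum>y\<in>J. (if y = - x \<and> x < - i then z * t i * t x else 0) * f x y) =
       (\<Sum>y\<in>J. if y = - x then (if x < - i then z * t i * t x * f x (- x) else 0) else 0)"
      by (rule sum.cong) auto
    then show "(\<Sum>y\<in>J. (if y = - x \<and> x < - i then z * t i * t x else 0) * f x y) =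
      (if x < - i then z * t i * t x * f x (- x) else 0)"
      using fin x sym[of i x] assms j by simp
  qed
  also have "\<dots> = z * t i * (\<Sum>k\<in>{k\<in>J. k < - i}. t k * f k (- k))"
    using fin by (simp add: sum.inter_filter[symmetric] sum_distrib_left mult_ac)
  finally have 1: "(\<Sum>x\<in>J. \<Sum>y\<in>J. (if y = - x \<and> x < - i then z * t i * t x else 0) * f x y) =
    z * t i * (\<Sum>k\<in>{k\<in>J. k < - i}. t k * f k (- k))" .
  have 2: "(\<Sum>x\<in>J. \<Sum>y\<in>J. (if i < 0 \<and> x = i \<and> y = - i then z else 0) * f x y) = (if i < 0 then z * f i (- i) else 0)"
    using sum_delta2[of i "- i" z f] assms j by simp
  have 3: "(\<Sum>x\<in>J. \<Sum>y\<in>J. (if x = - i \<and> y = i then qi else 0) * f x y) = qi * f (- i) i"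
    using sum_delta2[of "- i" i qi f] assms j by simp
  show ?thesis
    using j by (simp add: K_def s_def distrib_right left_diff_distrib sum.distrib sum_subtractf 1 2 3)
next
  case j: False
  show ?thesis
  proof (cases "i = j")
    case True
    then show ?thesis
      using j assms sum_delta2[of i i q f] by (simp add: K_def s_def)
  next
    case False
    then show ?thesis
      using j assms sum_delta2[of j i 1 f] sum_delta2[of i j z f]
      by (simp add: K_def s_def distrib_right sum.distrib)
  qed
qed

lemma sum_rotate:
  "(\<Sum>x\<in>J. \<Sum>y\<in>J. \<Sum>c\<in>J. F x y c) = (\<Sum>c\<in>J. \<Sum>x\<in>J. \<Sum>y\<in>J. F x y c :: 'k)"
proof -
  have "(\<Sum>x\<in>J. \<Sum>y\<in>J. \<Sum>c\<in>J. F x y c) = (\<Sum>x\<in>J. \<Sum>c\<in>J. \<Sum>y\<in>J. F x y c)"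
    by (intro sum.cong refl sum.swap)
  also have "\<dots> = (\<Sum>c\<in>J. \<Sum>x\<in>J. \<Sum>y\<in>J. F x y c)"
    by (rule sum.swap)
  finally show ?thesis .
qed

text \<open>By symmetry of \<open>K\<close>, \<open>s\<close> is self-adjoint for the standard
  bilinear form, so each law about caps has a transposed law about cups.\<close>

lemma s_adjoint:
  "(\<Sum>i\<in>J. \<Sum>j\<in>J. s f i j * g i j) = (\<Sum>i\<in>J. \<Sum>j\<in>J. f i j * s g i j)"
proof -
  have "(\<Sum>i\<in>J. \<Sum>j\<in>J. s f i j * g i j) = (\<Sum>i\<in>J. \<Sum>j\<in>J. \<Sum>x\<in>J. \<Sum>y\<in>J. K i j x y * f x y * g i j)"
    by (simp add: s_kernel sum_distrib_right)
  also have "\<dots> = (\<Sum>x\<in>J. \<Sum>y\<in>J. \<Sum>i\<in>J. \<Sum>j\<in>J. K i j x y * f x y * g i j)"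
    unfolding sum_rotate[of "\<lambda>i j x. \<Sum>y\<in>J. K i j x y * f x y * g i j"]
    by (intro sum.cong refl sum_rotate)
  also have "\<dots> = (\<Sum>x\<in>J. \<Sum>y\<in>J. \<Sum>i\<in>J. \<Sum>j\<in>J. f x y * (K x y i j * g i j))"
    by (intro sum.cong refl) (metis K_sym mult.assoc mult.commute)
  also have "\<dots> = (\<Sum>i\<in>J. \<Sum>j\<in>J. f i j * s g i j)"
    by (simp add: s_kernel sum_distrib_left)
  finally show ?thesis .
qed

text \<open>The reflection \<open>(i, j) \<mapsto> (- j, - i)\<close> fixes each dual pair and
  preserves the comparison of the two indices. On three strands it exchanges positions 1, 2 with
  positions 2, 3.\<close>

lemma s_rev: "s (\<lambda>x y. f (- y) (- x)) i j = s f (- j) (- i)"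
  unfolding s_def by auto

lemma cap_natural':
  fixes G :: "int \<Rightarrow> 'k"
  assumes "i \<in> J" "j \<in> J" "l \<in> J" "- l \<in> J"
  defines "g \<equiv> \<lambda>x y c. if y = - x then t x * G c else 0"
  shows "s1 (s2 g) i j l = (if l = - j then t j * G i else 0)"
proof -
  define h where "h = (\<lambda>x y c. if c = - y then t y * G (- x) else 0)"
  have g: "g = (\<lambda>x y c. h (- c) (- y) (- x))"
    unfolding g_def h_def by (auto simp: fun_eq_iff)
  have s2g: "s (g x) y c = s1 h (- c) (- y) (- x)" for x y c
    unfolding g by (rule s_rev[of "\<lambda>u v. h u v (- x)"])
  have "s1 (s2 g) i j l = s2 (s1 h) (- l) (- j) (- i)"
    unfolding s2g by (rule s_rev[of "s1 h (- l)"])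
  also have "\<dots> = (if - j = l then t (- l) * G i else 0)"
    unfolding h_def using cap_natural[of "- l" "- j" "- i" "\<lambda>x. G (- x)"] assms sym[of l] by auto
  finally show ?thesis using assms by auto
qed

lemma s_linear: "s (\<lambda>x y. f x y + c * g x y) i j = s f i j + c * s g i j"
  by (simp add: s_def sum.distrib sum_distrib_left sum_distrib_right algebra_simps)

text \<open>Pair \<open>s2 (s1 f)\<close> with the cup, move both operators to the other side by
  \<open>s_adjoint\<close>, and evaluate them there by \<open>cap_natural'\<close>. One function
  serves as cup and as cap since both have the weights \<open>t\<close>.\<close>

lemma cup_natural:
  assumes "l \<in> J" "- l \<in> J"
  shows "(\<Sum>k\<in>J. t k * s2 (s1 f) k (- k) l) = (\<Sum>k\<in>J. t k * f l k (- k))"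
proof -
  define g where "g = (\<lambda>x y c. if y = - x then t x * (if c = l then 1 else 0) else 0)"
  have "(\<Sum>k\<in>J. t k * s2 (s1 f) k (- k) l) = (\<Sum>x\<in>J. \<Sum>y\<in>J. \<Sum>c\<in>J. s2 (s1 f) x y c * g x y c)"
  proof (rule sum.cong[OF refl])
    fix x assume x: "x \<in> J"
    have "(\<Sum>y\<in>J. \<Sum>c\<in>J. s2 (s1 f) x y c * g x y c) =
       (\<Sum>y\<in>J. \<Sum>c\<in>J. (if y = - x \<and> c = l then t x else 0) * s2 (s1 f) x y c)"
      by (intro sum.cong) (auto simp: g_def)
    also have "\<dots> = t x * s2 (s1 f) x (- x) l"
      using sym[OF assms x] assms x by (intro sum_delta2) auto
    finally show "t x * s2 (s1 f) x (- x) l = (\<Sum>y\<in>J. \<Sum>c\<in>J. s2 (s1 f) x y c * g x y c)" by simp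
  qed
  also have "\<dots> = (\<Sum>x\<in>J. \<Sum>y\<in>J. \<Sum>c\<in>J. s1 f x y c * s2 g x y c)"
    by (simp add: s_adjoint)
  also have "\<dots> = (\<Sum>c\<in>J. \<Sum>x\<in>J. \<Sum>y\<in>J. s1 f x y c * s2 g x y c)"
    by (rule sum_rotate)
  also have "\<dots> = (\<Sum>c\<in>J. \<Sum>x\<in>J. \<Sum>y\<in>J. f x y c * s1 (s2 g) x y c)"
    by (simp add: s_adjoint[of "\<lambda>x y. f x y _" "\<lambda>x y. s2 g x y _"])
  also have "\<dots> = (\<Sum>x\<in>J. \<Sum>y\<in>J. \<Sum>c\<in>J. f x y c * s1 (s2 g) x y c)"
    by (rule sum_rotate[symmetric])
  also have "\<dots> = (\<Sum>x\<in>J. \<Sum>y\<in>J. \<Sum>c\<in>J. f x y c * (if c = - y then t y * (if x = l then 1 else 0) else 0))"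
    using sym[OF assms] unfolding g_def
    by (intro sum.cong refl arg_cong2[where f = "(*)"] cap_natural') auto
  also have "\<dots> = (\<Sum>x\<in>J. \<Sum>y\<in>J. if x = l then t y * f l y (- y) else 0)"
  proof (intro sum.cong refl)
    fix x y assume y: "y \<in> J"
    have "(\<Sum>c\<in>J. f x y c * (if c = - y then t y * (if x = l then 1 else 0) else 0)) =
      (\<Sum>c\<in>J. if c = - y then (if x = l then t y * f l y (- y) else 0) else 0)"
      by (intro sum.cong) auto
    then show "(\<Sum>c\<in>J. f x y c * (if c = - y then t y * (if x = l then 1 else 0) else 0)) = (if x = l then t y * f l y (- y) else 0)"
      using fin sym[OF assms y] by simp
  qed
  also have "\<dots> = (\<Sum>y\<in>J. \<Sum>x\<in>J. if x = l then t y * f l y (- y) else 0)"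
    by (rule sum.swap)
  also have "\<dots> = (\<Sum>k\<in>J. t k * f l k (- k))"
    using fin assms by simp
  finally show ?thesis .
qed

section \<open>Kink, loop and skein relations\<close>

lemma delta_filter:
  "(\<Sum>k\<in>{k\<in>J. P k}. if k = b then c k else 0) = (if b \<in> J \<and> P b then c b else (0::'k))"
  using fin by simp

text \<open>The assumption \<open>T\<close> is this eigenvalue equation: at the pair
  \<open>(i, - i)\<close> the partial sum below \<open>- i\<close> has to complete the first two
  terms of \<open>s\<close> to the kink factor \<open>ai\<close>.\<close>

lemma s_cup:
  assumes "i \<in> J" "j \<in> J"
  shows "s (\<lambda>x y. if y = - x then t x * c else 0) i j = ai * (if j = - i then t i * c else 0)"
proof (cases "j = - i")
  case True
  have *: "t i * t (- i) = 1" "t i * (t (- i) * x) = x" for x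
    using tt[of i] assms by (simp_all add: mult.assoc[symmetric])
  have "z * (\<Sum>k\<in>{k\<in>J. k < - i}. t k * (t k * c)) = z * (\<Sum>k\<in>{k\<in>J. k < - i}. t k * t k) * c"
    by (simp add: sum_distrib_right mult.assoc)
  also have "\<dots> = (qi * (t (- i) * t (- i)) + (if i < 0 then z else 0) - ai) * c"
    using T[of "- i"] assms True by simp
  finally have "z * t i * (\<Sum>k\<in>{k\<in>J. k < - i}. t k * (t k * c)) =
    t i * ((qi * (t (- i) * t (- i)) + (if i < 0 then z else 0) - ai) * c)"
    by (simp add: mult_ac)
  then show ?thesis using True * by (auto simp: s_def algebra_simps)
next
  case False
  then show ?thesis by (auto simp: s_def)
qed

lemma s_e: "i \<in> J \<Longrightarrow> j \<in> J \<Longrightarrow> s (e f) i j = ai * e f i j"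
  unfolding e_def[abs_def] by (rule s_cup)

lemma sum_cup:
  assumes "i \<in> J" "- i \<in> J"
  shows "(\<Sum>x\<in>J. \<Sum>y\<in>J. f x y * (if y = - x then t x * c else 0)) = (\<Sum>k\<in>J. t k * f k (- k)) * c"
proof -
  have "(\<Sum>y\<in>J. f x y * (if y = - x then t x * c else 0)) = t x * f x (- x) * c" if "x \<in> J" for x
  proof -
    have "(\<Sum>y\<in>J. f x y * (if y = - x then t x * c else 0)) = (\<Sum>y\<in>J. if y = - x then f x (- x) * (t x * c) else 0)"
      by (rule sum.cong) auto
    then show ?thesis using fin sym[OF assms that] by (simp add: mult_ac)
  qed
  then show ?thesis by (simp add: sum_distrib_right)
qed

text \<open>Transpose of \<open>s_cup\<close>: the cap is the same vector as the cup, and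
  \<open>s\<close> is self-adjoint.\<close>

lemma e_s:
  assumes "i \<in> J" "j \<in> J"
  shows "e (s f) i j = ai * e f i j"
proof (cases "j = - i")
  case True
  with assms have J: "i \<in> J" "- i \<in> J" by auto
  have "(\<Sum>k\<in>J. t k * s f k (- k)) = (\<Sum>x\<in>J. \<Sum>y\<in>J. s f x y * (if y = - x then t x * 1 else 0))"
    using sum_cup[OF J, of "s f" 1] by simp
  also have "\<dots> = (\<Sum>x\<in>J. \<Sum>y\<in>J. f x y * (if y = - x then t x * ai else 0))"
  proof -
    have "s (\<lambda>x y. if y = - x then t x * 1 else 0) x y = (if y = - x then t x * ai else 0)"
      if "x \<in> J" "y \<in> J" for x y
      unfolding s_cup[OF that] by simp
    then show ?thesis
      unfolding s_adjoint by (intro sum.cong refl arg_cong2[where f = "(*)"])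
  qed
  also have "\<dots> = (\<Sum>k\<in>J. t k * f k (- k)) * ai"
    by (rule sum_cup[OF J])
  finally show ?thesis by (simp add: e_def mult_ac)
qed (simp add: e_def)

text \<open>The loop value is the sum of all \<open>t j * t j\<close>, that is
  \<open>(a - ai) / z + 1\<close> by \<open>TT\<close>; the factor \<open>z\<close> avoids the
  division.\<close>

lemma e_e:
  assumes "i \<in> J" "j \<in> J"
  shows "z * e (e f) i j = (a - ai + z) * e f i j"
proof (cases "j = - i")
  case True
  define E where "E = (\<Sum>k\<in>J. t k * f k (- k))"
  have "(\<Sum>k\<in>J. t k * (t k * E)) = (\<Sum>k\<in>J. t k * t k) * E"
    by (simp add: sum_distrib_right mult.assoc)
  then have "e (e f) i j = t i * ((\<Sum>k\<in>J. t k * t k) * E)"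
    using True by (simp add: e_def E_def[symmetric])
  then have "z * e (e f) i j = (z * (\<Sum>k\<in>J. t k * t k)) * (t i * E)"
    by (simp only: mult_ac)
  also have "\<dots> = (a - ai + z) * (t i * E)"
    using TT[of i] assms True by simp
  finally show ?thesis
    using True by (simp add: e_def E_def)
qed (simp add: e_def)

text \<open>Block of the R-matrix on the span of the vectors \<open>v_i \<otimes> v_(- i)\<close>,
  which is stable. Outside this block the R-matrix is that of the Hecke algebra.\<close>

definition \<kappa> :: "int \<Rightarrow> int \<Rightarrow> 'k" where
  "\<kappa> i m = (if m = - i then qi else 0) + (if m = i then (if i < 0 then z else 0) else 0)
     - (if m < - i then z * t i * t m else 0)"

lemma \<kappa>_sum:
  assumes "i \<in> J" "- i \<in> J"
  shows "(\<Sum>m\<in>J. \<kappa> i m * g m) = qi * g (- i) + (if i < 0 then z * g i else 0)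
      - z * t i * (\<Sum>k\<in>{k\<in>J. k < - i}. t k * g k)"
proof -
  have "(\<Sum>m\<in>J. \<kappa> i m * g m) = (\<Sum>m\<in>J. (if m = - i then qi * g (- i) else 0)
      + (if m = i then (if i < 0 then z * g i else 0) else 0) - (if m < - i then z * t i * (t m * g m) else 0))"
    by (intro sum.cong refl) (auto simp: \<kappa>_def algebra_simps)
  then show ?thesis
    using fin assms by (simp add: sum.distrib sum_subtractf sum.inter_filter[symmetric] sum_distrib_left)
qed

lemma s_kappa:
  assumes "i \<in> J" "- i \<in> J"
  shows "s f i (- i) = (\<Sum>m\<in>J. \<kappa> i m * f m (- m))"
  unfolding \<kappa>_sum[OF assms] by (simp add: s_def)

text \<open>The skein relation on the block of dual pairs. The product of two partial sums carries
  both cutoffs \<open>k < - i\<close> and \<open>k < - m\<close>, so \<open>T\<close> is applied at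
  the smaller one, \<open>?\<mu>\<close>.\<close>

lemma \<kappa>_square:
  assumes "i \<in> J" "- i \<in> J" "m \<in> J" "- m \<in> J"
  shows "(\<Sum>k\<in>J. \<kappa> i k * \<kappa> k m) = (if i = m then 1 else 0) + z * \<kappa> i m - z * ai * (t i * t m)"
proof -
  have ti: "t i * t (- i) = 1" "t (- i) * t i = 1" "t i * (t (- i) * x) = x" "t (- i) * (t i * x) = x" for x
    using tt[of i] tt[of "- i"] assms by (simp_all add: mult.assoc[symmetric])
  have tm: "t m * t (- m) = 1" "t (- m) * t m = 1" "t m * (t (- m) * x) = x" "t (- m) * (t m * x) = x" for x
    using tt[of m] tt[of "- m"] assms by (simp_all add: mult.assoc[symmetric])
  have qq': "q * (qi * x) = x" "qi * (q * x) = x" for x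
    using qq by (simp_all add: mult.assoc[symmetric] mult.commute[of qi])
  let ?\<mu> = "min (- i) (- m)"
  have "(\<Sum>k\<in>{k\<in>J. k < - i}. t k * \<kappa> k m) = (\<Sum>k\<in>{k\<in>J. k < - i}.
      (if k = - m then qi * t k else 0) + (if k = m then (if m < 0 then z * t m else 0) else 0)
      - (if k < - m then z * t m * (t k * t k) else 0))"
    by (rule sum.cong) (auto simp: \<kappa>_def algebra_simps)
  also have "\<dots> = (if i < m then qi * t (- m) else 0) + (if m < - i \<and> m < 0 then z * t m else 0)
      - t m * (z * (\<Sum>k\<in>{k\<in>J. k < ?\<mu>}. t k * t k))"
  proof -
    have "(\<Sum>k\<in>{k\<in>J. k < - i}. if k < - m then z * t m * (t k * t k) else 0) = (\<Sum>k\<in>{k\<in>J. k < ?\<mu>}. z * t m * (t k * t k))"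
      using fin by (intro sum.mono_neutral_cong_right) auto
    then show ?thesis using assms
      by (simp add: sum.distrib sum_subtractf delta_filter sum_distrib_left mult_ac)
  qed
  also have "z * (\<Sum>k\<in>{k\<in>J. k < ?\<mu>}. t k * t k) = qi * (t ?\<mu> * t ?\<mu>) + (if ?\<mu> > 0 then z else 0) - ai"
    using T[of ?\<mu>] assms by (auto simp: min_def)
  finally have S: "(\<Sum>k\<in>{k\<in>J. k < - i}. t k * \<kappa> k m) = (if i < m then qi * t (- m) else 0) + (if m < - i \<and> m < 0 then z * t m else 0)
      - t m * (qi * (t ?\<mu> * t ?\<mu>) + (if ?\<mu> > 0 then z else 0) - ai)" .
  note i0 = J0[OF assms(1)] and m0 = J0[OF assms(3)]
  consider "m = - i" "i > 0" | "m = - i" "i < 0" | "m = i" "i > 0" | "m = i" "i < 0" 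
    | "m \<noteq> i" "m \<noteq> - i" "i < m" | "m \<noteq> i" "m \<noteq> - i" "m < i"
    using i0 by linarith
  then show ?thesis
  proof cases
    case 1 then show ?thesis unfolding \<kappa>_sum[OF assms(1,2)] S unfolding \<kappa>_def using i0 ti by (simp add: z_def qq qq' algebra_simps)
  next
    case 2 then show ?thesis unfolding \<kappa>_sum[OF assms(1,2)] S unfolding \<kappa>_def using i0 ti by (simp add: z_def qq qq' algebra_simps)
  next
    case 3 then show ?thesis unfolding \<kappa>_sum[OF assms(1,2)] S unfolding \<kappa>_def using i0 ti by (simp add: z_def qq qq' algebra_simps)
  next
    case 4 then show ?thesis unfolding \<kappa>_sum[OF assms(1,2)] S unfolding \<kappa>_def using i0 ti by (simp add: z_def qq qq' algebra_simps)
  next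
    case 5 then show ?thesis unfolding \<kappa>_sum[OF assms(1,2)] S unfolding \<kappa>_def using i0 m0 ti tm by (auto simp: min_def algebra_simps)
  next
    case 6 then show ?thesis unfolding \<kappa>_sum[OF assms(1,2)] S unfolding \<kappa>_def using i0 m0 ti tm by (auto simp: min_def algebra_simps)
  qed
qed

text \<open>Kauffman skein relation, multiplied by \<open>s\<close>. On dual pairs it is
  \<open>\<kappa>_square\<close>; elsewhere \<open>e\<close> vanishes and the Hecke relation
  \<open>(s - q) (s + qi) = 0\<close> holds.\<close>

lemma s_s:
  assumes "i \<in> J" "j \<in> J"
  shows "s (s f) i j = f i j + z * s f i j - z * ai * e f i j"
proof (cases "j = - i")
  case True
  with assms have J: "i \<in> J" "- i \<in> J" by auto
  have "s (s f) i (- i) = (\<Sum>k\<in>J. \<Sum>m\<in>J. \<kappa> i k * \<kappa> k m * f m (- m))"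
    using sym[OF J] by (simp add: s_kappa[OF J] s_kappa sum_distrib_left mult.assoc)
  also have "\<dots> = (\<Sum>m\<in>J. (\<Sum>k\<in>J. \<kappa> i k * \<kappa> k m) * f m (- m))"
    unfolding sum_distrib_right by (rule sum.swap)
  also have "\<dots> = (\<Sum>m\<in>J. (if i = m then f m (- m) else 0) + z * (\<kappa> i m * f m (- m)) - z * ai * t i * (t m * f m (- m)))"
  proof (rule sum.cong[OF refl])
    fix m assume m: "m \<in> J"
    show "(\<Sum>k\<in>J. \<kappa> i k * \<kappa> k m) * f m (- m) =
      (if i = m then f m (- m) else 0) + z * (\<kappa> i m * f m (- m)) - z * ai * t i * (t m * f m (- m))"
      unfolding \<kappa>_square[OF J m sym[OF J m]] by (simp add: algebra_simps)
  qed
  also have "\<dots> = f i (- i) + z * s f i (- i) - z * ai * e f i (- i)"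
    using fin J by (simp add: sum.distrib sum_subtractf s_kappa[OF J] e_def sum_distrib_left[symmetric] mult.assoc)
  finally show ?thesis using True by simp
next
  case False
  have "q * (qi * x) = x" "qi * (q * x) = x" for x
    using qq by (simp_all add: mult.assoc[symmetric] mult.commute[of qi])
  with False show ?thesis
    unfolding s_def e_def by (auto simp: z_def algebra_simps)
qed

text \<open>The diagonal terms of the inner crossing produce the sum of the \<open>t k * t k\<close>
  above \<open>- l\<close>. It is the total \<open>TT\<close> minus the part below, known from
  \<open>T\<close>; all terms except \<open>a\<close> then cancel.\<close>

lemma e_s_e:
  assumes "i \<in> J" "j \<in> J" "l \<in> J"
  shows "e1 (s2 (e1 f)) i j l = a * e1 f i j l"
proof (cases "j = - i")
  case True
  with assms have J: "i \<in> J" "- i \<in> J" by auto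
  have l: "- l \<in> J" using sym[OF J] assms by auto
  define G where "G = (\<lambda>c. \<Sum>k\<in>J. t k * f k (- k) c)"
  have G: "(\<Sum>k\<in>J. t k * f k (- k) c) = G c" for c by (simp add: G_def)
  have *: "t k * s2 (e1 f) k (- k) l = (if - l < k then z * (t k * t k) * G l else 0)
     - (if k = l then (if 0 < l then z * G l else 0) else 0) + (if k = - l then q * (t k * t k) * G l else 0)"
    if k: "k \<in> J" for k
  proof -
    have tk: "t k * t (- k) = 1" "t (- k) * t k = 1" "t (- k) * (t k * x) = x" "t k * (t (- k) * x) = x" for x
      using tt[OF k] tt[OF sym[OF J k]] by (simp_all add: mult.assoc[symmetric])
    have "(\<Sum>x\<in>{x\<in>J. x < k}. t x * (if x = - k then t k * G (- x) else 0)) = (\<Sum>x\<in>{x\<in>J. x < k}. if x = - k then G k else 0)"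
      by (rule sum.cong) (auto simp: tk)
    also have "\<dots> = (if 0 < k then G k else 0)"
      using sym[OF J k] J0[OF k] by (simp add: delta_filter)
    finally show ?thesis
      using J0[OF k] tk unfolding s_def e_def G by (auto simp: algebra_simps)
  qed
  have "(\<Sum>k\<in>J. t k * s2 (e1 f) k (- k) l) = z * (\<Sum>k\<in>{k\<in>J. - l < k}. t k * t k) * G l
     - (if 0 < l then z * G l else 0) + q * (t (- l) * t (- l)) * G l"
    using fin assms l by (simp add: * sum.distrib sum_subtractf sum.inter_filter[symmetric] sum_distrib_left sum_distrib_right)
  also have "z * (\<Sum>k\<in>{k\<in>J. - l < k}. t k * t k) = z * (\<Sum>k\<in>J. t k * t k) - z * (t (- l) * t (- l))
       - z * (\<Sum>k\<in>{k\<in>J. k < - l}. t k * t k)"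
  proof -
    have **: "J = insert (- l) ({k\<in>J. - l < k} \<union> {k\<in>J. k < - l})" using l by auto
    have "(\<Sum>k\<in>J. t k * t k) = t (- l) * t (- l) + ((\<Sum>k\<in>{k\<in>J. - l < k}. t k * t k) + (\<Sum>k\<in>{k\<in>J. k < - l}. t k * t k))"
      by (subst **, subst sum.insert) (use fin in \<open>auto intro!: sum.union_disjoint\<close>)
    then show ?thesis by (simp add: algebra_simps)
  qed
  also have "\<dots> = a + z - z * (t (- l) * t (- l)) - qi * (t (- l) * t (- l)) - (if l < 0 then z else 0)"
    using TT[OF J] T[of "- l"] assms l by simp
  finally have "(\<Sum>k\<in>J. t k * s2 (e1 f) k (- k) l) = (a + z - z * (t (- l) * t (- l)) - qi * (t (- l) * t (- l))
     - (if l < 0 then z else 0)) * G l - (if 0 < l then z * G l else 0) + q * (t (- l) * t (- l)) * G l" .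
  moreover have "q * (t (- l) * t (- l)) * G l = (z * (t (- l) * t (- l)) + qi * (t (- l) * t (- l))) * G l"
    by (simp add: z_def algebra_simps)
  ultimately have "(\<Sum>k\<in>J. t k * s2 (e1 f) k (- k) l) = a * G l"
    using J0[OF assms(3)] by (cases "0 < l") (auto simp: algebra_simps)
  then show ?thesis using True by (simp add: e_def[of "\<lambda>x y. s2 (e1 f) x y l"] e_def[of "\<lambda>x y. f x y l"] G_def)
qed (simp add: e_def)

text \<open>Straightening a zigzag: of the two nested sums only \<open>k = l\<close> survives, with
  coefficient \<open>1\<close> by \<open>tt\<close>.\<close>

lemma e_e_e:
  assumes "i \<in> J" "j \<in> J" "l \<in> J"
  shows "e1 (e2 (e1 f)) i j l = e1 f i j l"
proof (cases "j = - i")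
  case True
  with assms have J: "i \<in> J" "- i \<in> J" by auto
  define G where "G = (\<lambda>c. \<Sum>k\<in>J. t k * f k (- k) c)"
  have G: "(\<Sum>k\<in>J. t k * f k (- k) c) = G c" for c by (simp add: G_def)
  have *: "t k * e2 (e1 f) k (- k) l = (if k = l then G l else 0)" if k: "k \<in> J" for k
  proof -
    have tk: "t k * t (- k) = 1" "t (- k) * t k = 1" "t (- k) * (t k * x) = x" "t k * (t (- k) * x) = x" for x
      using tt[OF k] tt[OF sym[OF J k]] by (simp_all add: mult.assoc[symmetric])
    have "(\<Sum>x\<in>J. t x * (if x = - k then t k * G (- x) else 0)) = (\<Sum>x\<in>J. if x = - k then G k else 0)"
      by (rule sum.cong) (auto simp: tk)
    then show ?thesis
      using fin sym[OF J k] tk unfolding e_def G by auto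
  qed
  have "(\<Sum>k\<in>J. t k * e2 (e1 f) k (- k) l) = G l"
    using fin assms by (simp add: *)
  then show ?thesis using True by (simp add: e_def[of "\<lambda>x y. e2 (e1 f) x y l"] e_def[of "\<lambda>x y. f x y l"] G_def)
qed (simp add: e_def)

text \<open>Closing the second strand with the weights \<open>d\<close>. The three terms of
  \<open>D\<close> come from \<open>j = i\<close>, from \<open>i < j\<close>, and from the dual pair
  with \<open>i < 0\<close>.\<close>

lemma partial_trace:
  assumes i: "i \<in> J"
  shows "(\<Sum>j\<in>J. d j * s (\<lambda>x y. if y = j then G x else 0) i j) = a * G i"
proof -
  have "d j * s (\<lambda>x y. if y = j then G x else 0) i j = (if i < j then z * d j * G i else 0)
     + (if j = i then q * d i * G i else 0) - (if j = - i then (if i < 0 then z * (t i * t i * d (- i)) * G i else 0) else 0)"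
    if j: "j \<in> J" for j
  proof -
    have "(\<Sum>k\<in>{k\<in>J. k < - i}. t k * (if - k = - i then G k else 0)) = (\<Sum>k\<in>{k\<in>J. k < - i}. if k = i then t i * G i else 0)"
      by (rule sum.cong) auto
    also have "\<dots> = (if i < 0 then t i * G i else 0)"
      using i by (simp add: delta_filter)
    finally show ?thesis using J0[OF i] by (auto simp: s_def algebra_simps)
  qed
  then have "(\<Sum>j\<in>J. d j * s (\<lambda>x y. if y = j then G x else 0) i j) =
    z * (\<Sum>j\<in>{j\<in>J. i < j}. d j) * G i + q * d i * G i - (if - i \<in> J \<and> i < 0 then z * (t i * t i * d (- i)) * G i else 0)"
    using fin i by (simp add: sum.distrib sum_subtractf sum.inter_filter[symmetric] sum_distrib_left sum_distrib_right)
  also have "\<dots> = a * G i"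
    unfolding D[OF i, symmetric] by (auto simp: algebra_simps)
  finally show ?thesis .
qed

text \<open>Off the dual pairs \<open>s\<close> only keeps or exchanges the two indices; between
  dual pairs all weights \<open>d k * d (- k)\<close> equal \<open>1\<close> by \<open>dd\<close>.
  Hence \<open>d \<otimes> d\<close> commutes with the R-matrix.\<close>

lemma s_weight:
  assumes "i \<in> J" "j \<in> J"
  shows "s (\<lambda>x y. d x * d y * f x y) i j = d i * d j * s f i j"
proof (cases "j = - i")
  case True
  have "(\<Sum>k\<in>{k\<in>J. k < - i}. t k * (d k * d (- k) * f k (- k))) = (\<Sum>k\<in>{k\<in>J. k < - i}. t k * f k (- k))"
    using dd sym[of i] assms True by (intro sum.cong) auto
  then show ?thesis using True dd[of i] assms by (simp add: s_def mult.commute[of "d (- i)"])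
next
  case False
  then show ?thesis by (auto simp: s_def algebra_simps)
qed

section \<open>The braid relation\<close>

lemma s_cong:
  assumes "i \<in> J" "j \<in> J" "\<And>x y. x \<in> J \<Longrightarrow> y \<in> J \<Longrightarrow> f x y = g x y"
  shows "s f i j = s g i j"
  unfolding s_kernel[OF assms(1,2)] using assms(3) by (intro sum.cong) auto

lemma s_zero: "s (\<lambda>x y. 0) i j = 0"
  by (simp add: s_def)

lemma s_diff: "s (\<lambda>x y. f x y - g x y) i j = s f i j - s g i j"
  using s_linear[of f "- 1" g i j] by simp

text \<open>As \<open>e\<close> factors through cup and cap, \<open>cup_natural\<close> evaluates
  the left side and \<open>cap_natural\<close> the right side; at a dual pair both give
  \<open>t i\<close> times the cap of \<open>f l\<close>.\<close>

lemma e1_s2_s1: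
  assumes J: "i \<in> J" "j \<in> J" "l \<in> J"
  shows "e1 (s2 (s1 f)) i j l = s2 (s1 (e2 f)) i j l"
proof (cases "j = - i")
  case True
  then have "- i \<in> J" using J by simp
  then have "- l \<in> J" using sym J by blast
  then show ?thesis
    unfolding e_def[of "f _"] cap_natural[OF J, of "\<lambda>x. \<Sum>k\<in>J. t k * f x k (- k)"]
    using True cup_natural[OF J(3), of f] by (simp add: e_def[of "\<lambda>x y. s2 (s1 f) x y l"])
next
  case False
  then show ?thesis
    unfolding e_def[of "f _"] cap_natural[OF J, of "\<lambda>x. \<Sum>k\<in>J. t k * f x k (- k)"]
    by (simp add: e_def)
qed

lemma e_rev: "e (\<lambda>x y. f (- y) (- x)) i j = e f (- j) (- i)"
  unfolding e_def by auto

text \<open>Mirror image of \<open>e1_s2_s1\<close> if \<open>J\<close> is closed under negation.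
  Otherwise \<open>J\<close> is disjoint from its negative, and \<open>e\<close> vanishes on
  \<open>J\<close>, so both sides are zero.\<close>

lemma e2_s1_s2:
  assumes J: "i \<in> J" "j \<in> J" "l \<in> J"
  shows "e2 (s1 (s2 f)) i j l = s1 (s2 (e1 f)) i j l"
proof (cases "\<exists>x\<in>J. - x \<in> J")
  case True
  then have J': "- i \<in> J" "- j \<in> J" "- l \<in> J" using sym J by blast+
  define h where "h = (\<lambda>x y c. f (- c) (- y) (- x))"
  have f: "f = (\<lambda>x y c. h (- c) (- y) (- x))" by (simp add: h_def)
  have 1: "s (f x) y c = s1 h (- c) (- y) (- x)" for x y c
    unfolding f by (rule s_rev[of "\<lambda>u v. h u v (- x)"])
  have 2: "s1 (s2 f) x y c = s2 (s1 h) (- c) (- y) (- x)" for x y c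
    unfolding 1 by (rule s_rev[of "s1 h (- c)"])
  have 3: "e2 (s1 (s2 f)) i j l = e1 (s2 (s1 h)) (- l) (- j) (- i)"
    unfolding 2 by (rule e_rev[of "\<lambda>u v. s2 (s1 h) u v (- i)"])
  have 4: "e1 f x y c = e2 h (- c) (- y) (- x)" for x y c
    unfolding f by (rule e_rev[of "h (- c)"])
  have 5: "s2 (e1 f) x y c = s1 (e2 h) (- c) (- y) (- x)" for x y c
    unfolding 4 by (rule s_rev[of "\<lambda>u v. e2 h u v (- x)"])
  have 6: "s1 (s2 (e1 f)) i j l = s2 (s1 (e2 h)) (- l) (- j) (- i)"
    unfolding 5 by (rule s_rev[of "s1 (e2 h) (- l)"])
  show ?thesis unfolding 3 6 by (rule e1_s2_s1[OF J'(3,2,1)])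
next
  case False
  then have 0: "e g x y = 0" if "x \<in> J" "y \<in> J" for g x y
    using that by (auto simp: e_def)
  have 1: "s2 (e1 f) x y c = 0" if "x \<in> J" "y \<in> J" "c \<in> J" for x y c
    using s_cong[of y c "e1 f x" "\<lambda>x y. 0"] 0 that by (simp add: s_zero)
  have "s1 (s2 (e1 f)) i j l = 0"
    using s_cong[of i j "\<lambda>x y. s2 (e1 f) x y l" "\<lambda>x y. 0"] 1 J by (simp add: s_zero)
  then show ?thesis using 0 J by simp
qed

text \<open>The naturality laws above give \<open>s\<^sub>1 X + X s\<^sub>2 = z X\<close> for the defect \<open>X\<close> of the braid relation, so
  that the basis vectors on which \<open>X\<close> vanishes can be propagated by \<open>s\<^sub>1\<close> and \<open>s\<^sub>2\<close>.\<close>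

definition braid_defect :: "(int \<Rightarrow> int \<Rightarrow> int \<Rightarrow> 'k) \<Rightarrow> int \<Rightarrow> int \<Rightarrow> int \<Rightarrow> 'k" where
  "braid_defect f i j k = s1 (s2 (s1 f)) i j k - s2 (s1 (s2 f)) i j k"

text \<open>The words \<open>s1 s2 s1 s2\<close> cancel and leave
  \<open>s1^2 s2 s1 - s2 s1 s2^2\<close>. Expanding the squares by \<open>s_s\<close> gives
  \<open>z\<close> times the defect, and the terms with \<open>e\<close> cancel by
  \<open>e1_s2_s1\<close>.\<close>

lemma braid_defect_s1:
  assumes J: "i \<in> J" "j \<in> J" "k \<in> J"
  shows "s1 (braid_defect f) i j k + braid_defect (s2 f) i j k = z * braid_defect f i j k"
proof -
  have A: "s1 (braid_defect f) i j k = s1 (s1 (s2 (s1 f))) i j k - s1 (s2 (s1 (s2 f))) i j k"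
    unfolding braid_defect_def by (rule s_diff)
  have B: "s1 (s1 (s2 (s1 f))) i j k = s2 (s1 f) i j k + z * s1 (s2 (s1 f)) i j k - z * ai * e1 (s2 (s1 f)) i j k"
    by (rule s_s[OF J(1,2)])
  have C: "s1 (s2 (s2 f)) x y c = s1 f x y c + z * s1 (s2 f) x y c + (- z * ai) * s1 (e2 f) x y c"
    if c: "x \<in> J" "y \<in> J" "c \<in> J" for x y c
  proof -
    have "s1 (s2 (s2 f)) x y c = s (\<lambda>u v. (f u v c + z * s2 f u v c) + (- z * ai) * e2 f u v c) x y"
      using s_s c by (intro s_cong) auto
    then show ?thesis by (simp only: s_linear)
  qed
  have "s2 (s1 (s2 (s2 f))) i j k = s (\<lambda>y c. (s1 f i y c + z * s1 (s2 f) i y c) + (- z * ai) * s1 (e2 f) i y c) j k"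
    using C J by (intro s_cong) auto
  then have E: "s2 (s1 (s2 (s2 f))) i j k = s2 (s1 f) i j k + z * s2 (s1 (s2 f)) i j k + (- z * ai) * s2 (s1 (e2 f)) i j k"
    by (simp only: s_linear)
  show ?thesis
    unfolding A B braid_defect_def[of "s2 f"] E e1_s2_s1[OF J] by (simp add: braid_defect_def algebra_simps)
qed

lemma braid_defect_s2:
  assumes J: "i \<in> J" "j \<in> J" "k \<in> J"
  shows "s2 (braid_defect f) i j k + braid_defect (s1 f) i j k = z * braid_defect f i j k"
proof -
  have A: "s2 (braid_defect f) i j k = s2 (s1 (s2 (s1 f))) i j k - s2 (s2 (s1 (s2 f))) i j k"
    unfolding braid_defect_def by (rule s_diff)
  have B: "s2 (s2 (s1 (s2 f))) i j k = s1 (s2 f) i j k + z * s2 (s1 (s2 f)) i j k - z * ai * e2 (s1 (s2 f)) i j k"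
    by (rule s_s[OF J(2,3)])
  have C: "s2 (s1 (s1 f)) x y c = s2 f x y c + z * s2 (s1 f) x y c + (- z * ai) * s2 (e1 f) x y c"
    if c: "x \<in> J" "y \<in> J" "c \<in> J" for x y c
  proof -
    have "s2 (s1 (s1 f)) x y c = s (\<lambda>u v. (f x u v + z * s1 f x u v) + (- z * ai) * e1 f x u v) y c"
      using s_s c by (intro s_cong) auto
    then show ?thesis by (simp only: s_linear)
  qed
  have "s1 (s2 (s1 (s1 f))) i j k = s (\<lambda>x y. (s2 f x y k + z * s2 (s1 f) x y k) + (- z * ai) * s2 (e1 f) x y k) i j"
    using C J by (intro s_cong) auto
  then have E: "s1 (s2 (s1 (s1 f))) i j k = s1 (s2 f) i j k + z * s1 (s2 (s1 f)) i j k + (- z * ai) * s1 (s2 (e1 f)) i j k"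
    by (simp only: s_linear)
  show ?thesis
    unfolding A B braid_defect_def[of "s1 f"] E e2_s1_s2[OF J] by (simp add: braid_defect_def algebra_simps)
qed

lemma s_ne: "j \<noteq> - i \<Longrightarrow> i \<noteq> j \<Longrightarrow> s f i j = f j i + (if i < j then z * f i j else 0)"
  by (simp add: s_def)

lemma s_eq: "i \<noteq> - i \<Longrightarrow> s f i i = q * f i i"
  by (simp add: s_def)

lemma s_dual: "s f i (- i) = qi * f (- i) i + (if i < 0 then z * f i (- i) else 0)
      - z * t i * (\<Sum>k\<in>{k\<in>J. k < - i}. t k * f k (- k))"
  by (simp add: s_def)

text \<open>Starting from a weakly decreasing triple without dual pairs, only descents or equal
  indices are ever met, so no \<open>z\<close>-term arises.\<close>

lemma braid_defect_generic:
  assumes J: "i \<in> J" "j \<in> J" "k \<in> J" and "j \<le> i" "k \<le> j" "i \<noteq> - j" "j \<noteq> - k" "i \<noteq> - k"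
  shows "braid_defect f i j k = 0"
proof -
  have "j < i \<or> j = i" "k < j \<or> k = j" using assms by auto
  then show ?thesis
    using assms J0[of i] J0[of j] J0[of k] by (auto simp: braid_defect_def s_ne s_eq)
qed

text \<open>Every index \<open>m < - i\<close> of the sum satisfies \<open>m < j < - m\<close>, so
  the middle strand passes both legs of the cup by plain exchanges and the two sides produce the
  same sum.\<close>

lemma braid_defect_outer:
  assumes J: "i \<in> J" "j \<in> J" "- i \<in> J" and "j < i" "- i < j"
  shows "braid_defect f i j (- i) = 0"
proof -
  have *: "(\<Sum>m\<in>{m\<in>J. m < - i}. t m * s1 f j m (- m)) = (\<Sum>m\<in>{m\<in>J. m < - i}. t m * f m j (- m))"
    "(\<Sum>m\<in>{m\<in>J. m < - i}. t m * s2 f m (- m) j) = (\<Sum>m\<in>{m\<in>J. m < - i}. t m * f m j (- m))"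
    using assms by (auto simp: s_ne intro!: sum.cong)
  have 1: "s1 (s2 (s1 f)) i j (- i) = qi * f (- i) j i - z * t i * (\<Sum>m\<in>{m\<in>J. m < - i}. t m * f m j (- m))"
    using assms * by (simp add: s_ne s_dual)
  have 2: "s2 (s1 (s2 f)) i j (- i) = qi * f (- i) j i - z * t i * (\<Sum>m\<in>{m\<in>J. m < - i}. t m * f m j (- m))"
    using assms * by (simp add: s_ne s_dual)
  show ?thesis unfolding braid_defect_def 1 2 by simp
qed

text \<open>When the strand \<open>k\<close> passes the pair \<open>(j, - j)\<close>, each
  \<open>j < - k\<close> leaves an extra \<open>z\<close>-term. Their sum is cancelled by the one
  index \<open>j = - k\<close>, where \<open>k\<close> meets its own dual and contributes the same
  sum with the opposite sign.\<close>

lemma braid_defect_right: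
  assumes J: "k \<in> J" "l \<in> J" "- l \<in> J" "0 < l" "l < k"
  shows "braid_defect f k l (- l) = 0"
proof -
  have k: "- k \<in> J" using sym J by blast
  have 1: "s1 (s2 (s1 f)) k l (- l) = qi * f (- l) l k - z * t l * (\<Sum>j\<in>{j\<in>J. j < - l}. t j * f j (- j) k)"
    using assms by (simp add: s_ne s_dual)
  have tk: "t (- k) * (t k * x) = x" "t (- k) * (q * (qi * x)) = t (- k) * x" for x
    using tt[OF k] qq by (simp_all add: mult.assoc[symmetric])
  have Fk: "s1 (s2 f) k (- k) k = f (- k) k k - z * t k * (\<Sum>p\<in>{p\<in>J. p < - k}. t p * f p k (- p))"
  proof -
    have "s1 (s2 f) k (- k) k = qi * s (f (- k)) k k - z * t k * (\<Sum>p\<in>{p\<in>J. p < - k}. t p * s (f p) (- p) k)"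
      using assms by (simp add: s_dual)
    also have "s (f (- k)) k k = q * f (- k) k k" using assms by (simp add: s_eq)
    also have "(\<Sum>p\<in>{p\<in>J. p < - k}. t p * s (f p) (- p) k) = (\<Sum>p\<in>{p\<in>J. p < - k}. t p * f p k (- p))"
      using assms by (intro sum.cong) (auto simp: s_ne)
    finally show ?thesis using qq by (simp add: mult.assoc[symmetric] mult.commute[of qi])
  qed
  have F: "t j * s1 (s2 f) k j (- j) = t j * f j (- j) k + (if j < - k then z * (t j * f j k (- j)) else 0)
      - (if j = - k then z * (\<Sum>p\<in>{p\<in>J. p < - k}. t p * f p k (- p)) else 0)"
    if "j \<in> J" "j < - l" for j
  proof (cases "j = - k")
    case True
    then show ?thesis using Fk by (simp add: right_diff_distrib mult.assoc mult.left_commute[of _ z] tk)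
  next
    case False
    then show ?thesis using that assms by (auto simp: s_ne algebra_simps)
  qed
  have "s2 (s1 (s2 f)) k l (- l) = qi * f (- l) l k - z * t l * (\<Sum>j\<in>{j\<in>J. j < - l}. t j * s1 (s2 f) k j (- j))"
    using assms by (simp add: s_dual s_ne)
  also have "(\<Sum>j\<in>{j\<in>J. j < - l}. t j * s1 (s2 f) k j (- j)) = (\<Sum>j\<in>{j\<in>J. j < - l}. t j * f j (- j) k)"
  proof -
    have "(\<Sum>j\<in>{j\<in>J. j < - l}. if j < - k then z * (t j * f j k (- j)) else 0) = z * (\<Sum>p\<in>{p\<in>J. p < - k}. t p * f p k (- p))"
      unfolding sum_distrib_left using fin assms by (intro sum.mono_neutral_cong_right) auto
    then show ?thesis
      using F k assms fin by (simp add: sum.distrib sum_subtractf delta_filter)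
  qed
  finally show ?thesis unfolding braid_defect_def 1 by simp
qed

text \<open>Here the sum stops below \<open>- k\<close>, so the compensating index of
  \<open>braid_defect_right\<close> is absent; instead the coefficients of \<open>B\<close> agree
  because \<open>qi + z = q\<close>.\<close>

lemma braid_defect_right_eq:
  assumes J: "k \<in> J" "- k \<in> J" "0 < k"
  shows "braid_defect f k k (- k) = 0"
proof -
  have qq': "q * (qi * x) = x" "qi * (q * x) = x" for x
    using qq by (simp_all add: mult.assoc[symmetric] mult.commute[of qi])
  define A where "A = (\<Sum>p\<in>{p\<in>J. p < - k}. t p * f p (- p) k)"
  define B where "B = (\<Sum>p\<in>{p\<in>J. p < - k}. t p * f p k (- p))"
  have B1: "(\<Sum>p\<in>{p\<in>J. p < - k}. t p * s1 f k p (- p)) = B"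
    unfolding B_def using assms by (intro sum.cong) (auto simp: s_ne)
  have B2: "(\<Sum>p\<in>{p\<in>J. p < - k}. t p * s2 f p (- p) k) = B"
    unfolding B_def using assms by (intro sum.cong) (auto simp: s_ne)
  have B3: "(\<Sum>p\<in>{p\<in>J. p < - k}. t p * s1 (s2 f) k p (- p)) = A + z * B"
    unfolding A_def B_def sum_distrib_left sum.distrib[symmetric] using assms by (intro sum.cong) (auto simp: s_ne algebra_simps)
  have 1: "s1 (s2 (s1 f)) k k (- k) = q * (qi * (qi * f (- k) k k - z * t k * A) - z * t k * B)"
    using assms B1 by (simp add: s_eq s_dual A_def)
  have 2: "s2 (s1 (s2 f)) k k (- k) = qi * (qi * (q * f (- k) k k) - z * t k * B) - z * t k * (A + z * B)"
    using assms B2 B3 by (simp add: s_eq s_dual)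
  show ?thesis unfolding braid_defect_def 1 2 by (simp add: qq' z_def algebra_simps)
qed

text \<open>Reflection exchanges the two operators and thus the two sides of the braid relation,
  which accounts for the sign.\<close>

lemma braid_defect_rev: "braid_defect (\<lambda>x y c. f (- c) (- y) (- x)) i j k = - braid_defect f (- k) (- j) (- i)"
proof -
  define g where "g = (\<lambda>x y c. f (- c) (- y) (- x))"
  have 1: "s1 g x y c = s2 f (- c) (- y) (- x)" for x y c
    unfolding g_def by (rule s_rev[of "f (- c)"])
  have 2: "s2 g x y c = s1 f (- c) (- y) (- x)" for x y c
    unfolding g_def by (rule s_rev[of "\<lambda>u v. f u v (- x)"])
  have 3: "s2 (s1 g) x y c = s1 (s2 f) (- c) (- y) (- x)" for x y c
    unfolding 1 by (rule s_rev[of "\<lambda>u v. s2 f u v (- x)"])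
  have 4: "s1 (s2 g) x y c = s2 (s1 f) (- c) (- y) (- x)" for x y c
    unfolding 2 by (rule s_rev[of "s1 f (- c)"])
  have 5: "s1 (s2 (s1 g)) i j k = s2 (s1 (s2 f)) (- k) (- j) (- i)"
    unfolding 3 by (rule s_rev[of "s1 (s2 f) (- k)"])
  have 6: "s2 (s1 (s2 g)) i j k = s1 (s2 (s1 f)) (- k) (- j) (- i)"
    unfolding 4 by (rule s_rev[of "\<lambda>u v. s2 (s1 f) u v (- i)"])
  show ?thesis
    unfolding braid_defect_def g_def[symmetric] 5 6 by simp
qed

lemma braid_defect_descending:
  assumes J: "i \<in> J" "j \<in> J" "k \<in> J" and le: "j \<le> i" "k \<le> j"
  shows "braid_defect f i j k = 0"
proof -
  have right: "braid_defect f i j k = 0" if "i \<in> J" "j \<in> J" "k \<in> J" "j \<le> i" "k \<le> j" "j = - k" for f i j k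
  proof -
    have k: "k = - j" and j: "0 < j" "- j \<in> J" using that J0[of j] by auto
    show ?thesis
    proof (cases "j = i")
      case True
      show ?thesis unfolding k True[symmetric] by (rule braid_defect_right_eq) (use that j in auto)
    next
      case False
      show ?thesis unfolding k by (rule braid_defect_right) (use that j False in auto)
    qed
  qed
  consider "j = - k" | "i = - j" | "i = - k" "j \<noteq> - k" "i \<noteq> - j" | "i \<noteq> - j" "j \<noteq> - k" "i \<noteq> - k" by blast
  then show ?thesis
  proof cases
    case 1 then show ?thesis using right assms by blast
  next
    case 2
    \<comment> \<open>Reflection preserves weak descent and carries a dual pair on the left to one
      on the right.\<close>
    then have i: "- i \<in> J" using J by simp
    have "- j \<in> J" "- k \<in> J" by (rule sym[OF J(1) i J(2)], rule sym[OF J(1) i J(3)])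
    note this i
    moreover have "- i \<le> - j" "- j \<le> - k" using le by auto
    ultimately have "braid_defect (\<lambda>x y c. f (- c) (- y) (- x)) (- k) (- j) (- i) = 0"
      using 2 by (intro right) simp_all
    then show ?thesis by (simp add: braid_defect_rev)
  next
    case 3
    then show ?thesis using braid_defect_outer[of i j f] assms by auto
  next
    case 4
    then show ?thesis using braid_defect_generic assms by blast
  qed
qed

text \<open>At an ascent \<open>i < j\<close> the induction hypothesis for \<open>(j, i, k)\<close>,
  which holds for all \<open>f\<close>, kills two of the three terms of
  \<open>braid_defect_s1\<close> at that triple. The remaining one, \<open>s1\<close> applied to the
  defect, contains the value at \<open>(i, j, k)\<close> with coefficient \<open>1\<close> or
  \<open>qi\<close>.\<close>

lemma braid_defect_zero:
  "i \<in> J \<Longrightarrow> j \<in> J \<Longrightarrow> k \<in> J \<Longrightarrow> braid_defect f i j k = 0"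
proof -
  \<comment> \<open>A bound for the absolute values in \<open>J\<close>, so that the truncated
    difference in \<open>m1\<close> does decrease when an absolute value grows.\<close>
  define B where "B = (\<Sum>x\<in>J. nat \<bar>x\<bar>)"
  have B: "nat \<bar>x\<bar> \<le> B" if "x \<in> J" for x
    unfolding B_def using fin that by (intro member_le_sum) auto
  \<comment> \<open>The sum in \<open>s\<close> at a dual pair only involves indices of larger absolute value, and a transposition
    removes an ascent.\<close>
  define m1 where "m1 = (\<lambda>(i::int, j::int, k::int). 3 * B - (nat (abs i) + nat (abs j) + nat (abs k)))"
  define m2 :: "int \<times> int \<times> int \<Rightarrow> nat" where
    "m2 = (\<lambda>(i, j, k). (if i < j then 1 else 0) + (if j < k then 1 else 0) + (if i < k then 1 else 0))"
  define P where "P = (\<lambda>(i, j, k). i \<in> J \<longrightarrow> j \<in> J \<longrightarrow> k \<in> J \<longrightarrow> (\<forall>f. braid_defect f i j k = 0))"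
  have "P w" for w
  proof (induction w rule: wf_induct[OF wf_measures[of "[m1, m2]"]])
    case (1 w)
    obtain i j k where w: "w = (i, j, k)" by (cases w)
    have IH: "P (i', j', k')" if "m1 (i', j', k') < m1 (i, j, k) \<or> m1 (i', j', k') = m1 (i, j, k) \<and> m2 (i', j', k') < m2 (i, j, k)" for i' j' k'
      using 1 that by (auto simp: w)
    show ?case unfolding w P_def prod.case
    proof (intro impI allI)
      fix f assume J: "i \<in> J" "j \<in> J" "k \<in> J"
      consider "i < j" | "j < k" | "j \<le> i" "k \<le> j" by linarith
      then show "braid_defect f i j k = 0"
      proof cases
        case 1
        have "P (j, i, k)" using 1 by (intro IH) (auto simp: m1_def m2_def add.commute add.left_commute)
        then have Pj: "braid_defect f j i k = 0" for f using J by (auto simp: P_def)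
        have S: "s1 (braid_defect f) j i k = 0" using braid_defect_s1[OF J(2,1,3), of f] Pj by simp
        show ?thesis
        proof (cases "j = - i")
          case True
          have "(\<Sum>m\<in>{m\<in>J. m < i}. t m * braid_defect f m (- m) k) = 0"
          proof (rule sum.neutral, safe)
            fix m assume m: "m \<in> J" "m < i"
            have "- m \<in> J" using sym[of i m] J True m by auto
            moreover have "P (m, - m, k)" using 1 True m B[of m] B[of k] J
              by (intro IH disjI1) (simp only: m1_def prod.case, rule diff_less_mono2, auto)
            ultimately show "t m * braid_defect f m (- m) k = 0" using J m by (auto simp: P_def)
          qed
          moreover have "qi \<noteq> 0" using qq by auto
          ultimately show ?thesis using S True 1 by (simp add: s_def)
        next
          case False
          then show ?thesis using S 1 by (simp add: s_ne)
        qed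
      next
        case 2
        have "P (i, k, j)" using 2 by (intro IH) (auto simp: m1_def m2_def add.commute add.left_commute)
        then have Pj: "braid_defect f i k j = 0" for f using J by (auto simp: P_def)
        have S: "s2 (braid_defect f) i k j = 0" using braid_defect_s2[OF J(1,3,2), of f] Pj by simp
        show ?thesis
        proof (cases "k = - j")
          case True
          have "(\<Sum>m\<in>{m\<in>J. m < j}. t m * braid_defect f i m (- m)) = 0"
          proof (rule sum.neutral, safe)
            fix m assume m: "m \<in> J" "m < j"
            have "- m \<in> J" using sym[of j m] J True m by auto
            moreover have "P (i, m, - m)" using 2 True m B[of m] B[of i] J
              by (intro IH disjI1) (simp only: m1_def prod.case, rule diff_less_mono2, auto)
            ultimately show "t m * braid_defect f i m (- m) = 0" using J m by (auto simp: P_def)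
          qed
          moreover have "qi \<noteq> 0" using qq by auto
          ultimately show ?thesis using S True 2 by (simp add: s_def)
        next
          case False
          then show ?thesis using S 2 by (simp add: s_ne)
        qed
      next
        case 3
        then show ?thesis using braid_defect_descending J by blast
      qed
    qed
  qed
  then have "P (i, j, k)" by blast
  then show "i \<in> J \<Longrightarrow> j \<in> J \<Longrightarrow> k \<in> J \<Longrightarrow> braid_defect f i j k = 0" by (simp add: P_def)
qed

lemma braid:
  "i \<in> J \<Longrightarrow> j \<in> J \<Longrightarrow> k \<in> J \<Longrightarrow> s1 (s2 (s1 f)) i j k = s2 (s1 (s2 f)) i j k"
  using braid_defect_zero[of i j k f] by (simp add: braid_defect_def)

end

section \<open>Representations of the free algebra\<close>

lemma poly_mapping_sum_singles:
  fixes x :: "'a \<Rightarrow>\<^sub>0 'b::comm_monoid_add"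
  shows
  "x = (\<Sum>w\<in>Poly_Mapping.keys x. Poly_Mapping.single w (Poly_Mapping.lookup x w))"
  by (rule poly_mapping_eqI)
    (simp add: lookup_sum lookup_single when_def in_keys_iff if_distrib cong: if_cong)

lemma poly_mapping_additive_induct [consumes 1, case_names zero single add]:
  fixes x :: "'a \<Rightarrow>\<^sub>0 'b::comm_monoid_add"
  assumes "Poly_Mapping.keys x \<subseteq> A" and "P 0"
    and "\<And>w k. w \<in> A \<Longrightarrow> P (Poly_Mapping.single w k)"
    and "\<And>x y. Poly_Mapping.keys x \<subseteq> A \<Longrightarrow> Poly_Mapping.keys y \<subseteq> A \<Longrightarrow> P x \<Longrightarrow> P y \<Longrightarrow> P (x + y)"
  shows "P x"
proof -
  have "P (\<Sum>w\<in>B. Poly_Mapping.single w (Poly_Mapping.lookup x w)) \<and>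
     Poly_Mapping.keys (\<Sum>w\<in>B. Poly_Mapping.single w (Poly_Mapping.lookup x w)) \<subseteq> A"
    if "finite B" "B \<subseteq> A" for B
    using that
  proof (induction B rule: finite_induct)
    case empty
    then show ?case using assms(2) by simp
  next
    case (insert w B)
    let ?s = "Poly_Mapping.single w (Poly_Mapping.lookup x w)"
    have "Poly_Mapping.keys ?s \<subseteq> A" using insert by simp
    then show ?case
      using insert assms(3,4) keys_add[of ?s "\<Sum>w\<in>B. Poly_Mapping.single w (Poly_Mapping.lookup x w)"]
      by auto
  qed
  from this[of "Poly_Mapping.keys x"] show ?thesis
    using assms(1) poly_mapping_sum_singles[of x] by simp
qed

lemma free_alg_uminus:
  assumes "x \<in> carrier (free_alg n)"
  shows "\<ominus>\<^bsub>free_alg n\<^esub> x = - x"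
proof -
  interpret M: ring "free_alg n" by (rule free_alg_ring)
  show ?thesis
    by (rule M.minus_equality) (use assms in \<open>auto simp: free_alg_simps(2-) free_alg_uminus_closed\<close>)
qed

text \<open>\<open>ev\<close> specializes the coefficients to the field compatibly with the
  R-matrix. \<open>j0\<close> is a harmless value for the positions that carry no tensor
  factor.\<close>

locale bmw_rep = bmw_rmatrix J q qi a ai z t d
  for J :: "int set" and q qi a ai z :: "'k::field" and t d +
  fixes ev :: "coeff \<Rightarrow> 'k" and j0 :: int
  assumes ev_add: "ev (x + y) = ev x + ev y" and ev_mult: "ev (x * y) = ev x * ev y"
    and ev_1: "ev 1 = 1"
    and ev_a: "ev a_par = a" and ev_ai: "ev a_par_inv = ai" and ev_zi: "ev z_par_inv * z = 1"
    and j0: "j0 \<in> J"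
begin

lemma ev_0: "ev 0 = 0"
  using ev_add[of 0 0] by (metis add_0 add_cancel_right_right)

text \<open>Forms on infinitely many tensor factors, of which only \<open>p\<close> and
  \<open>p + 1\<close> are touched; one action thus serves the algebras for all
  \<open>n\<close>.\<close>

definition S :: "nat \<Rightarrow> ((nat \<Rightarrow> int) \<Rightarrow> 'k) \<Rightarrow> (nat \<Rightarrow> int) \<Rightarrow> 'k" where
  "S p f c = s (\<lambda>x y. f (c(p := x, Suc p := y))) (c p) (c (Suc p))"

definition E :: "nat \<Rightarrow> ((nat \<Rightarrow> int) \<Rightarrow> 'k) \<Rightarrow> (nat \<Rightarrow> int) \<Rightarrow> 'k" where
  "E p f c = e (\<lambda>x y. f (c(p := x, Suc p := y))) (c p) (c (Suc p))"

text \<open>The skein relation solved for the inverse crossing, which makes \<open>e_gen\<close> act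
  as \<open>E\<close>.\<close>

definition S' :: "nat \<Rightarrow> ((nat \<Rightarrow> int) \<Rightarrow> 'k) \<Rightarrow> (nat \<Rightarrow> int) \<Rightarrow> 'k" where
  "S' p f c = S p f c + z * (E p f c - f c)"

primrec letter_op :: "letter \<Rightarrow> ((nat \<Rightarrow> int) \<Rightarrow> 'k) \<Rightarrow> (nat \<Rightarrow> int) \<Rightarrow> 'k" where
  "letter_op (Gen p) = S p"
| "letter_op (Inv p) = S' p"

definition word_op :: "word \<Rightarrow> ((nat \<Rightarrow> int) \<Rightarrow> 'k) \<Rightarrow> (nat \<Rightarrow> int) \<Rightarrow> 'k" where
  "word_op w f = foldr letter_op (letters w) f"

definition \<Phi> :: "free \<Rightarrow> ((nat \<Rightarrow> int) \<Rightarrow> 'k) \<Rightarrow> (nat \<Rightarrow> int) \<Rightarrow> 'k" where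
  "\<Phi> x f c = (\<Sum>w\<in>Poly_Mapping.keys x. ev (Poly_Mapping.lookup x w) * word_op w f c)"

lemma word_op_plus: "word_op (u + v) f = word_op u (word_op v f)"
  by (simp add: word_op_def plus_word_def)

lemma word_op_0: "word_op 0 f = f"
  by (simp add: word_op_def zero_word_def)

lemma e_linear: "e (\<lambda>x y. f x y + c * g x y) i j = e f i j + c * e g i j"
  by (simp add: e_def sum.distrib sum_distrib_left algebra_simps)

lemma S_linear: "S p (\<lambda>c. f c + k * g c) c = S p f c + k * S p g c"
  unfolding S_def by (rule s_linear)

lemma E_linear: "E p (\<lambda>c. f c + k * g c) c = E p f c + k * E p g c"
  unfolding E_def by (rule e_linear)

lemma letter_op_linear: "letter_op l (\<lambda>c. f c + k * g c) c = letter_op l f c + k * letter_op l g c"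
  by (cases l) (simp_all add: S_linear E_linear S'_def algebra_simps)

lemma foldr_letter_op_linear: "foldr letter_op ls (\<lambda>c. f c + k * g c) = (\<lambda>c. foldr letter_op ls f c + k * foldr letter_op ls g c)"
  by (induction ls) (auto simp: letter_op_linear)

lemma word_op_linear: "word_op w (\<lambda>c. f c + k * g c) c = word_op w f c + k * word_op w g c"
  by (simp add: word_op_def foldr_letter_op_linear)

lemma \<Phi>_superset:
  assumes "finite A" "Poly_Mapping.keys x \<subseteq> A"
  shows "\<Phi> x f c = (\<Sum>w\<in>A. ev (Poly_Mapping.lookup x w) * word_op w f c)"
  unfolding \<Phi>_def using assms by (intro sum.mono_neutral_left) (auto simp: in_keys_iff ev_0)

lemma \<Phi>_add: "\<Phi> (x + y) f c = \<Phi> x f c + \<Phi> y f c"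
proof -
  let ?A = "Poly_Mapping.keys x \<union> Poly_Mapping.keys y"
  have "Poly_Mapping.keys (x + y) \<subseteq> ?A" by (rule keys_add)
  then show ?thesis
    using \<Phi>_superset[of ?A "x + y" f c] \<Phi>_superset[of ?A x f c] \<Phi>_superset[of ?A y f c]
    by (simp add: lookup_add ev_add distrib_right sum.distrib)
qed

lemma \<Phi>_single: "\<Phi> (Poly_Mapping.single w k) f c = ev k * word_op w f c"
  using \<Phi>_superset[of "{w}" "Poly_Mapping.single w k" f c] by (cases "k = 0") auto

lemma \<Phi>_zero: "\<Phi> 0 f c = 0"
  by (simp add: \<Phi>_def)

lemma \<Phi>_uminus: "\<Phi> (- x) f c = - \<Phi> x f c"
  using \<Phi>_add[of x "- x" f c] by (simp add: \<Phi>_zero add_eq_0_iff)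

lemma \<Phi>_diff: "\<Phi> (x - y) f c = \<Phi> x f c - \<Phi> y f c"
  using \<Phi>_add[of x "- y" f c] by (simp add: \<Phi>_uminus)

lemma \<Phi>_linear: "\<Phi> x (\<lambda>c. f c + k * g c) c = \<Phi> x f c + k * \<Phi> x g c"
  unfolding \<Phi>_def by (simp add: word_op_linear sum.distrib sum_distrib_left algebra_simps)

lemma \<Phi>_fun_zero: "\<Phi> x (\<lambda>c. 0) c = 0"
  using \<Phi>_linear[of x "\<lambda>c. 0" "- 1" "\<lambda>c. 0" c] by simp

lemma word_op_fun_zero: "word_op w (\<lambda>c. 0) c = 0"
  using word_op_linear[of w "\<lambda>c. 0" "- 1" "\<lambda>c. 0" c] by simp

lemma \<Phi>_sum: "\<Phi> x (\<lambda>c. \<Sum>i\<in>A. k i * g i c) c = (\<Sum>i\<in>A. k i * \<Phi> x (g i) c)"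
proof (induction A rule: infinite_finite_induct)
  case (insert i A)
  then show ?case
    using \<Phi>_linear[of x "\<lambda>c. \<Sum>i\<in>A. k i * g i c" "k i" "g i" c] by (simp add: add.commute)
qed (simp_all add: \<Phi>_fun_zero)

lemma \<Phi>_mult: "\<Phi> (x * y) f c = \<Phi> x (\<Phi> y f) c"
proof (induction x rule: poly_mapping_additive_induct[OF subset_UNIV, case_names zero single add])
  case zero
  then show ?case by (simp add: \<Phi>_zero)
next
  case (add x x')
  then show ?case by (simp add: distrib_right \<Phi>_add)
next
  case (single u k)
  show ?case
  proof (induction y arbitrary: c rule: poly_mapping_additive_induct[OF subset_UNIV, case_names zero single add])
    case zero
    have "\<Phi> 0 f = (\<lambda>c. 0)" by (intro ext \<Phi>_zero)
    then show ?case by (simp add: \<Phi>_fun_zero \<Phi>_zero)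
  next
    case (single v l)
    have "\<Phi> (Poly_Mapping.single v l) f = (\<lambda>c. 0 + ev l * word_op v f c)"
      by (intro ext) (simp add: \<Phi>_single)
    then show ?case
      by (simp only: mult_single \<Phi>_single word_op_linear word_op_fun_zero ev_mult word_op_plus) simp
  next
    case (add y y')
    have "\<Phi> (y + y') f = (\<lambda>c. \<Phi> y f c + 1 * \<Phi> y' f c)"
      by (intro ext) (simp add: \<Phi>_add)
    then show ?case
      using add by (simp only: distrib_left \<Phi>_add \<Phi>_linear) simp
  qed
qed

lemma \<Phi>_mult_fun: "\<Phi> (x * y) f = \<Phi> x (\<Phi> y f)"
  by (intro ext \<Phi>_mult)

lemma \<Phi>_scalar: "\<Phi> (scalar k) f c = ev k * f c"
  by (simp add: scalar_def \<Phi>_single word_op_0)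

lemma \<Phi>_one: "\<Phi> 1 f = f"
  using \<Phi>_scalar[of 1 f] by (simp add: scalar_def ev_1 fun_eq_iff)

lemma \<Phi>_s_gen: "\<Phi> (s_gen i) f = S i f"
  by (intro ext) (simp add: s_gen_def \<Phi>_single word_op_def ev_1)

lemma \<Phi>_s_inv: "\<Phi> (s_inv i) f = S' i f"
  by (intro ext) (simp add: s_inv_def \<Phi>_single word_op_def ev_1)

lemma \<Phi>_e_gen: "\<Phi> (e_gen i) f = E i f"
proof
  fix c
  have "\<Phi> (e_gen i) f c = ev z_par_inv * z * (E i f c - f c) + f c"
    by (simp add: e_gen_def \<Phi>_add \<Phi>_mult \<Phi>_diff \<Phi>_scalar \<Phi>_one \<Phi>_s_gen \<Phi>_s_inv S'_def)
  then show "\<Phi> (e_gen i) f c = E i f c" by (simp add: ev_zi)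
qed

text \<open>The identities for \<open>s\<close> and \<open>e\<close> hold for indices in
  \<open>J\<close> only. Operators are therefore compared on these configurations, which their
  cutoffs and sums never leave.\<close>

definition Conf :: "(nat \<Rightarrow> int) set" where
  "Conf = {c. \<forall>k. c k \<in> J}"

lemma Conf_upd: "c \<in> Conf \<Longrightarrow> x \<in> J \<Longrightarrow> c(p := x) \<in> Conf"
  by (simp add: Conf_def)

lemma Conf_J: "c \<in> Conf \<Longrightarrow> c p \<in> J"
  by (simp add: Conf_def)

lemma S_cong:
  assumes "c \<in> Conf" "\<And>c. c \<in> Conf \<Longrightarrow> f c = g c"
  shows "S p f c = S p g c"
  unfolding S_def using assms by (intro s_cong) (auto simp: Conf_J Conf_upd)

lemma e_cong:
  assumes "i \<in> J" "j \<in> J" "\<And>x y. x \<in> J \<Longrightarrow> y \<in> J \<Longrightarrow> f x y = g x y"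
  shows "e f i j = e g i j"
proof (cases "j = - i")
  case True
  then have "- k \<in> J" if "k \<in> J" for k using that sym assms(1,2) by blast
  then show ?thesis using assms(3) by (auto simp: e_def intro!: sum.cong arg_cong2[where f = "(*)"])
qed (simp add: e_def)

lemma E_cong:
  assumes "c \<in> Conf" "\<And>c. c \<in> Conf \<Longrightarrow> f c = g c"
  shows "E p f c = E p g c"
  unfolding E_def using assms by (intro e_cong) (auto simp: Conf_J Conf_upd)

lemma letter_op_cong:
  "c \<in> Conf \<Longrightarrow> (\<And>c. c \<in> Conf \<Longrightarrow> f c = g c) \<Longrightarrow> letter_op l f c = letter_op l g c"
  using S_cong[of c f g] E_cong[of c f g] by (cases l) (auto simp: S'_def)

lemma word_op_cong:
  "c \<in> Conf \<Longrightarrow> (\<And>c. c \<in> Conf \<Longrightarrow> f c = g c) \<Longrightarrow> word_op w f c = word_op w g c"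
proof -
  have "\<forall>c\<in>Conf. foldr letter_op ls f c = foldr letter_op ls g c" if "\<And>c. c \<in> Conf \<Longrightarrow> f c = g c" for ls
    using that by (induction ls) (auto intro: letter_op_cong)
  then show "c \<in> Conf \<Longrightarrow> (\<And>c. c \<in> Conf \<Longrightarrow> f c = g c) \<Longrightarrow> word_op w f c = word_op w g c"
    by (simp add: word_op_def)
qed

lemma \<Phi>_cong:
  "c \<in> Conf \<Longrightarrow> (\<And>c. c \<in> Conf \<Longrightarrow> f c = g c) \<Longrightarrow> \<Phi> x f c = \<Phi> x g c"
  unfolding \<Phi>_def by (intro sum.cong refl arg_cong2[where f = "(*)"] word_op_cong)

section \<open>The BMW relations on configurations\<close>

lemma S_S: "c \<in> Conf \<Longrightarrow> S p (S p f) c = f c + z * S p f c - z * ai * E p f c"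
  using s_s[of "c p" "c (Suc p)" "\<lambda>x y. f (c(p := x, Suc p := y))"]
  by (simp add: S_def E_def Conf_J fun_upd_twist)

lemma S_E: "c \<in> Conf \<Longrightarrow> S p (E p f) c = ai * E p f c"
  using s_e[of "c p" "c (Suc p)" "\<lambda>x y. f (c(p := x, Suc p := y))"]
  by (simp add: S_def E_def Conf_J fun_upd_twist)

lemma E_S: "c \<in> Conf \<Longrightarrow> E p (S p f) c = ai * E p f c"
  using e_s[of "c p" "c (Suc p)" "\<lambda>x y. f (c(p := x, Suc p := y))"]
  by (simp add: S_def E_def Conf_J fun_upd_twist)

lemma E_E: "c \<in> Conf \<Longrightarrow> z * E p (E p f) c = (a - ai + z) * E p f c"
  using e_e[of "c p" "c (Suc p)" "\<lambda>x y. f (c(p := x, Suc p := y))"]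
  by (simp add: E_def Conf_J fun_upd_twist)

lemma S_S': "c \<in> Conf \<Longrightarrow> S p (S' p f) c = f c"
proof -
  assume c: "c \<in> Conf"
  have "S' p f = (\<lambda>c. (S p f c + z * E p f c) + (- z) * f c)"
    by (intro ext) (simp add: S'_def algebra_simps)
  then show "S p (S' p f) c = f c"
    using c by (simp only: S_linear S_S S_E) (simp add: algebra_simps)
qed

lemma S'_S: "c \<in> Conf \<Longrightarrow> S' p (S p f) c = f c"
  by (simp add: S'_def S_S E_S algebra_simps)

text \<open>Reads a form on three adjacent positions, so that the three-strand identities for
  \<open>s\<close> and \<open>e\<close> apply without change.\<close>

definition conf3 :: "nat \<Rightarrow> ((nat \<Rightarrow> int) \<Rightarrow> 'k) \<Rightarrow> (nat \<Rightarrow> int) \<Rightarrow> int \<Rightarrow> int \<Rightarrow> int \<Rightarrow> 'k" where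
  "conf3 p f c = (\<lambda>x y u. f (c(p := x, Suc p := y, Suc (Suc p) := u)))"

lemma upd3:
  "c(p := x, Suc (Suc p) := u, Suc p := y) = c(p := x, Suc p := y, Suc (Suc p) := (u :: int))"
  "c(Suc p := y, Suc (Suc p) := u, p := x) = c(p := x, Suc p := y, Suc (Suc p) := u)"
  "c(Suc p := y, p := x) = c(p := x, Suc p := y)"
  "c(Suc (Suc p) := u, Suc p := y) = c(Suc p := y, Suc (Suc p) := u)"
  "c(Suc (Suc p) := u, p := x) = c(p := x, Suc (Suc p) := u)"
  by auto

lemma conf3_S: "conf3 p (S p f) c = s1 (conf3 p f c)" "conf3 p (S (Suc p) f) c = s2 (conf3 p f c)"
  by (simp_all add: conf3_def S_def fun_eq_iff upd3)

lemma conf3_E: "conf3 p (E p f) c = e1 (conf3 p f c)" "conf3 p (E (Suc p) f) c = e2 (conf3 p f c)"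
  by (simp_all add: conf3_def E_def fun_eq_iff upd3)

lemma conf3_at: "f c = conf3 p f c (c p) (c (Suc p)) (c (Suc (Suc p)))"
  by (simp add: conf3_def fun_upd_idem)

lemma S_braid:
  assumes "c \<in> Conf"
  shows "S p (S (Suc p) (S p f)) c = S (Suc p) (S p (S (Suc p) f)) c"
  unfolding conf3_at[of "S p (S (Suc p) (S p f))" c p] conf3_at[of "S (Suc p) (S p (S (Suc p) f))" c p] conf3_S
  using assms by (intro braid Conf_J)

lemma E_S_E:
  assumes "c \<in> Conf"
  shows "E p (S (Suc p) (E p f)) c = a * E p f c"
  unfolding conf3_at[of "E p (S (Suc p) (E p f))" c p] conf3_at[of "E p f" c p] conf3_S conf3_E
  using assms by (intro e_s_e Conf_J)

lemma E_E_E: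
  assumes "c \<in> Conf"
  shows "E p (E (Suc p) (E p f)) c = E p f c"
  unfolding conf3_at[of "E p (E (Suc p) (E p f))" c p] conf3_at[of "E p f" c p] conf3_S conf3_E
  using assms by (intro e_e_e Conf_J)

text \<open>Expanding \<open>S'\<close> leaves \<open>a + z\<close> times \<open>E\<close> minus
  \<open>z\<close> times \<open>E E\<close>, and the loop value in \<open>E_E\<close> turns this
  into \<open>ai\<close>.\<close>

lemma E_S'_E:
  assumes c: "c \<in> Conf"
  shows "E p (S' (Suc p) (E p f)) c = ai * E p f c"
proof -
  have "S' (Suc p) (E p f) = (\<lambda>c. (S (Suc p) (E p f) c + z * E (Suc p) (E p f) c) + (- z) * E p f c)"
    by (intro ext) (simp add: S'_def algebra_simps)
  then have "E p (S' (Suc p) (E p f)) c = a * E p f c + z * E p f c - z * E p (E p f) c"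
    using c by (simp only: E_linear E_S_E E_E_E) simp
  then show ?thesis using c by (simp add: E_E algebra_simps)
qed

text \<open>The two pairs of positions are disjoint, so both orders are the same fourfold sum of
  products of kernels \<open>K\<close>.\<close>

lemma S_far:
  assumes "p \<noteq> r" "Suc p \<noteq> r" "p \<noteq> Suc r" "c \<in> Conf"
  shows "S p (S r f) c = S r (S p f) c"
proof -
  have 1: "(c(p := x, Suc p := y)) r = c r" "(c(p := x, Suc p := y)) (Suc r) = c (Suc r)"
     "(c(r := x, Suc r := y)) p = c p" "(c(r := x, Suc r := y)) (Suc p) = c (Suc p)" for x y
    using assms by auto
  have 2: "c(p := x, Suc p := y, r := u, Suc r := v) = c(r := u, Suc r := v, p := x, Suc p := y)" for x y u v
    using assms by auto
  define F where "F = (\<lambda>u v x y. f (c(p := x, Suc p := y, r := u, Suc r := v)))"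
  have J: "c p \<in> J" "c (Suc p) \<in> J" "c r \<in> J" "c (Suc r) \<in> J" using assms by (auto simp: Conf_J)
  have "S p (S r f) c = s (\<lambda>x y. s (\<lambda>u v. F u v x y) (c r) (c (Suc r))) (c p) (c (Suc p))"
    unfolding S_def F_def 1 ..
  also have "\<dots> = (\<Sum>x\<in>J. \<Sum>y\<in>J. \<Sum>u\<in>J. \<Sum>v\<in>J. K (c p) (c (Suc p)) x y * (K (c r) (c (Suc r)) u v * F u v x y))"
    using J by (simp add: s_kernel sum_distrib_left)
  also have "\<dots> = (\<Sum>u\<in>J. \<Sum>v\<in>J. \<Sum>x\<in>J. \<Sum>y\<in>J. K (c p) (c (Suc p)) x y * (K (c r) (c (Suc r)) u v * F u v x y))"
    unfolding sum_rotate[of "\<lambda>x y u. \<Sum>v\<in>J. K (c p) (c (Suc p)) x y * (K (c r) (c (Suc r)) u v * F u v x y)"]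
    by (intro sum.cong refl sum_rotate)
  also have "\<dots> = s (\<lambda>u v. s (\<lambda>x y. F u v x y) (c p) (c (Suc p))) (c r) (c (Suc r))"
    using J by (simp add: s_kernel sum_distrib_left mult.left_commute)
  also have "\<dots> = S r (S p f) c"
    unfolding S_def F_def 1 2 ..
  finally show ?thesis .
qed

lemma \<Phi>_rel:
  assumes r: "r \<in> bmw_rel n" and c: "c \<in> Conf"
  shows "\<Phi> r f c = 0"
proof -
  note simps = \<Phi>_diff \<Phi>_mult_fun \<Phi>_s_gen \<Phi>_s_inv \<Phi>_e_gen \<Phi>_one \<Phi>_scalar mult.assoc
  from r consider
      (1) i where "r = s_gen i * s_inv i - 1"
    | (2) i where "r = s_inv i * s_gen i - 1"
    | (3) i j where "r = s_gen i * s_gen j - s_gen j * s_gen i" "2 \<le> \<bar>int i - int j\<bar>"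
    | (4) i where "r = s_gen i * s_gen (i + 1) * s_gen i - s_gen (i + 1) * s_gen i * s_gen (i + 1)"
    | (5) i where "r = e_gen i * s_gen i - scalar a_par_inv * e_gen i"
    | (6) i where "r = e_gen i * s_gen (i + 1) * e_gen i - scalar a_par * e_gen i"
    | (7) i where "r = e_gen i * s_inv (i + 1) * e_gen i - scalar a_par_inv * e_gen i"
    unfolding bmw_rel_def by blast
  then show ?thesis
  proof cases
    case 1 then show ?thesis using c by (simp add: simps S_S')
  next
    case 2 then show ?thesis using c by (simp add: simps S'_S)
  next
    case 3
    then have "i \<noteq> j" "Suc i \<noteq> j" "i \<noteq> Suc j" by auto
    then show ?thesis using c 3 by (simp add: simps S_far)
  next
    case 4 then show ?thesis using c by (simp add: simps S_braid)
  next
    case 5 then show ?thesis using c by (simp add: simps E_S ev_ai)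
  next
    case 6 then show ?thesis using c by (simp add: simps E_S_E ev_a)
  next
    case 7 then show ?thesis using c by (simp add: simps E_S'_E ev_ai)
  qed
qed

text \<open>The elements acting by zero on \<open>Conf\<close> form an ideal: a left factor
  \<open>y\<close> sees only values on \<open>Conf\<close>, and there \<open>\<Phi> x f\<close> is
  already zero.\<close>

lemma \<Phi>_ideal:
  assumes "x \<in> bmw_ideal n" "c \<in> Conf"
  shows "\<Phi> x f c = 0"
proof -
  interpret M: ring "free_alg n" by (rule free_alg_ring)
  let ?K = "{x \<in> carrier (free_alg n). \<forall>f. \<forall>c\<in>Conf. \<Phi> x f c = 0}"
  have "ideal ?K (free_alg n)"
  proof (rule idealI[OF free_alg_ring])
    show "subgroup ?K (add_monoid (free_alg n))"
    proof (rule M.add.subgroupI)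
      show "?K \<noteq> {}"
        using M.zero_closed by (auto simp: free_alg_simps(2-) \<Phi>_zero)
    next
      fix x assume "x \<in> ?K"
      then show "\<ominus>\<^bsub>free_alg n\<^esub> x \<in> ?K"
        by (auto simp: free_alg_uminus free_alg_uminus_closed \<Phi>_uminus)
    next
      fix x y assume "x \<in> ?K" "y \<in> ?K"
      then show "x \<oplus>\<^bsub>free_alg n\<^esub> y \<in> ?K"
        by (auto simp: free_alg_simps(2-) free_alg_add_closed \<Phi>_add)
    qed auto
  next
    fix x y assume x: "x \<in> ?K" and y: "y \<in> carrier (free_alg n)"
    have "\<Phi> y (\<Phi> x f) c = 0" if "c \<in> Conf" for f c
      using \<Phi>_cong[OF that, of "\<Phi> x f" "\<lambda>c. 0" y] x by (auto simp: \<Phi>_fun_zero)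
    then show "y \<otimes>\<^bsub>free_alg n\<^esub> x \<in> ?K" "x \<otimes>\<^bsub>free_alg n\<^esub> y \<in> ?K"
      using x y by (auto simp: free_alg_simps(2-) free_alg_mult_closed \<Phi>_mult_fun)
  qed
  moreover have "bmw_rel n \<subseteq> ?K"
    using bmw_rel_subset[of n] \<Phi>_rel by auto
  ultimately have "bmw_ideal n \<subseteq> ?K"
    unfolding bmw_ideal_def by (rule M.genideal_minimal)
  then show ?thesis using assms by auto
qed

section \<open>Quantum traces\<close>

text \<open>Words in \<open>J\<close> of length \<open>n\<close>, at the positions \<open>1, \<dots>, n\<close>; all other positions hold the dummy \<open>j0\<close>.\<close>

definition conf :: "nat \<Rightarrow> (nat \<Rightarrow> int) set" where
  "conf n = {c. \<forall>k. (k \<in> {1..n} \<longrightarrow> c k \<in> J) \<and> (k \<notin> {1..n} \<longrightarrow> c k = j0)}"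

lemma conf_finite: "finite (conf n)"
  unfolding conf_def by (rule finite_set_of_finite_funs[OF finite_atLeastAtMost fin])

lemma conf_Conf: "c \<in> conf n \<Longrightarrow> c \<in> Conf"
proof -
  assume c: "c \<in> conf n"
  have "c k \<in> J" for k using c j0 by (cases "k \<in> {1..n}") (simp_all add: conf_def)
  then show "c \<in> Conf" by (simp add: Conf_def)
qed

lemma conf_upd: "c \<in> conf n \<Longrightarrow> x \<in> J \<Longrightarrow> 1 \<le> p \<Longrightarrow> p \<le> n \<Longrightarrow> c(p := x) \<in> conf n"
  by (auto simp: conf_def)

lemma conf_0: "conf 0 = {\<lambda>k. j0}"
  by (auto simp: conf_def)

lemma sum_conf_Suc:
  "(\<Sum>c\<in>conf (Suc n). g c) = (\<Sum>b\<in>conf n. \<Sum>j\<in>J. g (b(Suc n := j)) :: 'k)"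
proof -
  have "bij_betw (\<lambda>(b, j). b(Suc n := j)) (conf n \<times> J) (conf (Suc n))"
  proof (rule bij_betw_byWitness[where f' = "\<lambda>c. (c(Suc n := j0), c (Suc n))"])
    show "\<forall>a\<in>conf n \<times> J. (\<lambda>c. (c(Suc n := j0), c (Suc n))) ((\<lambda>(b, j). b(Suc n := j)) a) = a"
      by (auto simp: conf_def fun_eq_iff)
  qed (auto simp: conf_def fun_eq_iff le_Suc_eq)
  then have "(\<Sum>c\<in>conf (Suc n). g c) = (\<Sum>(b, j)\<in>conf n \<times> J. g (b(Suc n := j)))"
    by (simp add: sum.reindex_bij_betw[symmetric] case_prod_unfold)
  then show ?thesis by (simp add: sum.cartesian_product)
qed

definition W :: "nat \<Rightarrow> (nat \<Rightarrow> int) \<Rightarrow> 'k" where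
  "W n c = (\<Prod>k\<in>{1..n}. d (c k))"

definition \<delta> :: "(nat \<Rightarrow> int) \<Rightarrow> (nat \<Rightarrow> int) \<Rightarrow> 'k" where
  "\<delta> c c' = (if c' = c then 1 else 0)"

text \<open>Quantum trace on the \<open>n\<close>-th tensor power:
  \<open>\<Phi> x (\<delta> c) c\<close> is the diagonal entry at \<open>c\<close>, and
  \<open>W n\<close> is the diagonal operator \<open>d \<otimes> ... \<otimes> d\<close>.\<close>

definition \<theta> :: "nat \<Rightarrow> free \<Rightarrow> 'k" where
  "\<theta> n x = (\<Sum>c\<in>conf n. W n c * \<Phi> x (\<delta> c) c)"

lemma \<theta>_add: "\<theta> n (x + y) = \<theta> n x + \<theta> n y"
  by (simp add: \<theta>_def \<Phi>_add sum.distrib algebra_simps)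

lemma \<theta>_scale: "\<theta> n (scalar k * x) = ev k * \<theta> n x"
  by (simp add: \<theta>_def \<Phi>_mult \<Phi>_scalar sum_distrib_left mult_ac)

lemma \<theta>_ideal: "x \<in> bmw_ideal n \<Longrightarrow> \<theta> m x = 0"
  by (simp add: \<theta>_def \<Phi>_ideal[OF _ conf_Conf])

section \<open>Finite matrices and the trace property\<close>

lemma letter_op_local:
  assumes "1 \<le> letter_index l" "letter_index l < n" "c \<in> conf n" "\<And>c. c \<in> conf n \<Longrightarrow> f c = g c"
  shows "letter_op l f c = letter_op l g c"
proof -
  have J: "c p \<in> J" for p using conf_Conf[OF assms(3)] by (simp add: Conf_J)
  have "S p f c = S p g c" "E p f c = E p g c" if "1 \<le> p" "p < n" for p
  proof -
    have "f (c(p := x, Suc p := y)) = g (c(p := x, Suc p := y))" if "x \<in> J" "y \<in> J" for x y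
      by (rule assms(4)) (use that \<open>1 \<le> p\<close> \<open>p < n\<close> assms(3) in \<open>auto intro!: conf_upd\<close>)
    then show "S p f c = S p g c" "E p f c = E p g c"
      unfolding S_def E_def using J by (auto intro!: s_cong e_cong)
  qed
  then show ?thesis using assms by (cases l) (auto simp: S'_def)
qed

lemma word_op_local:
  assumes "w \<in> words n" "c \<in> conf n" "\<And>c. c \<in> conf n \<Longrightarrow> f c = g c"
  shows "word_op w f c = word_op w g c"
proof -
  have "\<forall>c\<in>conf n. foldr letter_op ls f c = foldr letter_op ls g c"
    if "\<forall>x\<in>set ls. 1 \<le> letter_index x \<and> letter_index x < n" for ls
    using that assms(3) by (induction ls) (auto intro: letter_op_local)
  then show ?thesis using assms by (simp add: word_op_def words_def)
qed

lemma \<Phi>_local: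
  assumes "x \<in> carrier (free_alg n)" "c \<in> conf n" "\<And>c. c \<in> conf n \<Longrightarrow> f c = g c"
  shows "\<Phi> x f c = \<Phi> x g c"
  unfolding \<Phi>_def using assms
  by (intro sum.cong refl arg_cong2[where f = "(*)"] word_op_local[of _ n]) (auto simp: free_alg_simps)

text \<open>On \<open>conf n\<close> every form is a finite combination of the
  \<open>\<delta> b\<close>, and \<open>\<Phi> x\<close> looks at no other configurations; so
  \<open>\<Phi> x (\<delta> b) c\<close> are matrix entries.\<close>

lemma \<Phi>_expand:
  assumes "x \<in> carrier (free_alg n)" "c \<in> conf n"
  shows "\<Phi> x f c = (\<Sum>b\<in>conf n. f b * \<Phi> x (\<delta> b) c)"
proof -
  have "\<Phi> x f c = \<Phi> x (\<lambda>c. \<Sum>b\<in>conf n. f b * \<delta> b c) c"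
    using assms conf_finite by (intro \<Phi>_local) (auto simp: \<delta>_def if_distrib cong: if_cong)
  then show ?thesis by (simp add: \<Phi>_sum)
qed

lemma e_weight:
  assumes "i \<in> J" "j \<in> J"
  shows "e (\<lambda>x y. d x * d y * f x y) i j = d i * d j * e f i j"
proof (cases "j = - i")
  case True
  have "(\<Sum>k\<in>J. t k * (d k * d (- k) * f k (- k))) = (\<Sum>k\<in>J. t k * f k (- k))"
    using dd sym[of i] assms True by (intro sum.cong) auto
  then show ?thesis using True dd[of i] assms by (simp add: e_def)
qed (simp add: e_def)

lemma W_upd:
  assumes "1 \<le> p" "Suc p \<le> n"
  shows "W n (c(p := x, Suc p := y)) = (\<Prod>k\<in>{1..n} - {p, Suc p}. d (c k)) * (d x * d y)"
proof -
  have *: "{1..n} = insert p (insert (Suc p) ({1..n} - {p, Suc p}))" using assms by auto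
  have "W n (c(p := x, Suc p := y)) = d x * (d y * (\<Prod>k\<in>{1..n} - {p, Suc p}. d ((c(p := x, Suc p := y)) k)))"
    unfolding W_def by (subst *) simp
  also have "(\<Prod>k\<in>{1..n} - {p, Suc p}. d ((c(p := x, Suc p := y)) k)) = (\<Prod>k\<in>{1..n} - {p, Suc p}. d (c k))"
    by (rule prod.cong) auto
  finally show ?thesis by (simp only: mult_ac)
qed

lemma letter_op_weight:
  assumes "1 \<le> letter_index l" "letter_index l < n" "c \<in> conf n"
  shows "letter_op l (\<lambda>c. W n c * f c) c = W n c * letter_op l f c"
proof -
  have J: "c p \<in> J" for p using conf_Conf[OF assms(3)] by (simp add: Conf_J)
  have "S p (\<lambda>c. W n c * f c) c = W n c * S p f c" "E p (\<lambda>c. W n c * f c) c = W n c * E p f c"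
    if p: "1 \<le> p" "Suc p \<le> n" for p
  proof -
    define R where "R = (\<Prod>k\<in>{1..n} - {p, Suc p}. d (c k))"
    have Wc: "W n c = R * (d (c p) * d (c (Suc p)))"
      using W_upd[OF p, of c "c p" "c (Suc p)"] by (simp add: R_def)
    have *: "W n (c(p := x, Suc p := y)) * f (c(p := x, Suc p := y)) = 0 + R * (d x * d y * f (c(p := x, Suc p := y)))" for x y
      unfolding W_upd[OF p] R_def by (simp add: mult.assoc)
    show "S p (\<lambda>c. W n c * f c) c = W n c * S p f c"
      unfolding S_def * s_linear s_zero s_weight[OF J J] Wc by simp
    have e0: "e (\<lambda>x y. 0) i j = 0" for i j by (simp add: e_def)
    show "E p (\<lambda>c. W n c * f c) c = W n c * E p f c"
      unfolding E_def * e_linear e0 e_weight[OF J J] Wc by simp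
  qed
  then show ?thesis using assms by (cases l) (auto simp: S'_def algebra_simps)
qed

lemma word_op_weight:
  assumes "w \<in> words n" "c \<in> conf n"
  shows "word_op w (\<lambda>c. W n c * f c) c = W n c * word_op w f c"
proof -
  have "\<forall>c\<in>conf n. foldr letter_op ls (\<lambda>c. W n c * f c) c = W n c * foldr letter_op ls f c"
    if "\<forall>x\<in>set ls. 1 \<le> letter_index x \<and> letter_index x < n" for ls
    using that
  proof (induction ls)
    case (Cons l ls)
    show ?case
    proof
      fix c assume c: "c \<in> conf n"
      have "letter_op l (foldr letter_op ls (\<lambda>c. W n c * f c)) c = letter_op l (\<lambda>c. W n c * foldr letter_op ls f c) c"
        using Cons c by (intro letter_op_local[of l n]) auto
      also have "\<dots> = W n c * letter_op l (foldr letter_op ls f) c"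
        using Cons c by (intro letter_op_weight) auto
      finally show "foldr letter_op (l # ls) (\<lambda>c. W n c * f c) c = W n c * foldr letter_op (l # ls) f c" by simp
    qed
  qed simp
  then show ?thesis using assms by (simp add: word_op_def words_def)
qed

lemma \<Phi>_weight:
  assumes "x \<in> carrier (free_alg n)" "c \<in> conf n"
  shows "\<Phi> x (\<lambda>c. W n c * f c) c = W n c * \<Phi> x f c"
  unfolding \<Phi>_def sum_distrib_left
proof (intro sum.cong refl)
  fix w assume "w \<in> Poly_Mapping.keys x"
  then have "w \<in> words n" using assms by (auto simp: free_alg_simps)
  then show "ev (Poly_Mapping.lookup x w) * word_op w (\<lambda>c. W n c * f c) c = W n c * (ev (Poly_Mapping.lookup x w) * word_op w f c)"
    using assms(2) by (simp add: word_op_weight)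
qed

text \<open>Matrix form of the commutation with \<open>W\<close>: the entry at \<open>(b, c)\<close>
  can be nonzero only between configurations of equal weight.\<close>

lemma \<Phi>_\<delta>_weight:
  assumes "x \<in> carrier (free_alg n)" "c \<in> conf n"
  shows "W n b * \<Phi> x (\<delta> b) c = W n c * \<Phi> x (\<delta> b) c"
proof -
  have "(\<lambda>c. W n c * \<delta> b c) = (\<lambda>c. 0 + W n b * \<delta> b c)"
    by (auto simp: \<delta>_def)
  then show ?thesis
    using \<Phi>_weight[OF assms, of "\<delta> b"] by (simp only: \<Phi>_linear \<Phi>_fun_zero) simp
qed

text \<open>The index exchange for the trace of a product; \<open>\<Phi>_\<delta>_weight\<close>
  moves the weight from \<open>c\<close> to \<open>b\<close> across the matrix entry.\<close>

lemma \<theta>_commute: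
  assumes x: "x \<in> carrier (free_alg n)" and y: "y \<in> carrier (free_alg n)"
  shows "\<theta> n (x * y) = \<theta> n (y * x)"
proof -
  have "\<theta> n (x * y) = (\<Sum>c\<in>conf n. \<Sum>b\<in>conf n. W n c * (\<Phi> y (\<delta> c) b * \<Phi> x (\<delta> b) c))"
    unfolding \<theta>_def \<Phi>_mult sum_distrib_left[symmetric]
    by (intro sum.cong refl arg_cong2[where f = "(*)"] \<Phi>_expand[OF x])
  also have "\<dots> = (\<Sum>c\<in>conf n. \<Sum>b\<in>conf n. W n b * (\<Phi> x (\<delta> b) c * \<Phi> y (\<delta> c) b))"
  proof (intro sum.cong refl)
    fix c b assume c: "c \<in> conf n"
    have "W n c * (\<Phi> y (\<delta> c) b * \<Phi> x (\<delta> b) c) = (W n c * \<Phi> x (\<delta> b) c) * \<Phi> y (\<delta> c) b"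
      by (simp only: mult_ac)
    also have "\<dots> = W n b * \<Phi> x (\<delta> b) c * \<Phi> y (\<delta> c) b"
      by (simp only: \<Phi>_\<delta>_weight[OF x c])
    finally show "W n c * (\<Phi> y (\<delta> c) b * \<Phi> x (\<delta> b) c) = W n b * (\<Phi> x (\<delta> b) c * \<Phi> y (\<delta> c) b)"
      by (simp only: mult.assoc)
  qed
  also have "\<dots> = (\<Sum>b\<in>conf n. \<Sum>c\<in>conf n. W n b * (\<Phi> x (\<delta> b) c * \<Phi> y (\<delta> c) b))"
    by (rule sum.swap)
  also have "\<dots> = \<theta> n (y * x)"
    unfolding \<theta>_def \<Phi>_mult sum_distrib_left[symmetric]
    by (intro sum.cong refl arg_cong2[where f = "(*)"] \<Phi>_expand[OF y, symmetric])
  finally show ?thesis .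
qed

section \<open>Removing the last strand, and the values at \<open>1\<close> and
  \<open>e_1\<close>\<close>

lemma letter_op_frozen:
  assumes "Suc (letter_index l) < r"
  shows "letter_op l f (c(r := y)) = letter_op l (\<lambda>c. f (c(r := y))) c"
proof -
  have *: "c(r := y, p := u, Suc p := v) = c(p := u, Suc p := v, r := y)" if "Suc p < r" for p u v
    using that by auto
  have "S p f (c(r := y)) = S p (\<lambda>c. f (c(r := y))) c" "E p f (c(r := y)) = E p (\<lambda>c. f (c(r := y))) c" if "Suc p < r" for p
    unfolding S_def E_def using that by (simp_all only: *[OF that]) simp_all
  then show ?thesis using assms by (cases l) (auto simp: S'_def)
qed

text \<open>Generators of index below \<open>n\<close> never touch position \<open>n + 1\<close>,
  whose value is then a mere parameter.\<close>

lemma \<Phi>_frozen: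
  assumes "x \<in> carrier (free_alg n)"
  shows "\<Phi> x f (c(Suc n := y)) = \<Phi> x (\<lambda>c. f (c(Suc n := y))) c"
proof -
  have "foldr letter_op ls f (c(Suc n := y)) = foldr letter_op ls (\<lambda>c. f (c(Suc n := y))) c"
    if "\<forall>x\<in>set ls. 1 \<le> letter_index x \<and> letter_index x < n" for ls c
    using that
  proof (induction ls arbitrary: c)
    case (Cons l ls)
    have "foldr letter_op (l # ls) f (c(Suc n := y)) = letter_op l (\<lambda>c. foldr letter_op ls f (c(Suc n := y))) c"
      using Cons.prems by (simp add: letter_op_frozen)
    also have "(\<lambda>c. foldr letter_op ls f (c(Suc n := y))) = foldr letter_op ls (\<lambda>c. f (c(Suc n := y)))"
    proof
      fix c
      show "foldr letter_op ls f (c(Suc n := y)) = foldr letter_op ls (\<lambda>c. f (c(Suc n := y))) c"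
        by (rule Cons.IH) (use Cons.prems in auto)
    qed
    finally show ?case by (simp only: foldr.simps o_apply)
  qed simp
  then show ?thesis
    unfolding \<Phi>_def using assms by (intro sum.cong) (auto simp: word_op_def words_def free_alg_simps)
qed

lemma W_Suc: "b \<in> conf n \<Longrightarrow> W (Suc n) (b(Suc n := j)) = W n b * d j"
proof -
  have "(\<Prod>k\<in>{1..n}. d ((b(Suc n := j)) k)) = (\<Prod>k\<in>{1..n}. d (b k))"
    by (rule prod.cong) auto
  then show "W (Suc n) (b(Suc n := j)) = W n b * d j"
    unfolding W_def by (simp add: prod.nat_ivl_Suc' mult.commute)
qed

text \<open>The trace property first gathers \<open>x\<close> and \<open>y\<close> on one side of
  \<open>s_n\<close>. The sum over the index at \<open>n + 1\<close> is then the partial trace of a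
  single crossing.\<close>

lemma \<theta>_stab:
  assumes n: "1 \<le> n" and x: "x \<in> carrier (free_alg n)" and y: "y \<in> carrier (free_alg n)"
  shows "\<theta> (Suc n) (x * s_gen n * y) = a * \<theta> n (x * y)"
proof -
  define w where "w = y * x"
  have w: "w \<in> carrier (free_alg n)" unfolding w_def by (rule free_alg_mult_closed[OF y x])
  have sub: "carrier (free_alg n) \<subseteq> carrier (free_alg (Suc n))" by (rule free_alg_mono) simp
  have "\<theta> (Suc n) (x * s_gen n * y) = \<theta> (Suc n) (x * (s_gen n * y))"
    by (simp add: mult.assoc)
  also have "\<dots> = \<theta> (Suc n) (s_gen n * w)"
  proof -
    have "x \<in> carrier (free_alg (Suc n))" by (rule subsetD[OF sub x])
    moreover have "s_gen n * y \<in> carrier (free_alg (Suc n))"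
      by (intro free_alg_mult_closed s_gen_closed n lessI subsetD[OF sub y])
    ultimately have "\<theta> (Suc n) (x * (s_gen n * y)) = \<theta> (Suc n) (s_gen n * y * x)"
      by (rule \<theta>_commute)
    then show ?thesis by (simp add: w_def mult.assoc)
  qed
  also have "\<dots> = (\<Sum>b\<in>conf n. \<Sum>j\<in>J. W n b * (d j * S n (\<Phi> w (\<delta> (b(Suc n := j)))) (b(Suc n := j))))"
    unfolding \<theta>_def sum_conf_Suc
    by (intro sum.cong refl) (simp add: W_Suc \<Phi>_mult \<Phi>_s_gen mult.assoc)
  also have "\<dots> = (\<Sum>b\<in>conf n. W n b * (a * \<Phi> w (\<delta> b) b))"
    unfolding sum_distrib_left[symmetric]
  proof (intro sum.cong refl arg_cong2[where f = "(*)"])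
    fix b assume b: "b \<in> conf n"
    have bJ: "b k \<in> J" for k using conf_Conf[OF b] by (simp add: Conf_J)
    define G where "G = (\<lambda>u. \<Phi> w (\<delta> b) (b(n := u)))"
    have "S n (\<Phi> w (\<delta> (b(Suc n := j)))) (b(Suc n := j)) = s (\<lambda>u v. if v = j then G u else 0) (b n) j"
      if j: "j \<in> J" for j
    proof -
      have "S n (\<Phi> w (\<delta> (b(Suc n := j)))) (b(Suc n := j)) =
        s (\<lambda>u v. \<Phi> w (\<delta> (b(Suc n := j))) ((b(n := u))(Suc n := v))) (b n) j"
        unfolding S_def by (simp add: fun_upd_twist)
      also have "\<dots> = s (\<lambda>u v. if v = j then G u else 0) (b n) j"
      proof (rule s_cong[OF bJ j])
        fix u v assume u: "u \<in> J" and v: "v \<in> J"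
        have bu: "b(n := u) \<in> conf n" using b u n by (intro conf_upd) auto
        have "\<Phi> w (\<delta> (b(Suc n := j))) ((b(n := u))(Suc n := v)) =
           \<Phi> w (\<lambda>c. \<delta> (b(Suc n := j)) (c(Suc n := v))) (b(n := u))"
          by (rule \<Phi>_frozen[OF w])
        also have "\<dots> = \<Phi> w (\<lambda>c. if v = j then \<delta> b c else 0) (b(n := u))"
        proof (rule \<Phi>_local[OF w bu])
          fix c assume c: "c \<in> conf n"
          \<comment> \<open>The dummy value makes configurations of length \<open>n\<close>
            recoverable after position \<open>n + 1\<close> has been overwritten.\<close>
          have "c (Suc n) = j0" "b (Suc n) = j0" using b c by (auto simp: conf_def)
          then have "c(Suc n := j) = b(Suc n := j) \<longleftrightarrow> c = b"
            by (metis fun_upd_triv fun_upd_upd)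
          moreover have "c(Suc n := v) = b(Suc n := j) \<Longrightarrow> v = j"
            by (metis fun_upd_same)
          ultimately show "\<delta> (b(Suc n := j)) (c(Suc n := v)) = (if v = j then \<delta> b c else 0)"
            by (auto simp: \<delta>_def)
        qed
        also have "\<dots> = (if v = j then G u else 0)"
          by (simp add: G_def \<Phi>_fun_zero)
        finally show "\<Phi> w (\<delta> (b(Suc n := j))) ((b(n := u))(Suc n := v)) = (if v = j then G u else 0)" .
      qed
      finally show ?thesis .
    qed
    then have "(\<Sum>j\<in>J. d j * S n (\<Phi> w (\<delta> (b(Suc n := j)))) (b(Suc n := j))) =
      (\<Sum>j\<in>J. d j * s (\<lambda>u v. if v = j then G u else 0) (b n) j)"
      by simp
    also have "\<dots> = a * G (b n)" by (rule partial_trace[OF bJ])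
    finally show "(\<Sum>j\<in>J. d j * S n (\<Phi> w (\<delta> (b(Suc n := j)))) (b(Suc n := j))) = a * \<Phi> w (\<delta> b) b"
      by (simp add: G_def)
  qed
  also have "\<dots> = a * \<theta> n w"
    by (simp add: \<theta>_def sum_distrib_left mult.left_commute)
  also have "\<theta> n w = \<theta> n (x * y)" unfolding w_def by (rule \<theta>_commute[OF y x])
  finally show ?thesis .
qed

lemma \<theta>_one: "\<theta> n 1 = (\<Sum>j\<in>J. d j) ^ n"
proof -
  have "\<theta> n 1 = (\<Sum>c\<in>conf n. W n c)" for n by (simp add: \<theta>_def \<Phi>_one \<delta>_def)
  moreover have "(\<Sum>c\<in>conf n. W n c) = (\<Sum>j\<in>J. d j) ^ n"
  proof (induction n)
    case 0
    then show ?case by (simp add: conf_0 W_def)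
  next
    case (Suc n)
    have "(\<Sum>c\<in>conf (Suc n). W (Suc n) c) = (\<Sum>b\<in>conf n. \<Sum>j\<in>J. W n b * d j)"
      unfolding sum_conf_Suc by (intro sum.cong refl W_Suc)
    also have "\<dots> = (\<Sum>b\<in>conf n. W n b) * (\<Sum>j\<in>J. d j)"
      by (rule sum_product[symmetric])
    finally show ?case using Suc by simp
  qed
  ultimately show ?thesis by simp
qed

text \<open>On the support of \<open>e\<close> the weight \<open>d i * d (- i)\<close> is
  \<open>1\<close>, so the trace is that of the untwisted rank-one operator. For the general linear
  index sets all summands are zero.\<close>

lemma \<theta>_e:
  "\<theta> 2 (e_gen 1) = (\<Sum>i\<in>J. if - i \<in> J then t i * t i else 0)"
proof -
  have "\<theta> 2 (e_gen 1) = (\<Sum>b\<in>conf 0. \<Sum>i\<in>J. \<Sum>j\<in>J.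
      W 2 (b(1 := i, 2 := j)) * E 1 (\<delta> (b(1 := i, 2 := j))) (b(1 := i, 2 := j)))"
    unfolding \<theta>_def \<Phi>_e_gen numeral_2_eq_2 sum_conf_Suc by simp
  also have "\<dots> = (\<Sum>i\<in>J. \<Sum>j\<in>J. if j = - i then t i * t i else 0)"
    unfolding conf_0
  proof -
    define b :: "nat \<Rightarrow> int" where "b = (\<lambda>k. j0)"
    have "W 2 (b(1 := i, 2 := j)) * E 1 (\<delta> (b(1 := i, 2 := j))) (b(1 := i, 2 := j)) = (if j = - i then t i * t i else 0)"
      if "i \<in> J" "j \<in> J" for i j
    proof (cases "j = - i")
      case True
      have W: "W 2 (b(1 := i, 2 := j)) = d i * d j"
        by (simp add: W_def numeral_2_eq_2)
      have \<delta>: "\<delta> (b(1 := i, 2 := j)) (b(1 := i, 2 := j, 1 := x, Suc 1 := y)) = (if x = i \<and> y = j then 1 else 0)" for x y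
        by (auto simp: \<delta>_def fun_eq_iff numeral_2_eq_2 split: if_splits)
      have "E 1 (\<delta> (b(1 := i, 2 := j))) (b(1 := i, 2 := j)) = t i * (\<Sum>k\<in>J. if k = i then t k else 0)"
        unfolding E_def \<delta> using True by (auto simp: e_def numeral_2_eq_2 intro!: arg_cong2[where f = "(*)"] sum.cong)
      then show ?thesis using W True that fin dd[of i] by simp
    next
      case False
      then show ?thesis by (simp add: E_def e_def numeral_2_eq_2)
    qed
    then show "(\<Sum>b\<in>{\<lambda>k. j0}. \<Sum>i\<in>J. \<Sum>j\<in>J. W 2 (b(1 := i, 2 := j)) * E 1 (\<delta> (b(1 := i, 2 := j))) (b(1 := i, 2 := j)))
       = (\<Sum>i\<in>J. \<Sum>j\<in>J. if j = - i then t i * t i else 0)"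
      by (simp add: b_def)
  qed
  also have "\<dots> = (\<Sum>i\<in>J. if - i \<in> J then t i * t i else 0)"
    using fin by (intro sum.cong refl) simp
  finally show ?thesis .
qed

end

section \<open>Specialization of the coefficients\<close>

definition poly_ev :: "complex \<Rightarrow> complex \<Rightarrow> complex poly poly \<Rightarrow> complex" where
  "poly_ev a q p = poly (poly p [:a:]) q"

lemma poly_ev_simps:
  "poly_ev a q (p + r) = poly_ev a q p + poly_ev a q r"
  "poly_ev a q (p * r) = poly_ev a q p * poly_ev a q r"
  "poly_ev a q (p - r) = poly_ev a q p - poly_ev a q r"
  "poly_ev a q 1 = 1" "poly_ev a q (p ^ k) = poly_ev a q p ^ k"
  by (simp_all add: poly_ev_def)

lemma poly_ev_vars:
  "poly_ev a q [:0, 1:] = a" "poly_ev a q [:[:0, 1:]:] = q" "poly_ev a q [:[:c:]:] = c"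
  by (simp_all add: poly_ev_def)

text \<open>A common denominator of the generators of \<open>R\<close>; note that
  \<open>inverse (q - inverse q) = q / (q * q - 1)\<close>.\<close>

definition denom :: "complex poly poly" where
  "denom = [:0, 1:] * [:[:0, 1:]:] * ([:[:0, 1:]:] * [:[:0, 1:]:] - 1)"

definition poly_rf :: "complex poly poly \<Rightarrow> ratfun" where
  "poly_rf p = Fract p 1"

lemma poly_rf_simps:
  "poly_rf (p + r) = poly_rf p + poly_rf r" "poly_rf (p * r) = poly_rf p * poly_rf r" "poly_rf (p - r) = poly_rf p - poly_rf r"
  "poly_rf 1 = 1" "poly_rf 0 = 0"
  by (simp_all add: poly_rf_def One_fract_def Zero_fract_def)

lemma poly_rf_power: "poly_rf (p ^ k) = poly_rf p ^ k"
  by (induction k) (simp_all add: poly_rf_simps)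

lemma poly_rf_inject: "poly_rf p = poly_rf r \<longleftrightarrow> p = r"
  by (simp add: poly_rf_def eq_fract)

lemma poly_rf_vars: "poly_rf [:[:c:]:] = const_rf c" "poly_rf [:0, 1:] = a_rf" "poly_rf [:[:0, 1:]:] = q_rf"
  by (simp_all add: poly_rf_def const_rf_def a_rf_def q_rf_def)

lemma poly_rf_denom: "poly_rf denom = a_rf * q_rf * (q_rf * q_rf - 1)"
  by (simp only: denom_def poly_rf_simps poly_rf_vars)

lemma rf_nonzero: "a_rf \<noteq> 0" "q_rf \<noteq> 0" "q_rf * q_rf - 1 \<noteq> 0"
proof -
  show "a_rf \<noteq> 0" "q_rf \<noteq> 0" by (simp_all add: a_rf_def q_rf_def Zero_fract_def eq_fract)
  show "q_rf * q_rf - 1 \<noteq> 0" using q_rf_square_ne_1 by simp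
qed

lemma denom_nonzero: "denom \<noteq> 0"
  using poly_rf_denom rf_nonzero poly_rf_simps(5) by auto

lemma coeff_set_clear_denom: "x \<in> coeff_set \<Longrightarrow> \<exists>p k. x * poly_rf denom ^ k = poly_rf p"
proof (induction rule: coeff_set.induct)
  case (const c)
  show ?case by (rule exI[of _ "[:[:c:]:]"], rule exI[of _ 0]) (simp add: poly_rf_vars)
next
  case a
  show ?case by (rule exI[of _ "[:0, 1:]"], rule exI[of _ 0]) (simp add: poly_rf_vars)
next
  case q
  show ?case by (rule exI[of _ "[:[:0, 1:]:]"], rule exI[of _ 0]) (simp add: poly_rf_vars)
next
  case a_inv
  have "inverse a_rf * poly_rf denom ^ 1 = poly_rf ([:[:0, 1:]:] * ([:[:0, 1:]:] * [:[:0, 1:]:] - 1))"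
    using rf_nonzero by (simp only: poly_rf_denom poly_rf_simps poly_rf_vars) simp
  then show ?case by blast
next
  case q_inv
  have "inverse q_rf * poly_rf denom ^ 1 = poly_rf ([:0, 1:] * ([:[:0, 1:]:] * [:[:0, 1:]:] - 1))"
    using rf_nonzero by (simp only: poly_rf_denom poly_rf_simps poly_rf_vars) simp
  then show ?case by blast
next
  case z
  have "(q_rf - inverse q_rf) * poly_rf denom ^ 1 = a_rf * (q_rf * q_rf - 1) * (q_rf * q_rf - 1)"
    using rf_nonzero by (simp add: poly_rf_denom field_simps)
  also have "\<dots> = poly_rf ([:0, 1:] * ([:[:0, 1:]:] * [:[:0, 1:]:] - 1) * ([:[:0, 1:]:] * [:[:0, 1:]:] - 1))"
    by (simp only: poly_rf_simps poly_rf_vars)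
  finally show ?case by blast
next
  case z_inv
  have "q_rf - inverse q_rf = (q_rf * q_rf - 1) / q_rf" using rf_nonzero by (simp add: field_simps)
  then have "inverse (q_rf - inverse q_rf) = q_rf / (q_rf * q_rf - 1)" by simp
  then have "inverse (q_rf - inverse q_rf) * poly_rf denom ^ 1 = a_rf * q_rf * q_rf"
    using rf_nonzero by (simp add: poly_rf_denom)
  also have "\<dots> = poly_rf ([:0, 1:] * [:[:0, 1:]:] * [:[:0, 1:]:])"
    by (simp only: poly_rf_simps poly_rf_vars)
  finally show ?case by blast
next
  case (add x y)
  then obtain p k r l where "x * poly_rf denom ^ k = poly_rf p" "y * poly_rf denom ^ l = poly_rf r" by blast
  moreover have "(x + y) * D ^ (k + l) = (x * D ^ k) * D ^ l + (y * D ^ l) * D ^ k" for D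
    by (simp add: power_add algebra_simps)
  ultimately have "(x + y) * poly_rf denom ^ (k + l) = poly_rf (p * denom ^ l + r * denom ^ k)"
    by (simp add: poly_rf_simps poly_rf_power)
  then show ?case by blast
next
  case (mult x y)
  then obtain p k r l where "x * poly_rf denom ^ k = poly_rf p" "y * poly_rf denom ^ l = poly_rf r" by blast
  then have "(x * poly_rf denom ^ k) * (y * poly_rf denom ^ l) = poly_rf (p * r)"
    by (simp only: poly_rf_simps)
  then have "(x * y) * poly_rf denom ^ (k + l) = poly_rf (p * r)"
    by (simp only: power_add mult_ac)
  then show ?case by blast
qed

definition cleared :: "coeff \<Rightarrow> complex poly poly \<Rightarrow> nat \<Rightarrow> bool" where
  "cleared x p k \<longleftrightarrow> Rep_coeff x * poly_rf denom ^ k = poly_rf p"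

lemma ex_cleared: "\<exists>p k. cleared x p k"
  unfolding cleared_def by (rule coeff_set_clear_denom[OF Rep_coeff])

text \<open>As \<open>R\<close> is a subring of the fraction field, evaluation clears denominators
  by a power of \<open>denom\<close>. By \<open>ev_cleared\<close> the choice is immaterial at
  points where \<open>denom\<close> does not vanish.\<close>

definition ev :: "complex \<Rightarrow> complex \<Rightarrow> coeff \<Rightarrow> complex" where
  "ev a q x = (SOME c. \<exists>p k. cleared x p k \<and> c = poly_ev a q p / poly_ev a q denom ^ k)"

locale ev_point =
  fixes a q :: complex
  assumes a0: "a \<noteq> 0" and q0: "q \<noteq> 0" and q1: "q * q \<noteq> 1"
begin

lemma denom_ev: "poly_ev a q denom = a * q * (q * q - 1)" "poly_ev a q denom \<noteq> 0"
  using a0 q0 q1 by (simp_all only: denom_def poly_ev_simps poly_ev_vars) auto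

lemma ev_cleared:
  assumes "cleared x p k"
  shows "ev a q x = poly_ev a q p / poly_ev a q denom ^ k"
proof -
  have "\<exists>c p k. cleared x p k \<and> c = poly_ev a q p / poly_ev a q denom ^ k"
    using assms by blast
  from someI_ex[OF this] obtain p' k' where
    "cleared x p' k'" and ev: "ev a q x = poly_ev a q p' / poly_ev a q denom ^ k'"
    unfolding ev_def by blast
  then have "poly_rf p' * poly_rf denom ^ k = Rep_coeff x * poly_rf denom ^ k' * poly_rf denom ^ k"
    by (simp add: cleared_def)
  also have "\<dots> = Rep_coeff x * poly_rf denom ^ k * poly_rf denom ^ k'"
    by (simp only: mult_ac)
  also have "\<dots> = poly_rf p * poly_rf denom ^ k'"
    using assms by (simp add: cleared_def)
  finally have "p' * denom ^ k = p * denom ^ k'"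
    by (simp only: poly_rf_simps(2)[symmetric] poly_rf_power[symmetric] poly_rf_inject)
  then have "poly_ev a q p' * poly_ev a q denom ^ k = poly_ev a q p * poly_ev a q denom ^ k'"
    by (metis poly_ev_simps(2,5))
  then show ?thesis
    unfolding ev using denom_ev(2) by (simp add: field_simps)
qed

lemma ev_add: "ev a q (x + y) = ev a q x + ev a q y"
proof -
  obtain p k r l where c: "cleared x p k" "cleared y r l" using ex_cleared by metis
  have "(x + y) * D ^ (k + l) = (x * D ^ k) * D ^ l + (y * D ^ l) * D ^ k" for x y D :: ratfun
    by (simp add: power_add algebra_simps)
  then have "cleared (x + y) (p * denom ^ l + r * denom ^ k) (k + l)"
    using c by (simp add: cleared_def plus_coeff.rep_eq poly_rf_simps poly_rf_power)
  then show ?thesis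
    using c denom_ev(2) by (simp add: ev_cleared poly_ev_simps power_add field_simps)
qed

lemma ev_mult: "ev a q (x * y) = ev a q x * ev a q y"
proof -
  obtain p k r l where c: "cleared x p k" "cleared y r l" using ex_cleared by metis
  then have "(Rep_coeff x * poly_rf denom ^ k) * (Rep_coeff y * poly_rf denom ^ l) = poly_rf (p * r)"
    by (simp only: cleared_def poly_rf_simps)
  then have "cleared (x * y) (p * r) (k + l)"
    by (simp only: cleared_def times_coeff.rep_eq power_add mult_ac)
  then show ?thesis
    using c by (simp add: ev_cleared poly_ev_simps power_add)
qed

lemma ev_1: "ev a q 1 = 1"
proof -
  have "cleared 1 1 0" by (simp add: cleared_def one_coeff.rep_eq poly_rf_simps)
  then show ?thesis by (simp add: ev_cleared poly_ev_simps)
qed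

lemma ev_a: "ev a q a_par = a" and ev_q: "ev a q q_par = q"
proof -
  have "cleared a_par [:0, 1:] 0" by (simp add: cleared_def a_par.rep_eq poly_rf_vars)
  then show "ev a q a_par = a" by (simp add: ev_cleared poly_ev_vars)
  have "cleared q_par [:[:0, 1:]:] 0" by (simp add: cleared_def q_par.rep_eq poly_rf_vars)
  then show "ev a q q_par = q" by (simp add: ev_cleared poly_ev_vars)
qed

lemma ev_ai: "ev a q a_par_inv = inverse a"
  using ev_mult[of a_par a_par_inv] a0 by (simp add: a_par_inverse ev_1 ev_a field_simps)

lemma ev_qi: "ev a q q_par_inv = inverse q"
  using ev_mult[of q_par q_par_inv] q0 by (simp add: q_par_inverse ev_1 ev_q field_simps)

lemma ev_zi: "ev a q z_par_inv * (q - inverse q) = 1"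
proof -
  have "ev a q (q_par - q_par_inv) = q - inverse q"
    using ev_add[of "q_par - q_par_inv" q_par_inv] unfolding diff_add_cancel ev_q ev_qi
    by (metis add_diff_cancel_right')
  then show ?thesis
    using ev_mult[of "q_par - q_par_inv" z_par_inv] unfolding z_par_inverse ev_1 by (simp add: mult.commute)
qed

end

section \<open>A dense set of points detects zero\<close>

lemma poly_zero_infinite:
  assumes "infinite A" "\<And>x. x \<in> A \<Longrightarrow> poly p x = (0 :: complex)"
  shows "p = 0"
proof (rule ccontr)
  assume "p \<noteq> 0"
  then have "finite {x. poly p x = 0}" by (rule poly_roots_finite)
  moreover have "A \<subseteq> {x. poly p x = 0}" using assms(2) by auto
  ultimately show False using assms(1) finite_subset by blast
qed

text \<open>For fixed \<open>q = r\<close> the powers \<open>r ^ (2 * M - 1)\<close> are infinitely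
  many values of \<open>a\<close>, so the numerator vanishes as a polynomial in \<open>a\<close>.
  Each of its coefficients is a polynomial in \<open>q\<close> with all \<open>r > 1\<close> as
  roots, hence zero.\<close>

lemma coeff_zeroI:
  assumes "\<And>r M. r > 1 \<Longrightarrow> 1 \<le> M \<Longrightarrow> ev (complex_of_real (r ^ (2 * M - 1))) (complex_of_real r) x = 0"
  shows "x = 0"
proof -
  obtain p k where c: "cleared x p k" using ex_cleared by metis
  have "poly (coeff p i) (complex_of_real r) = 0" if r: "r > 1" for r i
  proof -
    have "poly_ev (complex_of_real (r ^ (2 * M - 1))) (complex_of_real r) p = 0" if "1 \<le> M" for M
    proof -
      have "r * r \<noteq> 1" using r by (metis less_1_mult less_irrefl)
      then have "complex_of_real r * complex_of_real r \<noteq> 1"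
        by (metis of_real_1 of_real_eq_iff of_real_mult)
      then interpret ev_point "complex_of_real (r ^ (2 * M - 1))" "complex_of_real r"
        using r by unfold_locales auto
      show ?thesis using assms[OF r that] ev_cleared[OF c] denom_ev(2) by simp
    qed
    note zero = this
    define P where "P = map_poly (\<lambda>c. poly c (complex_of_real r)) p"
    have P: "poly P b = poly_ev b (complex_of_real r) p" for b
      unfolding P_def poly_ev_def by (induction p) (simp_all add: map_poly_pCons)
    have "P = 0"
    proof (rule poly_zero_infinite)
      have "inj (\<lambda>M. complex_of_real (r ^ (2 * Suc M - 1)))"
      proof (rule injI)
        fix x y assume "complex_of_real (r ^ (2 * Suc x - 1)) = complex_of_real (r ^ (2 * Suc y - 1))"
        then have "2 * Suc x - 1 = 2 * Suc y - 1"
          unfolding of_real_eq_iff power_inject_exp[OF r] .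
        then show "x = y" by simp
      qed
      then show "infinite (range (\<lambda>M. complex_of_real (r ^ (2 * Suc M - 1))))"
        by (rule range_inj_infinite)
      fix b assume "b \<in> range (\<lambda>M. complex_of_real (r ^ (2 * Suc M - 1)))"
      then obtain M where "b = complex_of_real (r ^ (2 * Suc M - 1))" by blast
      then show "poly P b = 0" using zero[of "Suc M"] by (simp only: P)
    qed
    then have "coeff P i = 0" by simp
    then show ?thesis by (simp add: P_def coeff_map_poly)
  qed
  then have "coeff p i = 0" for i
  proof (intro poly_zero_infinite)
    have "inj complex_of_real" by (auto simp: inj_def)
    then show "infinite (complex_of_real ` {1<..})"
      by (simp add: finite_image_iff inj_on_subset[of _ UNIV] infinite_Ioi)
  qed auto
  then have "p = 0" by (simp add: poly_eq_iff)
  then have "Rep_coeff x * poly_rf denom ^ k = 0"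
    using c by (simp add: cleared_def poly_rf_simps)
  moreover have "poly_rf denom \<noteq> 0" using denom_nonzero poly_rf_inject[of denom 0] by (simp add: poly_rf_simps)
  ultimately have "Rep_coeff x = 0" by simp
  then show ?thesis by (metis Rep_coeff_inject zero_coeff.rep_eq)
qed

section \<open>The two families of R-matrices\<close>

text \<open>Telescoping: \<open>(q - qi) * q^(2p) = qi * (q^(2p+2) - q^(2p))\<close>.\<close>

lemma geometric_sum:
  fixes q qi :: "'k::field"
  assumes "q * qi = 1" "m \<le> n"
  shows "(q - qi) * (\<Sum>p\<in>{m..<n}. q ^ p * q ^ p) = qi * (q ^ n * q ^ n - q ^ m * q ^ m)"
  using assms(2)
proof (induction n rule: dec_induct)
  case (step n)
  have "q * (qi * x) = x" "qi * (q * x) = x" for x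
    using assms(1) by (simp_all add: mult.assoc[symmetric] mult.commute[of qi])
  note qq = this
  show ?case using step by (simp add: qq algebra_simps)
qed simp

text \<open>The exponent is \<open>i - 1\<close> for positive and \<open>i + 1\<close> for negative
  indices, so both middle indices \<open>1\<close> and \<open>- 1\<close> have weight
  \<open>1\<close>, as for the even orthogonal groups. Its square is the diagonal of the quantum
  trace.\<close>

definition weight :: "complex \<Rightarrow> int \<Rightarrow> complex" where
  "weight q i = (if i > 0 then q ^ nat (i - 1) else inverse q ^ nat (- i - 1))"

lemma weight_simps: "weight q (int p + 1) = q ^ p" "weight q (- int p - 1) = inverse q ^ p"
  by (simp_all add: weight_def)

lemma weight_inverse: "q \<noteq> 0 \<Longrightarrow> i \<noteq> 0 \<Longrightarrow> weight q i * weight q (- i) = 1"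
  by (auto simp: weight_def power_mult_distrib[symmetric])

context ev_point
begin

abbreviation "w i \<equiv> weight q i * weight q i"

lemma neg_sum: "(\<Sum>j\<in>{- int M..<- int m}. w j) = (\<Sum>p\<in>{m..<M}. inverse q ^ p * inverse q ^ p)"
proof -
  have "{- int M..<- int m} = (\<lambda>p. - int p - 1) ` {m..<M}"
  proof (intro equalityI subsetI)
    fix j assume "j \<in> {- int M..<- int m}"
    then show "j \<in> (\<lambda>p. - int p - 1) ` {m..<M}"
      by (intro image_eqI[of _ _ "nat (- j - 1)"]) auto
  qed auto
  then show ?thesis by (simp add: sum.reindex inj_on_def weight_simps)
qed

lemma pos_sum: "(\<Sum>j\<in>{int m<..int M}. w j) = (\<Sum>p\<in>{m..<M}. q ^ p * q ^ p)"
proof -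
  have "{int m<..int M} = (\<lambda>p. int p + 1) ` {m..<M}"
  proof (intro equalityI subsetI)
    fix j assume "j \<in> {int m<..int M}"
    then show "j \<in> (\<lambda>p. int p + 1) ` {m..<M}"
      by (intro image_eqI[of _ _ "nat (j - 1)"]) auto
  qed auto
  then show ?thesis by (simp add: sum.reindex inj_on_def weight_simps)
qed

lemma z_neg_sum:
  assumes "m \<le> M"
  shows "(q - inverse q) * (\<Sum>j\<in>{- int M..<- int m}. w j) =
    q * (inverse q ^ m * inverse q ^ m - inverse q ^ M * inverse q ^ M)"
  using geometric_sum[of "inverse q" q m M] q0 assms unfolding neg_sum by (simp add: algebra_simps)

lemma z_pos_sum:
  assumes "m \<le> M"
  shows "(q - inverse q) * (\<Sum>j\<in>{int m<..int M}. w j) = inverse q * (q ^ M * q ^ M - q ^ m * q ^ m)"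
  using geometric_sum[of q "inverse q" m M] q0 assms unfolding pos_sum by simp

text \<open>The constant in front of \<open>w\<close> is forced by \<open>D\<close> at
  \<open>i = N\<close>, which reads \<open>q * d N = a\<close>; the geometric sum makes the left
  side of \<open>D\<close> independent of \<open>i\<close>. Here \<open>a\<close> only scales the
  diagonal and remains free.\<close>

lemma hecke_rmatrix:
  "bmw_rmatrix {0<..int N} q (inverse q) a (inverse a) (q - inverse q) (weight q)
    (\<lambda>i. a * q * (inverse q ^ N * inverse q ^ N) * w i)"
proof
  fix i assume i: "i \<in> {0<..int N}"
  define m where "m = nat i"
  have m: "i = int m" "1 \<le> m" "m \<le> N" using i by (auto simp: m_def)
  have eq: "{j \<in> {0<..int N}. i < j} = {int m<..int N}" using m by auto
  have w: "w i = inverse q * inverse q * (q ^ m * q ^ m)"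
  proof -
    obtain m' where m': "m = Suc m'" using m by (cases m) auto
    have "w i = q ^ m' * q ^ m'" using weight_simps(1)[of q m'] by (simp add: m(1) m' add.commute)
    then show ?thesis using q0 by (simp add: m' field_simps)
  qed
  define A where "A = a * q * (inverse q ^ N * inverse q ^ N)"
  have A: "A * (inverse q * (q ^ N * q ^ N)) = a"
  proof -
    have "A * (inverse q * (q ^ N * q ^ N)) = a * (q * inverse q) * (inverse q ^ N * q ^ N) * (inverse q ^ N * q ^ N)"
      unfolding A_def by (simp only: mult_ac)
    moreover have "inverse q ^ N * q ^ N = 1"
      using q0 by (simp add: power_mult_distrib[symmetric])
    ultimately show ?thesis using q0 by simp
  qed
  have "q * (A * w i) + (q - inverse q) * (\<Sum>j\<in>{int m<..int N}. A * w j) =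
     A * (q * w i + (q - inverse q) * (\<Sum>j\<in>{int m<..int N}. w j))"
    by (simp add: sum_distrib_left[symmetric] algebra_simps)
  also have "\<dots> = A * (inverse q * (q ^ N * q ^ N))"
    unfolding z_pos_sum[OF m(3)] w using q0 by (simp add: algebra_simps)
  finally have "q * (A * w i) + (q - inverse q) * (\<Sum>j\<in>{int m<..int N}. A * w j) = a"
    unfolding A .
  then show "q * (a * q * (inverse q ^ N * inverse q ^ N) * w i) + (q - inverse q) *
      (\<Sum>j\<in>{j \<in> {0<..int N}. i < j}. a * q * (inverse q ^ N * inverse q ^ N) * w j) -
      (if - i \<in> {0<..int N} \<and> i < 0 then (q - inverse q) *
        (w i * (a * q * (inverse q ^ N * inverse q ^ N) * w (- i))) else 0) = a"
    unfolding eq using m by (simp add: A_def)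
qed (use a0 q0 weight_inverse in auto)

text \<open>The value of \<open>a\<close> is forced by \<open>T\<close> at the smallest index
  \<open>- M\<close>, where the partial sum is empty and \<open>qi * w (- M) = inverse a\<close>.
  The sum above \<open>i\<close> in \<open>D\<close> is the total from \<open>TT\<close> minus the
  part from \<open>T\<close>.\<close>

lemma orthogonal_rmatrix:
  assumes aM: "a = inverse q * (q ^ M * q ^ M)"
  shows "bmw_rmatrix ({- int M..int M} - {0}) q (inverse q) a (inverse a) (q - inverse q) (weight q) w"
proof -
  let ?J = "{- int M..int M} - {0}" and ?z = "q - inverse q"
  have ai: "inverse a = q * (inverse q ^ M * inverse q ^ M)"
    unfolding aM by (simp add: power_inverse)
  have weight_m: "w i = inverse q * inverse q * (q ^ m * q ^ m)" if i: "i = int m" and m: "1 \<le> m" for i m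
  proof -
    obtain m' where m': "m = Suc m'" using m by (cases m) auto
    have "w i = q ^ m' * q ^ m'" using weight_simps(1)[of q m'] by (simp add: i m' add.commute)
    then show ?thesis using q0 by (simp add: m' field_simps)
  qed
  have weight_neg: "w i = q * q * (inverse q ^ m * inverse q ^ m)" if i: "i = - int m" and m: "1 \<le> m" for i m
  proof -
    obtain m' where m': "m = Suc m'" using m by (cases m) auto
    have "- int m = - int m' - 1" using m' by simp
    then have "w i = inverse q ^ m' * inverse q ^ m'" using weight_simps(2)[of q m'] i by simp
    then show ?thesis using q0 by (simp add: m' field_simps)
  qed
  have T: "?z * (\<Sum>j\<in>{j\<in>?J. j < k}. w j) = inverse q * w k + (if k > 0 then ?z else 0) - inverse a"
    if k: "k \<in> ?J" for k
  proof (cases "k > 0")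
    case False
    define m where "m = nat (- k)"
    have m: "k = - int m" "1 \<le> m" "m \<le> M" using k False by (auto simp: m_def)
    have "{j\<in>?J. j < k} = {- int M..<- int m}" using m by auto
    then show ?thesis
      using False z_neg_sum[OF m(3)] q0 by (simp add: weight_neg[OF m(1,2)] ai algebra_simps)
  next
    case True
    define m where "m = nat (k - 1)"
    have m: "k = int m + 1" "m \<le> M" using k True by (auto simp: m_def)
    have wk: "w k = q ^ m * q ^ m" unfolding m(1) weight_simps ..
    have *: "{j\<in>?J. j < k} = {- int M..<- int 0} \<union> {int 0<..int m}" using m by auto
    have "(\<Sum>j\<in>{j\<in>?J. j < k}. w j) = (\<Sum>j\<in>{- int M..<- int 0}. w j) + (\<Sum>j\<in>{int 0<..int m}. w j)"
      unfolding * by (rule sum.union_disjoint) auto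
    then have "?z * (\<Sum>j\<in>{j\<in>?J. j < k}. w j) =
      q * (inverse q ^ 0 * inverse q ^ 0 - inverse q ^ M * inverse q ^ M) + inverse q * (q ^ m * q ^ m - q ^ 0 * q ^ 0)"
      by (simp only: distrib_left z_neg_sum[OF le0] z_pos_sum[OF le0])
    then show ?thesis
      using True unfolding wk ai by (simp add: algebra_simps)
  qed
  have TT: "?z * (\<Sum>j\<in>?J. w j) = a - inverse a + ?z"
  proof -
    have *: "?J = {- int M..<- int 0} \<union> {int 0<..int M}" by auto
    have "(\<Sum>j\<in>?J. w j) = (\<Sum>j\<in>{- int M..<- int 0}. w j) + (\<Sum>j\<in>{int 0<..int M}. w j)"
      unfolding * by (rule sum.union_disjoint) auto
    then have "?z * (\<Sum>j\<in>?J. w j) =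
      q * (inverse q ^ 0 * inverse q ^ 0 - inverse q ^ M * inverse q ^ M) + inverse q * (q ^ M * q ^ M - q ^ 0 * q ^ 0)"
      by (simp only: distrib_left z_neg_sum[OF le0] z_pos_sum[OF le0])
    then show ?thesis
      unfolding ai by (simp add: aM algebra_simps)
  qed
  show ?thesis
  proof
    fix i assume i: "i \<in> ?J"
    have w1: "w i * w (- i) = 1"
      using weight_inverse[OF q0, of i] i by (simp add: mult_ac)
    then show "w i * w (- i) = 1" .
    have *: "?J = insert i ({j\<in>?J. i < j} \<union> {j\<in>?J. j < i})" using i by auto
    have "(\<Sum>j\<in>?J. w j) = w i + ((\<Sum>j\<in>{j\<in>?J. i < j}. w j) + (\<Sum>j\<in>{j\<in>?J. j < i}. w j))"
    proof -
      have fin: "finite {j\<in>?J. i < j}" "finite {j\<in>?J. j < i}"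
        by (rule finite_subset[of _ ?J]; auto)+
      have "(\<Sum>j\<in>?J. w j) = (\<Sum>j\<in>insert i ({j\<in>?J. i < j} \<union> {j\<in>?J. j < i}). w j)"
        by (rule arg_cong[OF *])
      also have "\<dots> = w i + (\<Sum>j\<in>{j\<in>?J. i < j} \<union> {j\<in>?J. j < i}. w j)"
        by (rule sum.insert) (use fin in auto)
      also have "(\<Sum>j\<in>{j\<in>?J. i < j} \<union> {j\<in>?J. j < i}. w j) = (\<Sum>j\<in>{j\<in>?J. i < j}. w j) + (\<Sum>j\<in>{j\<in>?J. j < i}. w j)"
        by (rule sum.union_disjoint[OF fin]) auto
      finally show ?thesis .
    qed
    then have "?z * (\<Sum>j\<in>{j\<in>?J. i < j}. w j) = ?z * (\<Sum>j\<in>?J. w j) - ?z * w i - ?z * (\<Sum>j\<in>{j\<in>?J. j < i}. w j)"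
      by (simp add: algebra_simps)
    also have "\<dots> = a + ?z - q * w i - (if i > 0 then ?z else 0)"
      unfolding T[OF i] TT by (simp add: algebra_simps)
    finally have D: "?z * (\<Sum>j\<in>{j\<in>?J. i < j}. w j) = a + ?z - q * w i - (if i > 0 then ?z else 0)" .
    show "q * w i + ?z * (\<Sum>j\<in>{j\<in>?J. i < j}. w j) - (if - i \<in> ?J \<and> i < 0 then ?z * (w i * w (- i)) else 0) = a"
      unfolding D w1 using i by (auto simp: algebra_simps)
  next
    show "weight q i * weight q (- i) = 1" if "i \<in> ?J" for i
      using weight_inverse[OF q0] that by auto
  qed (use a0 q0 T TT in auto)
qed

lemma hecke_rep:
  assumes "1 \<le> N"
  shows "bmw_rep {0<..int N} q (inverse q) a (inverse a) (q - inverse q) (weight q)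
    (\<lambda>i. a * q * (inverse q ^ N * inverse q ^ N) * w i) (ev a q) 1"
  by (intro bmw_rep.intro hecke_rmatrix bmw_rep_axioms.intro)
    (use assms in \<open>simp_all add: ev_add ev_mult ev_1 ev_a ev_ai ev_zi\<close>)

lemma orthogonal_rep:
  assumes "1 \<le> M" "a = inverse q * (q ^ M * q ^ M)"
  shows "bmw_rep ({- int M..int M} - {0}) q (inverse q) a (inverse a) (q - inverse q) (weight q) w (ev a q) 1"
  by (intro bmw_rep.intro orthogonal_rmatrix[OF assms(2)] bmw_rep_axioms.intro)
    (use assms(1) in \<open>simp_all add: ev_add ev_mult ev_1 ev_a ev_ai ev_zi\<close>)

end

section \<open>Relations between adjacent generators\<close>

text \<open>Congruence modulo an ideal \<open>I\<close> of a subring \<open>C\<close>. Computations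
  stay with the ring operations of the type, while \<open>C\<close> and \<open>I\<close> vary with
  the number of strands.\<close>

locale cong_ring =
  fixes C I :: "'r::ring_1 set"
  assumes C_one: "1 \<in> C" and C_add: "x \<in> C \<Longrightarrow> y \<in> C \<Longrightarrow> x + y \<in> C"
    and C_mult: "x \<in> C \<Longrightarrow> y \<in> C \<Longrightarrow> x * y \<in> C" and C_uminus: "x \<in> C \<Longrightarrow> - x \<in> C"
    and I_C: "x \<in> I \<Longrightarrow> x \<in> C" and I_zero: "0 \<in> I" and I_add: "x \<in> I \<Longrightarrow> y \<in> I \<Longrightarrow> x + y \<in> I"
    and I_left: "x \<in> C \<Longrightarrow> y \<in> I \<Longrightarrow> x * y \<in> I" and I_right: "y \<in> I \<Longrightarrow> x \<in> C \<Longrightarrow> y * x \<in> I"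
begin

lemmas C_simps [simp] = C_one C_add C_mult C_uminus

lemma C_diff [simp]: "x \<in> C \<Longrightarrow> y \<in> C \<Longrightarrow> x - y \<in> C"
  using C_add[of x "- y"] by simp

definition cg :: "'r \<Rightarrow> 'r \<Rightarrow> bool" (infix "\<approx>" 50) where
  "x \<approx> y \<longleftrightarrow> x \<in> C \<and> y \<in> C \<and> x - y \<in> I"

lemma I_uminus: "x \<in> I \<Longrightarrow> - x \<in> I"
  using I_left[of "- 1" x] by simp

lemma cg_refl: "x \<in> C \<Longrightarrow> x \<approx> x"
  by (simp add: cg_def I_zero)

lemma cg_sym: "x \<approx> y \<Longrightarrow> y \<approx> x"
  using I_uminus[of "x - y"] by (simp add: cg_def)

lemma cg_trans [trans]: "x \<approx> y \<Longrightarrow> y \<approx> w \<Longrightarrow> x \<approx> w"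
  using I_add[of "x - y" "y - w"] by (simp add: cg_def)

lemma cg_add: "x \<approx> x' \<Longrightarrow> y \<approx> y' \<Longrightarrow> x + y \<approx> x' + y'"
  using I_add[of "x - x'" "y - y'"] by (simp add: cg_def algebra_simps)

lemma cg_ctx: "x \<approx> y \<Longrightarrow> u \<in> C \<Longrightarrow> v \<in> C \<Longrightarrow> u * x * v \<approx> u * y * v"
  using I_right[OF I_left[of u "x - y"], of v] by (simp add: cg_def algebra_simps)

lemma cg_left: "x \<approx> y \<Longrightarrow> u \<in> C \<Longrightarrow> u * x \<approx> u * y"
  using cg_ctx[of x y u 1] by simp

lemma cg_right: "x \<approx> y \<Longrightarrow> u \<in> C \<Longrightarrow> x * u \<approx> y * u"
  using cg_ctx[of x y 1 u] by simp

lemma cg_uminus: "x \<approx> y \<Longrightarrow> - x \<approx> - y"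
  using cg_left[of x y "- 1"] by simp

lemma cg_diff: "x \<approx> x' \<Longrightarrow> y \<approx> y' \<Longrightarrow> x - y \<approx> x' - y'"
  using cg_add[of x x' "- y" "- y'"] cg_uminus by simp

lemma inv_left:
  assumes "x * y \<approx> w" "x' * x \<approx> 1" "x' \<in> C" "y \<in> C"
  shows "y \<approx> x' * w"
proof -
  have "1 * y \<approx> x' * x * y" by (rule cg_right[OF cg_sym[OF assms(2)] assms(4)])
  also have "\<dots> \<approx> x' * w" using cg_left[OF assms(1,3)] by (simp add: mult.assoc)
  finally show ?thesis by simp
qed

lemma inv_right:
  assumes "y * x \<approx> w" "x * x' \<approx> 1" "x' \<in> C" "y \<in> C"
  shows "y \<approx> w * x'"
proof -
  have "y * 1 \<approx> y * (x * x')" by (rule cg_left[OF cg_sym[OF assms(2)] assms(4)])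
  also have "\<dots> \<approx> w * x'" using cg_right[OF assms(1,3)] by (simp add: mult.assoc)
  finally show ?thesis by simp
qed

end

locale bmw_scalars = cong_ring +
  fixes A Ai z zi :: "'a"
  assumes scal_C [simp]: "A \<in> C" "Ai \<in> C" "z \<in> C" "zi \<in> C"
    and central: "A * x = x * A" "Ai * x = x * Ai" "z * x = x * z" "zi * x = x * zi"
    and A_Ai: "A * Ai = 1" and z_zi: "z * zi = 1"
begin

lemma Ai_A: "Ai * A = 1" using A_Ai central(1)[of Ai] by simp

lemma Ai_out: "x * (Ai * y) = Ai * (x * y)" and A_out: "x * (A * y) = A * (x * y)"
  and zi_out: "x * (zi * y) = zi * (x * y)" and z_out: "x * (z * y) = z * (x * y)"
  by (metis central mult.assoc)+

end

locale bmw_gen = bmw_scalars +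
  fixes s si e :: "'a"
  assumes gen_C [simp]: "s \<in> C" "si \<in> C"
    and e_eq: "e = zi * (si - s) + 1"
    and s_si: "s * si \<approx> 1" and si_s: "si * s \<approx> 1" and e_s: "e * s \<approx> Ai * e"
begin

lemma e_C [simp]: "e \<in> C"
  by (simp add: e_eq)

lemma si_eq: "si = s + z * (e - 1)"
  using z_zi by (simp add: e_eq mult.assoc[symmetric])

text \<open>\<open>e\<close> is a combination of \<open>1\<close>, \<open>s\<close> and its inverse,
  hence commutes with \<open>s\<close> modulo \<open>I\<close>.\<close>

lemma s_e: "s * e \<approx> Ai * e"
proof -
  have "s * e = zi * (s * si) - zi * (s * s) + s"
    by (simp add: e_eq algebra_simps zi_out)
  also have "\<dots> \<approx> zi * (si * s) - zi * (s * s) + s"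
    by (intro cg_add cg_diff cg_refl cg_left cg_trans[OF s_si cg_sym[OF si_s]]) simp_all
  also have "\<dots> = e * s" by (simp add: e_eq algebra_simps)
  also note e_s
  finally show ?thesis .
qed

lemma si_e: "si * e \<approx> A * e"
proof -
  have "e \<approx> si * (Ai * e)" by (rule inv_left[OF s_e si_s]) simp_all
  then have "A * (si * (Ai * e)) \<approx> A * e" by (intro cg_sym[OF cg_left]) simp_all
  moreover have "A * (si * (Ai * e)) = si * e"
    unfolding Ai_out by (simp add: Ai_A A_Ai mult.assoc[symmetric])
  ultimately show ?thesis by simp
qed

lemma e_si: "e * si \<approx> A * e"
proof -
  have "e \<approx> Ai * e * si" by (rule inv_right[OF e_s s_si]) simp_all
  from cg_sym[OF cg_left[OF this, of A]] show ?thesis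
    using A_Ai by (simp add: mult.assoc[symmetric])
qed

text \<open>The value of a closed loop.\<close>

definition "\<Delta> = zi * (A - Ai) + 1"

lemma e_e: "e * e \<approx> \<Delta> * e"
proof -
  have "e * e = zi * (e * si - e * s) + e"
    by (subst (2) e_eq) (simp add: algebra_simps zi_out)
  also have "\<dots> \<approx> zi * (A * e - Ai * e) + e"
    by (intro cg_add cg_left cg_diff e_si e_s cg_refl) simp_all
  also have "\<dots> = \<Delta> * e" by (simp add: \<Delta>_def algebra_simps)
  finally show ?thesis .
qed

lemma s_s: "s * s \<approx> 1 + z * s - z * Ai * e"
proof -
  have "s * s = s * si - z * (s * e) + z * s"
    by (subst si_eq) (simp add: algebra_simps z_out central(3)[of s, symmetric])
  also have "\<dots> \<approx> 1 - z * (Ai * e) + z * s"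
    by (intro cg_add cg_diff cg_left s_si s_e cg_refl) simp_all
  finally show ?thesis by (simp add: algebra_simps)
qed

lemma conj_si:
  assumes g: "g \<in> C" "t \<in> C" "ti \<in> C" and "ti * t \<approx> 1" and gs: "g * s \<approx> t * g"
  shows "g * si \<approx> ti * g"
proof -
  have "t * (g * si) \<approx> g * s * si" using cg_sym[OF cg_right[OF gs, of si]] by (simp add: mult.assoc)
  also have "\<dots> \<approx> g" using cg_left[OF s_si g(1)] by (simp add: mult.assoc)
  finally have "g * si \<approx> ti * g" using assms by (intro inv_left[of t]) simp_all
  then show ?thesis .
qed

text \<open>Whatever carries \<open>s\<close> to \<open>t\<close> carries the inverse of
  \<open>s\<close> to that of \<open>t\<close>, and hence also \<open>e\<close>, a combination of
  these and \<open>1\<close>, to its counterpart.\<close>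

lemma conj_e:
  assumes g: "g \<in> C" "t \<in> C" "ti \<in> C" and "ti * t \<approx> 1" and gs: "g * s \<approx> t * g"
  shows "g * e \<approx> (zi * (ti - t) + 1) * g"
proof -
  have "g * e = zi * (g * si - g * s) + g"
    by (simp add: e_eq algebra_simps zi_out)
  also have "\<dots> \<approx> zi * (ti * g - t * g) + g"
    using assms by (intro cg_add cg_left cg_diff conj_si cg_refl) simp_all
  finally show ?thesis by (simp add: algebra_simps)
qed

end

text \<open>The given sandwich relations have the lower \<open>e\<close> outside. Those with the
  indices exchanged, and the values of all mixed products, have to be derived.\<close>

locale bmw_pair = g1: bmw_gen C I A Ai z zi s si e + g2: bmw_gen C I A Ai z zi t ti f
  for C I :: "'r::ring_1 set" and A Ai z zi s si e t ti f +
  assumes braid: "s * t * s \<approx> t * s * t"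
    and ete: "e * t * e \<approx> A * e" and etie: "e * ti * e \<approx> Ai * e"
begin

section \<open>Products of adjacent generators\<close>

lemma ste: "s * t * e \<approx> f * (s * t)"
  using g1.conj_e[of "s * t" t ti] braid by (simp add: g2.e_eq g2.si_s mult.assoc)

lemma tsf: "t * s * f \<approx> e * (t * s)"
  using g2.conj_e[of "t * s" s si] g1.cg_sym[OF braid] by (simp add: g1.e_eq g1.si_s mult.assoc)

lemma inverses:
  "(ti * si) * (s * t) \<approx> 1" "(s * t) * (ti * si) \<approx> 1" "(si * ti) * (t * s) \<approx> 1" "(t * s) * (si * ti) \<approx> 1"
proof -
  have "(ti * si) * (s * t) \<approx> ti * t"
    using g1.cg_ctx[OF g1.si_s, of ti t] by (simp add: mult.assoc)
  also note g2.si_s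
  finally show "(ti * si) * (s * t) \<approx> 1" .
  have "(s * t) * (ti * si) \<approx> s * si"
    using g1.cg_ctx[OF g2.s_si, of s si] by (simp add: mult.assoc)
  also note g1.s_si
  finally show "(s * t) * (ti * si) \<approx> 1" .
  have "(si * ti) * (t * s) \<approx> si * s"
    using g1.cg_ctx[OF g2.si_s, of si s] by (simp add: mult.assoc)
  also note g1.si_s
  finally show "(si * ti) * (t * s) \<approx> 1" .
  have "(t * s) * (si * ti) \<approx> t * ti"
    using g1.cg_ctx[OF g1.s_si, of t ti] by (simp add: mult.assoc)
  also note g2.s_si
  finally show "(t * s) * (si * ti) \<approx> 1" .
qed

lemma etisi: "ti * si * f \<approx> e * (ti * si)"
proof -
  have "s * t * (e * (ti * si)) \<approx> f * (s * t) * (ti * si)"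
    using g1.cg_right[OF ste, of "ti * si"] by (simp add: mult.assoc)
  also have "\<dots> \<approx> f"
    using g1.cg_left[OF inverses(2), of f] by (simp add: mult.assoc)
  finally have "e * (ti * si) \<approx> ti * si * f"
    by (intro g1.inv_left[OF _ inverses(1)]) simp_all
  then show ?thesis by (rule g1.cg_sym)
qed

lemma fsiti: "si * ti * e \<approx> f * (si * ti)"
proof -
  have "t * s * (f * (si * ti)) \<approx> e * (t * s) * (si * ti)"
    using g1.cg_right[OF tsf, of "si * ti"] by (simp add: mult.assoc)
  also have "\<dots> \<approx> e"
    using g1.cg_left[OF inverses(4), of e] by (simp add: mult.assoc)
  finally have "f * (si * ti) \<approx> si * ti * e"
    by (intro g1.inv_left[OF _ inverses(3)]) simp_all
  then show ?thesis by (rule g1.cg_sym)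
qed

text \<open>Multiplication by the inverse of \<open>s t\<close> turns \<open>f\<close> into
  \<open>e\<close> across \<open>ti si\<close>; then \<open>e * ti * si * e\<close> collapses to
  \<open>e\<close> by the kink law and \<open>etie\<close>.\<close>

lemma fe1: "f * e \<approx> s * t * e"
proof -
  have "ti * si * (f * e) \<approx> e * (ti * si) * e"
    using g1.cg_right[OF etisi, of e] by (simp add: mult.assoc)
  also have "\<dots> \<approx> A * (e * ti * e)"
    using g1.cg_left[OF g1.si_e, of "e * ti"] by (simp add: mult.assoc g1.A_out)
  also have "\<dots> \<approx> A * (Ai * e)" by (intro g1.cg_left etie) simp
  also have "\<dots> = e" by (simp add: g1.A_Ai mult.assoc[symmetric])
  finally show ?thesis by (intro g1.inv_left[OF _ inverses(2)]) simp_all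
qed

lemma fe2: "f * e \<approx> f * (s * t)"
  by (rule g1.cg_trans[OF fe1 ste])

lemma fe3: "f * e \<approx> f * (si * ti)"
proof -
  have "t * s * (f * e) \<approx> e * (t * s) * e"
    using g1.cg_right[OF tsf, of e] by (simp add: mult.assoc)
  also have "\<dots> \<approx> Ai * (e * t * e)"
    using g1.cg_left[OF g1.s_e, of "e * t"] by (simp add: mult.assoc g1.Ai_out)
  also have "\<dots> \<approx> Ai * (A * e)" by (intro g1.cg_left ete) simp
  also have "\<dots> = e" by (simp add: g1.Ai_A mult.assoc[symmetric])
  finally have "f * e \<approx> si * ti * e" by (intro g1.inv_left[OF _ inverses(3)]) simp_all
  also note fsiti
  finally show ?thesis .
qed

lemma ef1: "e * f \<approx> e * (ti * si)"
proof -
  have "e * f * (s * t) \<approx> e * (s * t * e)"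
    using g1.cg_left[OF g1.cg_sym[OF ste], of e] by (simp add: mult.assoc)
  also have "\<dots> \<approx> Ai * (e * t * e)"
    using g1.cg_right[OF g1.e_s, of "t * e"] by (simp add: mult.assoc)
  also have "\<dots> \<approx> Ai * (A * e)" by (intro g1.cg_left ete) simp
  also have "\<dots> = e" by (simp add: g1.Ai_A mult.assoc[symmetric])
  finally show ?thesis by (intro g1.inv_right[OF _ inverses(2)]) simp_all
qed

lemma ef2: "e * f \<approx> e * (t * s)"
proof -
  have "e * f * (si * ti) \<approx> e * (si * ti * e)"
    using g1.cg_left[OF g1.cg_sym[OF fsiti], of e] by (simp add: mult.assoc)
  also have "\<dots> \<approx> A * (e * ti * e)"
    using g1.cg_right[OF g1.e_si, of "ti * e"] by (simp add: mult.assoc)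
  also have "\<dots> \<approx> A * (Ai * e)" by (intro g1.cg_left etie) simp
  also have "\<dots> = e" by (simp add: g1.A_Ai mult.assoc[symmetric])
  finally show ?thesis by (intro g1.inv_right[OF _ inverses(3)]) simp_all
qed

lemma ef3: "e * f \<approx> t * s * f"
  by (rule g1.cg_trans[OF ef2 g1.cg_sym[OF tsf]])

lemma ef4: "e * f \<approx> ti * si * f"
  by (rule g1.cg_trans[OF ef1 g1.cg_sym[OF etisi]])

text \<open>\<open>f e\<close> is expressed by positive crossings and \<open>e f\<close> by negative
  ones, so that the crossings cancel.\<close>

lemma fef: "f * e * f \<approx> f"
proof -
  have "f * e * f \<approx> s * t * (e * f)"
    using g1.cg_right[OF fe1, of f] by (simp add: mult.assoc)
  also have "\<dots> \<approx> s * t * (ti * si * f)" by (intro g1.cg_left ef4) simp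
  also have "\<dots> \<approx> f" using g1.cg_right[OF inverses(2), of f] by (simp add: mult.assoc)
  finally show ?thesis .
qed

text \<open>Up to the scalar a kink \<open>t\<close> may be inserted after the first
  \<open>f\<close>; then \<open>t s f\<close> becomes \<open>e f\<close>, and \<open>fef\<close>
  applies.\<close>

lemma fsf: "f * s * f \<approx> A * f"
proof -
  have "Ai * (f * s * f) \<approx> f * t * (s * f)"
    using g1.cg_right[OF g1.cg_sym[OF g2.e_s], of "s * f"] by (simp add: mult.assoc)
  also have "\<dots> \<approx> f * e * f"
    using g1.cg_left[OF g1.cg_sym[OF ef3], of f] by (simp add: mult.assoc)
  also note fef
  finally have "A * (Ai * (f * s * f)) \<approx> A * f" by (intro g1.cg_left) simp_all
  then show ?thesis by (simp add: g1.A_Ai mult.assoc[symmetric])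
qed

lemma te: "t * e \<approx> si * f * e"
proof -
  have "s * (t * e) \<approx> f * e" using g1.cg_sym[OF fe1] by (simp add: mult.assoc)
  then have "t * e \<approx> si * (f * e)" by (intro g1.inv_left[OF _ g1.si_s]) simp_all
  then show ?thesis by (simp add: mult.assoc)
qed

lemma fet: "f * e * t \<approx> f * si"
proof -
  have "f * e * t \<approx> f * si * (ti * t)"
    using g1.cg_right[OF fe3, of t] by (simp add: mult.assoc)
  also have "\<dots> \<approx> f * si" using g1.cg_left[OF g2.si_s, of "f * si"] by simp
  finally show ?thesis .
qed

text \<open>Like \<open>fet\<close>, \<open>tet\<close> and \<open>fef\<close>, a rule that trades
  two factors of the upper index around \<open>e\<close> for a single \<open>f\<close>.\<close>

lemma tef: "t * e * f \<approx> si * f"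
proof -
  have "t * e * f \<approx> si * (f * e * f)"
    using g1.cg_right[OF te, of f] by (simp add: mult.assoc)
  also have "\<dots> \<approx> si * f" by (intro g1.cg_left fef) simp
  finally show ?thesis .
qed

lemma tet: "t * e * t \<approx> si * f * si"
proof -
  have "t * e * t \<approx> si * (f * e * t)"
    using g1.cg_right[OF te, of t] by (simp add: mult.assoc)
  also have "\<dots> \<approx> si * (f * si)" by (intro g1.cg_left fet) simp
  finally show ?thesis by (simp add: mult.assoc)
qed

lemma fs: "f * s \<approx> f * e * ti"
  using g1.inv_right[of "f * s" t "f * e" ti] g1.cg_sym[OF fe2] g2.s_si by (simp add: mult.assoc)

end

section \<open>Spanning sets\<close>

lemma bmw_cong_ring: "cong_ring (carrier (free_alg n)) (bmw_ideal n)"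
proof -
  interpret I: ideal "bmw_ideal n" "free_alg n" by (rule bmw_ideal_ideal)
  show ?thesis
  proof
    fix x assume "x \<in> bmw_ideal n"
    then show "x \<in> carrier (free_alg n)" by (rule I.Icarr)
  next
    show "0 \<in> bmw_ideal n"
      using additive_subgroup.zero_closed[OF I.is_additive_subgroup] unfolding free_alg_simps .
  next
    fix x y assume "x \<in> bmw_ideal n" "y \<in> bmw_ideal n"
    then show "x + y \<in> bmw_ideal n"
      using additive_subgroup.a_closed[OF I.is_additive_subgroup, of x y] unfolding free_alg_simps by blast
  next
    fix x y assume "x \<in> carrier (free_alg n)" "y \<in> bmw_ideal n"
    then show "x * y \<in> bmw_ideal n" "y * x \<in> bmw_ideal n"
      using I.I_l_closed[of y x] I.I_r_closed[of y x] unfolding free_alg_simps(2-) by blast+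
  qed (auto intro: one_closed free_alg_add_closed free_alg_mult_closed free_alg_uminus_closed)
qed

interpretation N: cong_ring "carrier (free_alg n)" "bmw_ideal n" for n
  by (rule bmw_cong_ring)

abbreviation bmw_cong :: "free \<Rightarrow> nat \<Rightarrow> free \<Rightarrow> bool" ("_ \<approx>\<^bsub>_\<^esub> _" [51, 0, 51] 50) where
  "x \<approx>\<^bsub>n\<^esub> y \<equiv> N.cg n x y"

lemma bmw_rel_cong:
  assumes "x - y \<in> bmw_rel n" "x \<in> carrier (free_alg n)" "y \<in> carrier (free_alg n)"
  shows "x \<approx>\<^bsub>n\<^esub> y"
  unfolding N.cg_def
  using assms ring.genideal_self[OF free_alg_ring bmw_rel_subset, of n]
  by (auto simp: bmw_ideal_def)

lemma cong_mono: "x \<approx>\<^bsub>m\<^esub> y \<Longrightarrow> m \<le> n \<Longrightarrow> x \<approx>\<^bsub>n\<^esub> y"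
  using bmw_ideal_mono[of m n] free_alg_mono[of m n] by (auto simp: N.cg_def)

lemma scalar_mult: "scalar c * scalar d = scalar (c * d)"
  by (simp add: scalar_def mult_single)

lemma scalar_1: "scalar 1 = 1"
  by (simp add: scalar_def)

lemma scalar_diff: "scalar (c - d) = scalar c - scalar d"
  by (simp add: scalar_def single_diff)

lemma bmw_scalars: "bmw_scalars (carrier (free_alg n)) (bmw_ideal n)
  (scalar a_par) (scalar a_par_inv) (scalar (q_par - q_par_inv)) (scalar z_par_inv)"
  by unfold_locales
    (rule scalar_closed scalar_commute | simp add: scalar_mult a_par_inverse z_par_inverse scalar_1)+

locale bmw_gen_at =
  bmw_gen "carrier (free_alg N)" "bmw_ideal N" "scalar a_par" "scalar a_par_inv"
    "scalar (q_par - q_par_inv)" "scalar z_par_inv" "s_gen i" "s_inv i" "e_gen i" for N i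

locale bmw_pair_at =
  bmw_pair "carrier (free_alg N)" "bmw_ideal N" "scalar a_par" "scalar a_par_inv"
    "scalar (q_par - q_par_inv)" "scalar z_par_inv" "s_gen i" "s_inv i" "e_gen i"
    "s_gen j" "s_inv j" "e_gen j" for N i j

lemma bmw_gen_at:
  assumes "1 \<le> i" "i < n"
  shows "bmw_gen_at n i"
proof -
  interpret bmw_scalars "carrier (free_alg n)" "bmw_ideal n" "scalar a_par" "scalar a_par_inv"
    "scalar (q_par - q_par_inv)" "scalar z_par_inv" by (rule bmw_scalars)
  note [simp] = s_gen_closed s_inv_closed e_gen_closed
  show ?thesis
    unfolding bmw_gen_at_def
  proof
    show "s_gen i * s_inv i \<approx>\<^bsub>n\<^esub> 1"
      using assms by (intro bmw_rel_cong) (auto simp: bmw_rel_def)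
    show "s_inv i * s_gen i \<approx>\<^bsub>n\<^esub> 1"
      using assms by (intro bmw_rel_cong) (auto simp: bmw_rel_def)
    show "e_gen i * s_gen i \<approx>\<^bsub>n\<^esub> scalar a_par_inv * e_gen i"
      using assms by (intro bmw_rel_cong) (auto simp: bmw_rel_def)
  qed (use assms in \<open>simp_all add: e_gen_def\<close>)
qed

lemma bmw_pair_at:
  assumes "1 \<le> i" "j = Suc i" "j < n"
  shows "bmw_pair_at n i j"
proof -
  note [simp] = s_gen_closed s_inv_closed e_gen_closed scalar_closed
  show ?thesis
    unfolding bmw_pair_at_def
  proof (intro bmw_pair.intro bmw_gen_at[unfolded bmw_gen_at_def] bmw_pair_axioms.intro)
    show "s_gen i * s_gen j * s_gen i \<approx>\<^bsub>n\<^esub> s_gen j * s_gen i * s_gen j"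
      using assms by (intro bmw_rel_cong) (auto simp: bmw_rel_def)
    show "e_gen i * s_gen j * e_gen i \<approx>\<^bsub>n\<^esub> scalar a_par * e_gen i"
      using assms by (intro bmw_rel_cong) (auto simp: bmw_rel_def)
    show "e_gen i * s_inv j * e_gen i \<approx>\<^bsub>n\<^esub> scalar a_par_inv * e_gen i"
      using assms by (intro bmw_rel_cong) (auto simp: bmw_rel_def)
  qed (use assms in simp_all)
qed

text \<open>The subalgebra on the strands \<open>l, \<dots>, m\<close>.\<close>

definition cl :: "nat \<Rightarrow> nat \<Rightarrow> free set" where
  "cl l m = {f. Poly_Mapping.keys f \<subseteq> {w. \<forall>x\<in>set (letters w). l \<le> letter_index x \<and> letter_index x < m}}"

lemma cl_1: "cl 1 n = carrier (free_alg n)"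
  by (auto simp: cl_def free_alg_def words_def)

lemma cl_add: "x \<in> cl l m \<Longrightarrow> y \<in> cl l m \<Longrightarrow> x + y \<in> cl l m"
  using keys_add[of x y] by (auto simp: cl_def)

lemma cl_mult: "x \<in> cl l m \<Longrightarrow> y \<in> cl l m \<Longrightarrow> x * y \<in> cl l m"
  using keys_mult[of x y] unfolding cl_def by (fastforce simp: plus_word_def)

lemma cl_scalar: "scalar c \<in> cl l m"
  by (simp add: cl_def scalar_def zero_word_def)

lemma cl_one: "1 \<in> cl l m"
  using cl_scalar[of 1] by (simp add: scalar_1)

lemma cl_uminus: "x \<in> cl l m \<Longrightarrow> - x \<in> cl l m"
  by (simp add: cl_def)

lemma cl_mono: "l \<le> l' \<Longrightarrow> m' \<le> m \<Longrightarrow> cl l' m' \<subseteq> cl l m"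
  by (fastforce simp: cl_def)

lemma cl_carrier: "x \<in> cl l m \<Longrightarrow> 1 \<le> l \<Longrightarrow> m \<le> n \<Longrightarrow> x \<in> carrier (free_alg n)"
  using cl_mono[of 1 l m n] cl_1[of n] by blast

lemma cl_s_gen: "l \<le> i \<Longrightarrow> i < m \<Longrightarrow> s_gen i \<in> cl l m"
  and cl_s_inv: "l \<le> i \<Longrightarrow> i < m \<Longrightarrow> s_inv i \<in> cl l m"
  by (simp_all add: cl_def s_gen_def s_inv_def)

lemma cl_e_gen: "l \<le> i \<Longrightarrow> i < m \<Longrightarrow> e_gen i \<in> cl l m"
  unfolding e_gen_def diff_conv_add_uminus
  by (intro cl_add cl_mult cl_scalar cl_one cl_s_gen cl_s_inv cl_uminus)

definition letter_el :: "letter \<Rightarrow> free" where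
  "letter_el x = Poly_Mapping.single (Word [x]) 1"

lemma letter_el: "letter_el (Gen i) = s_gen i" "letter_el (Inv i) = s_inv i"
  by (simp_all add: letter_el_def s_gen_def s_inv_def)

lemma letter_el_cl: "l \<le> letter_index x \<Longrightarrow> letter_index x < m \<Longrightarrow> letter_el x \<in> cl l m"
  by (simp add: cl_def letter_el_def)

lemma cl_induct [consumes 1, case_names scalar letter add]:
  assumes "x \<in> cl l m" and "\<And>c. P (scalar c)"
    and "\<And>x u. x \<in> cl l m \<Longrightarrow> P x \<Longrightarrow> l \<le> letter_index u \<Longrightarrow> letter_index u < m \<Longrightarrow> P (x * letter_el u)"
    and "\<And>x y. x \<in> cl l m \<Longrightarrow> y \<in> cl l m \<Longrightarrow> P x \<Longrightarrow> P y \<Longrightarrow> P (x + y)"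
  shows "P x"
proof -
  have word: "P (Poly_Mapping.single (Word ls) c) \<and> Poly_Mapping.single (Word ls) c \<in> cl l m"
    if "\<forall>x\<in>set ls. l \<le> letter_index x \<and> letter_index x < m" for ls c
    using that
  proof (induction ls rule: rev_induct)
    case Nil
    show ?case using assms(2)[of c] cl_scalar[of c] by (simp add: scalar_def zero_word_def)
  next
    case (snoc x xs)
    have eq: "Poly_Mapping.single (Word (xs @ [x])) c = Poly_Mapping.single (Word xs) c * letter_el x"
      by (simp add: letter_el_def mult_single plus_word_def)
    show ?case
      unfolding eq using snoc by (auto intro!: assms(3) cl_mult letter_el_cl)
  qed
  have "Poly_Mapping.keys x \<subseteq> {w. \<forall>x\<in>set (letters w). l \<le> letter_index x \<and> letter_index x < m}"
    using assms(1) by (simp add: cl_def)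
  then show ?thesis
  proof (induction x rule: poly_mapping_additive_induct)
    case zero
    then show ?case using assms(2)[of 0] by (simp add: scalar_def)
  next
    case (single w c)
    then show ?case using word[of "letters w" c] by simp
  next
    case (add x y)
    then show ?case by (intro assms(4)) (simp_all add: cl_def)
  qed
qed

lemma cl_empty: "m \<le> l \<Longrightarrow> x \<in> cl l m \<Longrightarrow> \<exists>c. x = scalar c"
proof -
  assume "m \<le> l" "x \<in> cl l m"
  from this(2) show "\<exists>c. x = scalar c"
  proof (induction x rule: cl_induct)
    case (add x y)
    then show ?case by (metis scalar_def single_add)
  qed (use \<open>m \<le> l\<close> in auto)
qed

lemma far_commute:
  assumes x: "x \<in> cl 1 (n - 1)" and n: "1 \<le> n" "n < m"
  shows "x * s_gen n \<approx>\<^bsub>m\<^esub> s_gen n * x"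
  using x
proof (induction x rule: cl_induct)
  case (scalar c)
  show ?case unfolding scalar_commute[of c] using n by (intro N.cg_refl free_alg_mult_closed scalar_closed s_gen_closed)
next
  case (add x y)
  then show ?case by (simp add: distrib_left distrib_right N.cg_add)
next
  case (letter x u)
  note C = s_gen_closed[of n m, OF n]
  have u: "letter_el u \<in> carrier (free_alg m)" using letter n by (intro cl_carrier[OF letter_el_cl[of 1 u "n - 1"]]) auto
  have x: "x \<in> carrier (free_alg m)" using letter n by (intro cl_carrier[of x 1 "n - 1"]) auto
  have i: "1 \<le> letter_index u" "letter_index u < m" using letter n by auto
  interpret g: bmw_gen_at "m" "letter_index u"
    by (rule bmw_gen_at[OF i])
  have "s_gen n * s_gen (letter_index u) \<approx>\<^bsub>m\<^esub> s_gen (letter_index u) * s_gen n"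
  proof (rule bmw_rel_cong)
    show "s_gen n * s_gen (letter_index u) - s_gen (letter_index u) * s_gen n \<in> bmw_rel m"
    proof -
      have "2 \<le> \<bar>int n - int (letter_index u)\<bar>" using letter.hyps by auto
      then have "\<exists>i j. s_gen n * s_gen (letter_index u) - s_gen (letter_index u) * s_gen n =
          s_gen i * s_gen j - s_gen j * s_gen i \<and>
          1 \<le> i \<and> i < m \<and> 1 \<le> j \<and> j < m \<and> 2 \<le> \<bar>int i - int j\<bar>"
        using i n by blast
      then show ?thesis unfolding bmw_rel_def by blast
    qed
  qed (use C in simp_all)
  note comm = this
  consider "letter_el u = s_gen (letter_index u)" | "letter_el u = s_inv (letter_index u)"
    by (cases u) (simp_all add: letter_el)
  then have "s_gen n * letter_el u \<approx>\<^bsub>m\<^esub> letter_el u * s_gen n"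
  proof cases
    case 1
    show ?thesis unfolding 1 by (rule comm)
  next
    case 2
    show ?thesis unfolding 2 by (rule g.conj_si[OF C g.gen_C g.si_s comm])
  qed
  then have "x * (letter_el u * s_gen n) \<approx>\<^bsub>m\<^esub> x * (s_gen n * letter_el u)"
    by (rule N.cg_left[OF N.cg_sym x])
  also have "\<dots> \<approx>\<^bsub>m\<^esub> s_gen n * x * letter_el u"
    using N.cg_right[OF letter.IH u] by (simp add: mult.assoc)
  finally show ?case by (simp add: mult.assoc)
qed

lemma far_commute_e:
  assumes x: "x \<in> cl 1 (n - 1)" and n: "1 \<le> n" "n < m"
  shows "x * e_gen n \<approx>\<^bsub>m\<^esub> e_gen n * x" "x * s_inv n \<approx>\<^bsub>m\<^esub> s_inv n * x"
proof -
  interpret g: bmw_gen_at "m" "n"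
    by (rule bmw_gen_at[OF n])
  have C: "x \<in> carrier (free_alg m)" using x n by (intro cl_carrier[of x 1 "n - 1"]) auto
  show "x * e_gen n \<approx>\<^bsub>m\<^esub> e_gen n * x"
    using g.conj_e[OF C g.gen_C g.si_s far_commute[OF assms]] by (simp add: g.e_eq)
  show "x * s_inv n \<approx>\<^bsub>m\<^esub> s_inv n * x"
    using g.conj_si[OF C g.gen_C g.si_s far_commute[OF assms]] .
qed

text \<open>The lower end \<open>l\<close> is a parameter because the reduction later applies the
  decomposition to blocks that do not start at the first strand.\<close>

inductive_set spanned :: "nat \<Rightarrow> nat \<Rightarrow> free set" for l n where
  base: "x \<in> cl l n \<Longrightarrow> x \<in> spanned l n"
| s: "x \<in> cl l n \<Longrightarrow> y \<in> cl l n \<Longrightarrow> x * s_gen n * y \<in> spanned l n"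
| e: "x \<in> cl l n \<Longrightarrow> y \<in> cl l n \<Longrightarrow> x * e_gen n * y \<in> spanned l n"
| add: "x \<in> spanned l n \<Longrightarrow> y \<in> spanned l n \<Longrightarrow> x + y \<in> spanned l n"
| cong: "x \<in> spanned l n \<Longrightarrow> x \<approx>\<^bsub>Suc n\<^esub> y \<Longrightarrow> y \<in> spanned l n"

section \<open>Closure of the decomposition under multiplication\<close>

lemma spanned_right:
  assumes "x \<in> spanned l n" "y \<in> cl l n" "1 \<le> l"
  shows "x * y \<in> spanned l n"
  using assms(1)
proof induction
  case (cong x x')
  then have "x * y \<approx>\<^bsub>Suc n\<^esub> x' * y" using assms by (intro N.cg_right cl_carrier[of y]) auto
  then show ?case using cong by (metis spanned.cong)
qed (use assms(2) in \<open>auto simp: distrib_right mult.assoc intro: spanned.intros cl_mult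
    spanned.s[of _ l n, unfolded mult.assoc] spanned.e[of _ l n, unfolded mult.assoc]\<close>)

lemma spanned_left:
  assumes "x \<in> spanned l n" "y \<in> cl l n" "1 \<le> l"
  shows "y * x \<in> spanned l n"
  using assms(1)
proof induction
  case (cong x x')
  then have "y * x \<approx>\<^bsub>Suc n\<^esub> y * x'" using assms by (intro N.cg_left cl_carrier[of y]) auto
  then show ?case using cong by (metis spanned.cong)
qed (use assms(2) in \<open>auto simp: distrib_left mult.assoc[symmetric] intro: spanned.intros cl_mult\<close>)

text \<open>One more layer of the decomposition: for \<open>l < n\<close> elements are assembled
  from \<open>cl l (n - 1)\<close> with at most one letter of index \<open>n - 1\<close> in each
  summand. For \<open>l = n\<close> only scalars are left, and they are covered by
  \<open>base\<close>.\<close>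

lemma cl_peel_induct:
  assumes y: "y \<in> cl l n" and l: "1 \<le> l" "l \<le> n"
    and IH: "l < n \<Longrightarrow> cl l n \<subseteq> spanned l (n - 1)"
    and base: "\<And>p. p \<in> cl l (n - 1) \<Longrightarrow> Q p"
    and s: "\<And>p r. l < n \<Longrightarrow> p \<in> cl l (n - 1) \<Longrightarrow> r \<in> cl l (n - 1) \<Longrightarrow> Q (p * s_gen (n - 1) * r)"
    and e: "\<And>p r. l < n \<Longrightarrow> p \<in> cl l (n - 1) \<Longrightarrow> r \<in> cl l (n - 1) \<Longrightarrow> Q (p * e_gen (n - 1) * r)"
    and add: "\<And>x y. Q x \<Longrightarrow> Q y \<Longrightarrow> Q (x + y)"
    and cong: "\<And>x y. Q x \<Longrightarrow> x \<approx>\<^bsub>n\<^esub> y \<Longrightarrow> Q y"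
  shows "Q y"
proof (cases "l < n")
  case True
  then have "y \<in> spanned l (n - 1)" using IH y by blast
  then show ?thesis
  proof induction
    case (cong x y)
    then show ?case using assms(9) True by auto
  qed (use base s e add True in auto)
next
  case False
  then obtain c where "y = scalar c" using cl_empty[of n l y] y l by auto
  then show ?thesis using base cl_scalar by simp
qed

lemma spanned_scalar: "x \<in> spanned l n \<Longrightarrow> 1 \<le> l \<Longrightarrow> scalar c * x \<in> spanned l n"
  by (rule spanned_left[OF _ cl_scalar])

lemma spanned_uminus: "x \<in> spanned l n \<Longrightarrow> 1 \<le> l \<Longrightarrow> - x \<in> spanned l n"
  using spanned_left[of x l n "- 1"] cl_uminus[OF cl_one] by auto

lemma spanned_gens: "s_gen n \<in> spanned l n" "e_gen n \<in> spanned l n" "1 \<in> spanned l n"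
  using spanned.s[OF cl_one cl_one, of n l] spanned.e[OF cl_one cl_one, of n l] spanned.base[OF cl_one] by simp_all

text \<open>After peeling \<open>y\<close>, the outer factors \<open>p\<close> and \<open>r\<close>
  commute with the letters of index \<open>n\<close> and can be pulled outside. What remains are the
  products \<open>g * x * h\<close> with \<open>x\<close> among \<open>1\<close>,
  \<open>s_(n-1)\<close> and \<open>e_(n-1)\<close>.\<close>

lemma spanned_sandwich:
  assumes l: "1 \<le> l" "l \<le> n" and IH: "l < n \<Longrightarrow> cl l n \<subseteq> spanned l (n - 1)"
    and y: "y \<in> cl l n" and g: "g = s_gen n \<or> g = e_gen n" and h: "h = s_gen n \<or> h = e_gen n"
  shows "g * y * h \<in> spanned l n"
proof -
  have n: "1 \<le> n" "n < Suc n" using l by auto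
  interpret g: bmw_gen_at "Suc n" "n"
    by (rule bmw_gen_at[OF n])
  have gC: "g \<in> carrier (free_alg (Suc n))" "h \<in> carrier (free_alg (Suc n))" using g h by auto
  have comm: "x * g \<approx>\<^bsub>Suc n\<^esub> g * x" "x * h \<approx>\<^bsub>Suc n\<^esub> h * x" if "x \<in> cl l (n - 1)" for x
  proof -
    have "x \<in> cl 1 (n - 1)" using that cl_mono[of 1 l "n - 1" "n - 1"] l by auto
    then show "x * g \<approx>\<^bsub>Suc n\<^esub> g * x" "x * h \<approx>\<^bsub>Suc n\<^esub> h * x"
      using far_commute[of x n "Suc n"] far_commute_e[of x n "Suc n"] n g h by auto
  qed
  have up: "x \<in> cl l n" "x \<in> carrier (free_alg (Suc n))" if "x \<in> cl l (n - 1)" for x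
    using that cl_mono[of l l "n - 1" n] cl_carrier[of x l "n - 1" "Suc n"] l by auto
  have scal: "g.\<Delta> \<in> cl l n"
    unfolding g.\<Delta>_def diff_conv_add_uminus by (intro cl_add cl_mult cl_uminus cl_scalar cl_one)
  have gh: "g * h \<in> spanned l n"
  proof -
    have "s_gen n * s_gen n \<in> spanned l n"
    proof (rule spanned.cong[OF _ N.cg_sym[OF g.s_s]])
      show "1 + scalar (q_par - q_par_inv) * s_gen n - scalar (q_par - q_par_inv) * scalar a_par_inv * e_gen n \<in> spanned l n"
        unfolding diff_conv_add_uminus scalar_mult
        by (intro spanned.add spanned_scalar spanned_uminus spanned_gens l)
    qed
    moreover have "s_gen n * e_gen n \<in> spanned l n"
      by (rule spanned.cong[OF _ N.cg_sym[OF g.s_e]]) (intro spanned_scalar spanned_gens l)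
    moreover have "e_gen n * s_gen n \<in> spanned l n"
      by (rule spanned.cong[OF _ N.cg_sym[OF g.e_s]]) (intro spanned_scalar spanned_gens l)
    moreover have "e_gen n * e_gen n \<in> spanned l n"
      by (rule spanned.cong[OF _ N.cg_sym[OF g.e_e]]) (intro spanned_left scal spanned_gens l)
    ultimately show ?thesis using g h by auto
  qed
  \<comment> \<open>Each entry is a relation of \<open>bmw_pair\<close> whose other side has a
    single letter of index \<open>n\<close>.\<close>
  have table: "g * s_gen (n - 1) * h \<in> spanned l n" "g * e_gen (n - 1) * h \<in> spanned l n" if ln: "l < n"
  proof -
    have n1: "1 \<le> n - 1" "n = Suc (n - 1)" "n < Suc n" using ln l by auto
    interpret p: bmw_pair_at "Suc n" "n - 1" "n"
      by (rule bmw_pair_at[OF n1])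
    have lo: "l \<le> n - 1" "n - 1 < n" using ln by auto
    note C = cl_s_gen[OF lo] cl_s_inv[OF lo] cl_e_gen[OF lo]
    have A: "x * s_gen n * y \<in> spanned l n" "x * e_gen n * y \<in> spanned l n" if "x \<in> cl l n" "y \<in> cl l n" for x y
      using spanned.s[OF that] spanned.e[OF that] by auto
    have B: "x * e_gen n \<in> spanned l n" "e_gen n * x \<in> spanned l n" if "x \<in> cl l n" for x
      using spanned_left[OF spanned_gens(2) that l(1)] spanned_right[OF spanned_gens(2) that l(1)] by auto
    have "s_gen n * s_gen (n - 1) * s_gen n \<in> spanned l n"
      by (rule spanned.cong[OF _ p.braid]) (intro A B C)
    moreover have "s_gen n * s_gen (n - 1) * e_gen n \<in> spanned l n"
      by (rule spanned.cong[OF _ p.ef3]) (intro A B C)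
    moreover have "e_gen n * s_gen (n - 1) * s_gen n \<in> spanned l n"
      using spanned.cong[OF _ p.fe2] B(2)[OF C(3)] by (simp add: mult.assoc)
    moreover have "e_gen n * s_gen (n - 1) * e_gen n \<in> spanned l n"
      by (rule spanned.cong[OF _ N.cg_sym[OF p.fsf]]) (intro spanned_scalar spanned_gens l)
    ultimately show "g * s_gen (n - 1) * h \<in> spanned l n" using g h by auto
    have "s_gen n * e_gen (n - 1) * s_gen n \<in> spanned l n"
      by (rule spanned.cong[OF _ N.cg_sym[OF p.tet]]) (intro A B C)
    moreover have "s_gen n * e_gen (n - 1) * e_gen n \<in> spanned l n"
      by (rule spanned.cong[OF _ N.cg_sym[OF p.tef]]) (intro A B C)
    moreover have "e_gen n * e_gen (n - 1) * s_gen n \<in> spanned l n"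
      by (rule spanned.cong[OF _ N.cg_sym[OF p.fet]]) (intro A B C)
    moreover have "e_gen n * e_gen (n - 1) * e_gen n \<in> spanned l n"
      by (rule spanned.cong[OF _ N.cg_sym[OF p.fef]]) (intro spanned_gens)
    ultimately show "g * e_gen (n - 1) * h \<in> spanned l n" using g h by auto
  qed
  have sand: "g * (p * x * r) * h \<in> spanned l n"
    if p: "p \<in> cl l (n - 1)" and r: "r \<in> cl l (n - 1)" and x: "x \<in> carrier (free_alg (Suc n))"
      and gx: "g * x * h \<in> spanned l n" for p x r
  proof -
    have "p * (g * x * h) * r \<approx>\<^bsub>Suc n\<^esub> g * p * (x * h * r)"
      using N.cg_right[OF comm(1)[OF p], of "x * h * r"] up[OF p] up[OF r] gC x by (simp add: mult.assoc)
    also have "\<dots> \<approx>\<^bsub>Suc n\<^esub> g * p * x * (r * h)"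
      using N.cg_left[OF N.cg_sym[OF comm(2)[OF r]], of "g * p * x"] up[OF p] up[OF r] gC x by (simp add: mult.assoc)
    finally have "p * (g * x * h) * r \<approx>\<^bsub>Suc n\<^esub> g * (p * x * r) * h" by (simp add: mult.assoc)
    moreover have "p * (g * x * h) * r \<in> spanned l n"
      by (intro spanned_right spanned_left gx up p r l)
    ultimately show ?thesis by (rule spanned.cong[rotated])
  qed
  show ?thesis
  proof (rule cl_peel_induct[OF y l IH])
    fix p assume "p \<in> cl l (n - 1)"
    then show "g * p * h \<in> spanned l n" using sand[of p 1 1] gh cl_one by simp
  next
    fix p r assume "l < n" "p \<in> cl l (n - 1)" "r \<in> cl l (n - 1)"
    then show "g * (p * s_gen (n - 1) * r) * h \<in> spanned l n" "g * (p * e_gen (n - 1) * r) * h \<in> spanned l n"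
      using table l by (auto intro!: sand s_gen_closed e_gen_closed)
  next
    fix x y assume "g * x * h \<in> spanned l n" "g * y * h \<in> spanned l n"
    then show "g * (x + y) * h \<in> spanned l n" by (simp add: distrib_left distrib_right spanned.add)
  next
    fix x y assume x: "g * x * h \<in> spanned l n" and "x \<approx>\<^bsub>n\<^esub> y"
    then have "x \<approx>\<^bsub>Suc n\<^esub> y" by (auto intro: cong_mono)
    then have "g * x * h \<approx>\<^bsub>Suc n\<^esub> g * y * h" using gC by (rule N.cg_ctx)
    with x show "g * y * h \<in> spanned l n" by (rule spanned.cong)
  qed
qed

text \<open>The span contains the scalars and is stable under right multiplication by all letters:
  those of lower index are absorbed, \<open>s_n\<close> and \<open>e_n\<close> are handled by
  \<open>spanned_sandwich\<close>, and the inverse of \<open>s_n\<close> by the skein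
  relation.\<close>

lemma spanned_all_step:
  assumes l: "1 \<le> l" "l \<le> n" and IH: "l < n \<Longrightarrow> cl l n \<subseteq> spanned l (n - 1)"
  shows "cl l (Suc n) \<subseteq> spanned l n"
proof
  have n: "1 \<le> n" "n < Suc n" using l by auto
  interpret g: bmw_gen_at "Suc n" "n"
    by (rule bmw_gen_at[OF n])
  have gen: "x * h \<in> spanned l n" if "x \<in> spanned l n" and h: "h = s_gen n \<or> h = e_gen n" for x h
    using that(1)
  proof induction
    case (base x)
    show ?case using spanned_left[OF spanned_gens(1) base l(1)] spanned_left[OF spanned_gens(2) base l(1)] h by auto
  next
    case (s x y)
    show ?case
      using spanned_left[OF spanned_sandwich[OF l IH s(2), of "s_gen n" h] s(1) l(1)] h by (simp add: mult.assoc)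
  next
    case (e x y)
    show ?case
      using spanned_left[OF spanned_sandwich[OF l IH e(2), of "e_gen n" h] e(1) l(1)] h by (simp add: mult.assoc)
  next
    case (add x y)
    then show ?case by (simp add: distrib_right spanned.add)
  next
    case (cong x y)
    have "x * h \<approx>\<^bsub>Suc n\<^esub> y * h" using h by (intro N.cg_right cong) auto
    then show ?case using cong by (metis spanned.cong)
  qed
  have inv: "x * s_inv n \<in> spanned l n" if x: "x \<in> spanned l n" for x
  proof -
    have "x * s_inv n = x * s_gen n + scalar (q_par - q_par_inv) * (x * e_gen n) + - (scalar (q_par - q_par_inv) * x)"
      by (subst g.si_eq) (simp add: algebra_simps g.z_out scalar_commute[of "q_par - q_par_inv" x, symmetric])
    also have "\<dots> \<in> spanned l n"
      by (intro spanned.add spanned_uminus spanned_scalar x l) (auto intro: gen x)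
    finally show ?thesis .
  qed
  fix x assume "x \<in> cl l (Suc n)"
  then show "x \<in> spanned l n"
  proof (induction x rule: cl_induct)
    case (scalar c)
    then show ?case by (intro spanned.base cl_scalar)
  next
    case (add x y)
    show ?case by (rule spanned.add[OF add.IH])
  next
    case (letter x u)
    show ?case
    proof (cases "letter_index u = n")
      case True
      then show ?thesis using gen[OF letter.IH] inv[OF letter.IH] by (cases u) (auto simp: letter_el)
    next
      case False
      then show ?thesis using letter l by (intro spanned_right letter_el_cl) auto
    qed
  qed
qed

theorem spanned_all: "1 \<le> l \<Longrightarrow> l \<le> n \<Longrightarrow> cl l (Suc n) \<subseteq> spanned l n"
proof (induction n)
  case (Suc n)
  then show ?case by (intro spanned_all_step) auto
qed simp

section \<open>Reduction of elements to the basic symbols\<close>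

text \<open>In \<open>red n x P\<close>, the coefficient of \<open>P\<close> at \<open>k \<ge> 1\<close> belongs to \<open>1 \<in> BMW\<^sub>k\<close>, the one at \<open>0\<close> to
  \<open>e\<^sub>1 \<in> BMW\<^sub>2\<close>.\<close>

inductive red :: "nat \<Rightarrow> free \<Rightarrow> coeff poly \<Rightarrow> bool" where
  e: "red 2 (e_gen 1) (monom 1 0)"
| one: "1 \<le> n \<Longrightarrow> red n 1 (monom 1 n)"
| add: "red n x P \<Longrightarrow> red n y Q \<Longrightarrow> red n (x + y) (P + Q)"
| scale: "red n x P \<Longrightarrow> red n (scalar c * x) (smult c P)"
| ideal: "1 \<le> n \<Longrightarrow> x \<in> bmw_ideal n \<Longrightarrow> red n x 0"
| commute: "1 \<le> n \<Longrightarrow> x \<in> carrier (free_alg n) \<Longrightarrow> y \<in> carrier (free_alg n) \<Longrightarrow> red n (x * y - y * x) 0"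
| stab: "1 \<le> n \<Longrightarrow> x \<in> carrier (free_alg n) \<Longrightarrow> y \<in> carrier (free_alg n) \<Longrightarrow> red n (x * y) P \<Longrightarrow>
    red (Suc n) (x * s_gen n * y) (smult a_par P)"

lemma red_n: "red n x P \<Longrightarrow> 1 \<le> n"
  by (induction rule: red.induct) auto

lemma red_carrier: "red n x P \<Longrightarrow> x \<in> carrier (free_alg n)"
proof (induction rule: red.induct)
  case (stab n x y P)
  then show ?case
    using free_alg_mono[of n "Suc n"] by (intro free_alg_mult_closed s_gen_closed) auto
qed (auto simp: e_gen_closed one_closed free_alg_add_closed free_alg_mult_closed free_alg_diff_closed scalar_closed N.I_C)

definition reducible :: "nat \<Rightarrow> free \<Rightarrow> bool" where
  "reducible n x \<longleftrightarrow> (\<exists>P. red n x P)"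

lemma reducible_add: "reducible n x \<Longrightarrow> reducible n y \<Longrightarrow> reducible n (x + y)"
  unfolding reducible_def using red.add by blast

lemma reducible_scale: "reducible n x \<Longrightarrow> reducible n (scalar c * x)"
  unfolding reducible_def using red.scale by blast

lemma reducible_cong: "reducible n x \<Longrightarrow> x \<approx>\<^bsub>n\<^esub> y \<Longrightarrow> reducible n y"
proof -
  assume x: "reducible n x" and "x \<approx>\<^bsub>n\<^esub> y"
  then have "y - x \<in> bmw_ideal n" using N.cg_sym[of n x y] by (simp add: N.cg_def)
  moreover have "1 \<le> n" using x red_n by (auto simp: reducible_def)
  ultimately have "reducible n (x + (y - x))"
    using x red.ideal by (intro reducible_add) (auto simp: reducible_def)
  then show ?thesis by simp
qed

lemma reducible_commute:
  assumes "reducible n (x * y)" "x \<in> carrier (free_alg n)" "y \<in> carrier (free_alg n)"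
  shows "reducible n (y * x)"
proof -
  have "1 \<le> n" using assms(1) red_n by (auto simp: reducible_def)
  then have "reducible n (x * y + (y * x - x * y))"
    using assms red.commute by (intro reducible_add) (auto simp: reducible_def)
  then show ?thesis by simp
qed

lemma reducible_stab:
  "1 \<le> n \<Longrightarrow> x \<in> carrier (free_alg n) \<Longrightarrow> y \<in> carrier (free_alg n) \<Longrightarrow> reducible n (x * y) \<Longrightarrow>
    reducible (Suc n) (x * s_gen n * y)"
  unfolding reducible_def using red.stab by blast

lemma reducible_one: "1 \<le> n \<Longrightarrow> reducible n 1"
  unfolding reducible_def using red.one by blast

text \<open>There is no stabilization rule for \<open>e_n\<close>, but \<open>e_(n-1) e_n\<close>
  equals \<open>e_(n-1) s_n s_(n-1)\<close>, to which the rule applies; \<open>H\<close> is the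
  element that it leaves. The other two products arise from \<open>e_n e_(n-1) y\<close> by
  splitting a factor off \<open>e_n\<close> and carrying it around by the trace property.\<close>

lemma reducible_e_step:
  assumes n: "2 \<le> n" and y: "y \<in> cl 1 (n - 1)"
    and H: "reducible n (e_gen (n - 1) * s_gen (n - 1) * y)"
  shows "reducible (Suc n) (e_gen n * e_gen (n - 1) * y)"
    and "reducible (Suc n) (e_gen n * y)"
    and "reducible (Suc n) (e_gen n * s_gen (n - 1) * y)"
proof -
  have n1: "1 \<le> n - 1" "n = Suc (n - 1)" "n < Suc n" using n by auto
  have n0: "1 \<le> n" "n < Suc n" "n - 1 < n" using n by auto
  interpret p: bmw_pair_at "Suc n" "n - 1" "n"
    by (rule bmw_pair_at[OF n1])
  define s t ti e f where "s = s_gen (n - 1)" and "t = s_gen n" and "ti = s_inv n" and "e = e_gen (n - 1)" and "f = e_gen n"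
  have yC: "y \<in> carrier (free_alg n)" "y \<in> carrier (free_alg (Suc n))"
    using cl_carrier[OF y] n by auto
  have C: "s \<in> carrier (free_alg (Suc n))" "t \<in> carrier (free_alg (Suc n))" "ti \<in> carrier (free_alg (Suc n))"
    "e \<in> carrier (free_alg (Suc n))" "f \<in> carrier (free_alg (Suc n))"
    unfolding s_def t_def ti_def e_def f_def
    by (rule p.g1.gen_C p.g2.gen_C p.g1.e_C p.g2.e_C)+
  have Cn: "s \<in> carrier (free_alg n)" "e \<in> carrier (free_alg n)"
    unfolding s_def e_def using n1 n0 by (auto intro: s_gen_closed e_gen_closed)
  note [simp] = yC C
  have yf: "y * f \<approx>\<^bsub>Suc n\<^esub> f * y" and yti: "y * ti \<approx>\<^bsub>Suc n\<^esub> ti * y"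
    unfolding f_def ti_def using far_commute_e[OF y n0(1,2)] by auto
  have "reducible (Suc n) (e * t * (s * y))"
    unfolding t_def using Cn yC n0 H
    by (intro reducible_stab free_alg_mult_closed) (simp_all add: s_def e_def mult.assoc)
  moreover have "e * t * (s * y) \<approx>\<^bsub>Suc n\<^esub> e * y * f"
  proof -
    have "e * t * (s * y) \<approx>\<^bsub>Suc n\<^esub> e * f * y"
      using N.cg_right[OF N.cg_sym[OF p.ef2], of y] unfolding s_def[symmetric] t_def[symmetric] e_def[symmetric] f_def[symmetric]
      by (simp add: mult.assoc)
    also have "\<dots> \<approx>\<^bsub>Suc n\<^esub> e * y * f"
      using N.cg_left[OF N.cg_sym[OF yf], of e] by (simp add: mult.assoc)
    finally show ?thesis .
  qed
  ultimately have "reducible (Suc n) (e * y * f)" by (rule reducible_cong)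
  then have fey: "reducible (Suc n) (f * (e * y))" by (rule reducible_commute) simp_all
  then show "reducible (Suc n) (e_gen n * e_gen (n - 1) * y)"
    by (simp add: e_def f_def mult.assoc)
  \<comment> \<open>The scalar is the loop value, so that \<open>f\<close> can be doubled and one
    copy carried around to form \<open>f * e * f\<close>.\<close>
  have "reducible (Suc n) (scalar (z_par_inv * (a_par - a_par_inv) + 1) * (f * (e * y)))"
    by (rule reducible_scale[OF fey])
  moreover have "scalar (z_par_inv * (a_par - a_par_inv) + 1) = p.g1.\<Delta>"
    unfolding p.g1.\<Delta>_def
    by (simp add: scalar_diff[symmetric] scalar_mult scalar_1[symmetric] del: scalar_1) (simp add: scalar_def single_add)
  moreover have "p.g1.\<Delta> * (f * (e * y)) \<approx>\<^bsub>Suc n\<^esub> f * (f * e * y)"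
    using N.cg_right[OF N.cg_sym[OF p.g2.e_e], of "e * y"] unfolding f_def[symmetric]
    by (simp add: mult.assoc p.g1.\<Delta>_def p.g2.\<Delta>_def)
  ultimately have "reducible (Suc n) (f * (f * e * y))" by (metis reducible_cong)
  then have "reducible (Suc n) (f * e * y * f)" by (rule reducible_commute) simp_all
  moreover have "f * e * y * f \<approx>\<^bsub>Suc n\<^esub> f * y"
  proof -
    have "f * e * y * f \<approx>\<^bsub>Suc n\<^esub> f * e * (f * y)"
      using N.cg_left[OF yf, of "f * e"] by (simp add: mult.assoc)
    also have "\<dots> \<approx>\<^bsub>Suc n\<^esub> f * y"
      using N.cg_right[OF p.fef, of y] unfolding e_def[symmetric] f_def[symmetric] by (simp add: mult.assoc)
    finally show ?thesis .
  qed
  ultimately show "reducible (Suc n) (e_gen n * y)" unfolding f_def by (rule reducible_cong)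
  \<comment> \<open>The scalar creates a kink \<open>ti\<close> in front of \<open>f\<close>;
    carried around, it turns \<open>f * e * ti\<close> into \<open>f * s\<close>.\<close>
  have "reducible (Suc n) (scalar a_par * (f * (e * y)))" by (rule reducible_scale[OF fey])
  moreover have "scalar a_par * (f * (e * y)) \<approx>\<^bsub>Suc n\<^esub> ti * (f * e * y)"
    using N.cg_right[OF N.cg_sym[OF p.g2.si_e], of "e * y"] unfolding f_def[symmetric] ti_def[symmetric]
    by (simp add: mult.assoc)
  ultimately have "reducible (Suc n) (ti * (f * e * y))" by (rule reducible_cong)
  then have "reducible (Suc n) (f * e * y * ti)" by (rule reducible_commute) simp_all
  moreover have "f * e * y * ti \<approx>\<^bsub>Suc n\<^esub> f * s * y"
  proof -
    have "f * e * y * ti \<approx>\<^bsub>Suc n\<^esub> f * e * (ti * y)"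
      using N.cg_left[OF yti, of "f * e"] by (simp add: mult.assoc)
    also have "\<dots> \<approx>\<^bsub>Suc n\<^esub> f * s * y"
      using N.cg_right[OF N.cg_sym[OF p.fs], of y] unfolding e_def[symmetric] f_def[symmetric] s_def[symmetric] ti_def[symmetric]
      by (simp add: mult.assoc)
    finally show ?thesis .
  qed
  ultimately show "reducible (Suc n) (e_gen n * s_gen (n - 1) * y)"
    unfolding f_def s_def by (rule reducible_cong)
qed

text \<open>With \<open>y = 1\<close> the hypothesis of \<open>reducible_e_step\<close> is a kink on
  the previous \<open>e_n\<close>, so all \<open>e_n\<close> go back to \<open>e_1\<close> in two
  strands.\<close>

lemma reducible_e_gen: "1 \<le> n \<Longrightarrow> reducible (Suc n) (e_gen n)"
proof (induction n rule: dec_induct)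
  case base
  show ?case using red.e by (auto simp: reducible_def numeral_2_eq_2)
next
  case (step n)
  interpret g: bmw_gen_at "Suc n" "n"
    by (rule bmw_gen_at) (use step in auto)
  have "reducible (Suc n) (e_gen n * s_gen n)"
    by (rule reducible_cong[OF reducible_scale[OF step.IH] N.cg_sym[OF g.e_s]])
  then show ?case
    using reducible_e_step(2)[of "Suc n" 1] step cl_one by simp
qed

section \<open>Shifting blocks of strands by conjugation\<close>

primrec cable :: "nat \<Rightarrow> nat \<Rightarrow> free" where
  "cable l 0 = 1"
| "cable l (Suc k) = cable l k * s_gen (l + k)"

lemma cable_cl: "cable l k \<in> cl l (l + k)"
proof (induction k)
  case (Suc k)
  then have "cable l k \<in> cl l (l + Suc k)" using cl_mono[of l l "l + k" "l + Suc k"] by auto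
  then show ?case by (auto intro!: cl_mult cl_s_gen)
qed (simp add: cl_one)

lemma cable_carrier: "1 \<le> l \<Longrightarrow> l + k \<le> N \<Longrightarrow> cable l k \<in> carrier (free_alg N)"
  by (rule cl_carrier[OF cable_cl])

lemma cable_inverse:
  assumes "1 \<le> l" "l + k \<le> N"
  shows "\<exists>g'\<in>carrier (free_alg N). g' * cable l k \<approx>\<^bsub>N\<^esub> 1 \<and> cable l k * g' \<approx>\<^bsub>N\<^esub> 1"
  using assms(2)
proof (induction k)
  case 0
  show ?case by (intro bexI[of _ 1]) (simp_all add: N.cg_refl one_closed)
next
  case (Suc k)
  then obtain g' where g': "g' \<in> carrier (free_alg N)" "g' * cable l k \<approx>\<^bsub>N\<^esub> 1" "cable l k * g' \<approx>\<^bsub>N\<^esub> 1" by auto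
  interpret g: bmw_gen_at "N" "l + k"
    by (rule bmw_gen_at) (use Suc assms in auto)
  have cC: "cable l k \<in> carrier (free_alg N)" using cable_carrier[of l k N] assms Suc by auto
  have "s_inv (l + k) * g' * (cable l k * s_gen (l + k)) \<approx>\<^bsub>N\<^esub> s_inv (l + k) * s_gen (l + k)"
    using N.cg_ctx[OF g'(2), of "s_inv (l + k)" "s_gen (l + k)"] by (simp add: mult.assoc)
  also note g.si_s
  finally have 1: "s_inv (l + k) * g' * (cable l k * s_gen (l + k)) \<approx>\<^bsub>N\<^esub> 1" .
  have "cable l k * s_gen (l + k) * (s_inv (l + k) * g') \<approx>\<^bsub>N\<^esub> cable l k * g'"
    using N.cg_ctx[OF g.s_si, of "cable l k" g'] cC g'(1) by (simp add: mult.assoc)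
  also note g'(3)
  finally have 2: "cable l k * s_gen (l + k) * (s_inv (l + k) * g') \<approx>\<^bsub>N\<^esub> 1" .
  show ?case
    using 1 2 g'(1) by (intro bexI[of _ "s_inv (l + k) * g'"]) auto
qed

text \<open>\<open>s_i\<close> passes the later factors, the braid relation turns it into
  \<open>s_(i+1)\<close> at \<open>s_i s_(i+1)\<close>, and the earlier factors commute with the
  result.\<close>

lemma cable_shift_gen:
  assumes l: "1 \<le> l"
  shows "l + k < N \<Longrightarrow> l \<le> i \<Longrightarrow> i < l + k \<Longrightarrow> cable l (Suc k) * s_gen i \<approx>\<^bsub>N\<^esub> s_gen (Suc i) * cable l (Suc k)"
proof (induction k arbitrary: i)
  case (Suc k)
  let ?t = "s_gen (l + Suc k)" and ?s = "s_gen (l + k)"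
  have tC: "?t \<in> carrier (free_alg N)" "?s \<in> carrier (free_alg N)" "s_gen i \<in> carrier (free_alg N)" "s_gen (Suc i) \<in> carrier (free_alg N)"
    using Suc.prems l by (auto intro: s_gen_closed)
  have gC: "cable l k \<in> carrier (free_alg N)" "cable l (Suc k) \<in> carrier (free_alg N)"
    using cable_carrier[of l k N] cable_carrier[of l "Suc k" N] Suc.prems l by auto
  note [simp] = tC gC(1)
  show ?case
  proof (cases "i < l + k")
    case True
    have "s_gen i \<in> cl 1 (l + Suc k - 1)" using True Suc.prems l by (intro cl_s_gen) auto
    then have far: "s_gen i * ?t \<approx>\<^bsub>N\<^esub> ?t * s_gen i"
      using Suc.prems l by (intro far_commute) auto
    have "cable l (Suc k) * (?t * s_gen i) \<approx>\<^bsub>N\<^esub> cable l (Suc k) * (s_gen i * ?t)"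
      by (rule N.cg_left[OF N.cg_sym[OF far] gC(2)])
    also have "\<dots> \<approx>\<^bsub>N\<^esub> s_gen (Suc i) * cable l (Suc k) * ?t"
      using N.cg_right[OF Suc.IH[of i] tC(1)] True Suc.prems by (simp add: mult.assoc)
    finally show ?thesis by (simp add: mult.assoc)
  next
    case False
    then have i: "i = l + k" using Suc.prems by simp
    interpret p: bmw_pair_at "N" "i" "Suc i"
      using Suc.prems l by (intro bmw_pair_at) auto
    have "cable l k \<in> cl 1 (Suc i - 1)" using cable_cl[of l k] cl_mono[of 1 l "l + k" "l + k"] l i by auto
    then have far: "cable l k * s_gen (Suc i) \<approx>\<^bsub>N\<^esub> s_gen (Suc i) * cable l k"
      using Suc.prems l i by (intro far_commute) auto
    have "cable l (Suc (Suc k)) * s_gen i = cable l k * (s_gen i * s_gen (Suc i) * s_gen i)"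
      by (simp add: i mult.assoc)
    also have "\<dots> \<approx>\<^bsub>N\<^esub> cable l k * (s_gen (Suc i) * s_gen i * s_gen (Suc i))"
      by (intro N.cg_left p.braid) simp
    also have "\<dots> \<approx>\<^bsub>N\<^esub> s_gen (Suc i) * cable l k * (s_gen i * s_gen (Suc i))"
      using N.cg_right[OF far, of "s_gen i * s_gen (Suc i)"] by (simp add: mult.assoc)
    also have "\<dots> = s_gen (Suc i) * cable l (Suc (Suc k))"
      by (simp add: i mult.assoc)
    finally show ?thesis .
  qed
qed simp

lemma cable_shift:
  assumes l: "1 \<le> l" "l \<le> n" and x: "x \<in> cl l n"
  shows "\<exists>x'\<in>cl (Suc l) (Suc n). cable l (Suc n - l) * x \<approx>\<^bsub>Suc n\<^esub> x' * cable l (Suc n - l)"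
proof -
  define g where "g = cable l (Suc n - l)"
  have gC: "g \<in> carrier (free_alg (Suc n))" unfolding g_def using l by (intro cable_carrier) auto
  show ?thesis unfolding g_def[symmetric] using x
  proof (induction x rule: cl_induct)
    case (scalar c)
    show ?case
      by (intro bexI[of _ "scalar c"] cl_scalar)
        (simp add: scalar_commute[of c g, symmetric] N.cg_refl free_alg_mult_closed scalar_closed gC)
  next
    case (add x y)
    then obtain x' y' where "x' \<in> cl (Suc l) (Suc n)" "y' \<in> cl (Suc l) (Suc n)"
      "g * x \<approx>\<^bsub>Suc n\<^esub> x' * g" "g * y \<approx>\<^bsub>Suc n\<^esub> y' * g" by blast
    then show ?case
      by (intro bexI[of _ "x' + y'"] cl_add) (simp_all add: distrib_left distrib_right N.cg_add)
  next
    case (letter x u)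
    then obtain x' where x': "x' \<in> cl (Suc l) (Suc n)" "g * x \<approx>\<^bsub>Suc n\<^esub> x' * g" by blast
    define i where "i = letter_index u"
    have i: "l \<le> i" "i < n" using letter by (auto simp: i_def)
    interpret a: bmw_gen_at "Suc n" "i"
      by (rule bmw_gen_at) (use i l in auto)
    interpret b: bmw_gen_at "Suc n" "Suc i"
      by (rule bmw_gen_at) (use i l in auto)
    have sh: "g * s_gen i \<approx>\<^bsub>Suc n\<^esub> s_gen (Suc i) * g"
      using cable_shift_gen[of l "n - l" "Suc n" i] i l by (simp add: g_def Suc_diff_le)
    obtain u' where u': "u' \<in> cl (Suc l) (Suc n)" "g * letter_el u \<approx>\<^bsub>Suc n\<^esub> u' * g"
    proof (cases u)
      case (Gen j)
      then show ?thesis using that[of "s_gen (Suc i)"] sh i by (auto simp: letter_el i_def cl_s_gen)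
    next
      case (Inv j)
      then show ?thesis using that[of "s_inv (Suc i)"] a.conj_si[OF gC b.gen_C b.si_s sh] i by (auto simp: letter_el i_def cl_s_inv)
    qed
    have C: "letter_el u \<in> carrier (free_alg (Suc n))" "x' \<in> carrier (free_alg (Suc n))"
      using letter l x' cl_carrier[OF letter_el_cl[of l u n], of "Suc n"] cl_carrier[OF x'(1), of "Suc n"] by auto
    have "g * (x * letter_el u) \<approx>\<^bsub>Suc n\<^esub> x' * (g * letter_el u)"
      using N.cg_right[OF x'(2) C(1)] by (simp add: mult.assoc)
    also have "\<dots> \<approx>\<^bsub>Suc n\<^esub> x' * (u' * g)" by (rule N.cg_left[OF u'(2) C(2)])
    finally show ?case
      using cl_mult[OF x'(1) u'(1)] by (intro bexI[of _ "x' * u'"]) (simp_all add: mult.assoc)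
  qed
qed

text \<open>Induction on a bound \<open>k\<close> for the width \<open>m - l\<close>. Each summand
  from \<open>spanned_all\<close> leads to a narrower block: stabilization lowers \<open>m\<close>,
  the rules for \<open>e_n\<close> lead back to \<open>cl l n\<close>, and a summand without index
  \<open>n\<close> is shifted to start at \<open>l + 1\<close>.\<close>

theorem reducible_cl:
  "1 \<le> l \<Longrightarrow> 1 \<le> m \<Longrightarrow> m \<le> l + k \<Longrightarrow> x \<in> cl l m \<Longrightarrow> reducible m x"
proof (induction k arbitrary: l m x)
  case 0
  then obtain c where "x = scalar c * 1" using cl_empty[of m l x] by auto
  then show ?case using reducible_scale[OF reducible_one] 0 by auto
next
  case (Suc k)
  show ?case
  proof (cases "m \<le> l")
    case True
    then obtain c where "x = scalar c * 1" using cl_empty[of m l x] Suc by auto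
    then show ?thesis using reducible_scale[OF reducible_one] Suc by auto
  next
    case False
    define n where "n = m - 1"
    have m: "m = Suc n" and n: "1 \<le> n" "l \<le> n" using False Suc.prems by (auto simp: n_def)
    have up: "y \<in> carrier (free_alg n)" "y \<in> carrier (free_alg (Suc n))" if "y \<in> cl l n" for y
      using cl_carrier[OF that] Suc.prems by auto
    have IH: "reducible n y" if "y \<in> cl l n" for y
      using Suc.IH[of l n y] that Suc.prems n m by auto
    \<comment> \<open>It suffices to treat factors on the right of \<open>e_n\<close>; a left factor
      is carried around by the trace property.\<close>
    have E: "reducible (Suc n) (e_gen n * y)" if "y \<in> cl l n" for y
    proof (rule cl_peel_induct[OF that Suc.prems(1) n(2)])
      assume "l < n"
      then show "cl l n \<subseteq> spanned l (n - 1)" using spanned_all[of l "n - 1"] Suc.prems by auto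
    next
      fix p assume p: "p \<in> cl l (n - 1)"
      show "reducible (Suc n) (e_gen n * p)"
      proof (cases "l < n")
        case True
        have p': "p \<in> cl 1 (n - 1)" "p \<in> cl l n" using p cl_mono[of 1 l "n - 1" "n - 1"] cl_mono[of l l "n - 1" n] Suc.prems by auto
        have "e_gen (n - 1) * s_gen (n - 1) * p \<in> cl l n"
          using p' True by (intro cl_mult cl_e_gen cl_s_gen) auto
        then show ?thesis
          using reducible_e_step(2)[OF _ p'(1) IH] True Suc.prems by auto
      next
        case False
        then have "n - 1 \<le> l" by simp
        then obtain c where "p = scalar c" using cl_empty p by blast
        then show ?thesis
          using reducible_scale[OF reducible_e_gen[OF n(1)], of c] by (simp add: scalar_commute)
      qed
    next
      fix p r assume ln: "l < n" and p: "p \<in> cl l (n - 1)" and r: "r \<in> cl l (n - 1)"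
      have rp: "r * p \<in> cl l (n - 1)" using p r by (rule cl_mult[rotated])
      then have rp': "r * p \<in> cl 1 (n - 1)" "r * p \<in> cl l n"
        using cl_mono[of 1 l "n - 1" "n - 1"] cl_mono[of l l "n - 1" n] Suc.prems by auto
      have pC: "p \<in> cl 1 (n - 1)" "p \<in> carrier (free_alg (Suc n))" "r \<in> carrier (free_alg (Suc n))"
        using p r cl_mono[of 1 l "n - 1" "n - 1"] cl_carrier[OF p, of "Suc n"] cl_carrier[OF r, of "Suc n"] Suc.prems by auto
      have fC: "e_gen n \<in> carrier (free_alg (Suc n))" using n by (auto intro: e_gen_closed)
      have far: "p * e_gen n \<approx>\<^bsub>Suc n\<^esub> e_gen n * p" using far_commute_e[OF pC(1) n(1)] by auto
      \<comment> \<open>\<open>p\<close> commutes with \<open>e_n\<close>, so it can be carried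
        around to stand behind \<open>r\<close>.\<close>
      have conj: "reducible (Suc n) (e_gen n * (p * w * r))"
        if w: "w \<in> carrier (free_alg (Suc n))" and H: "reducible (Suc n) (e_gen n * w * (r * p))" for w
      proof -
        have "reducible (Suc n) (e_gen n * w * r * p)" using H by (simp add: mult.assoc)
        then have "reducible (Suc n) (p * (e_gen n * w * r))"
          by (rule reducible_commute) (use w pC fC in auto)
        moreover have "p * (e_gen n * w * r) \<approx>\<^bsub>Suc n\<^esub> e_gen n * (p * w * r)"
          using N.cg_right[OF far, of "w * r"] w pC by (simp add: mult.assoc)
        ultimately show ?thesis by (rule reducible_cong)
      qed
      have "e_gen (n - 1) * s_gen (n - 1) * (r * p) \<in> cl l n"
        by (rule cl_mult[OF cl_mult[OF cl_e_gen cl_s_gen] rp'(2)]) (use ln in auto)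
      then have H: "reducible n (e_gen (n - 1) * s_gen (n - 1) * (r * p))" by (rule IH)
      have n2: "2 \<le> n" using ln Suc.prems by auto
      show "reducible (Suc n) (e_gen n * (p * s_gen (n - 1) * r))"
        using reducible_e_step(3)[OF n2 rp'(1) H] n2 by (intro conj s_gen_closed) auto
      show "reducible (Suc n) (e_gen n * (p * e_gen (n - 1) * r))"
        using reducible_e_step(1)[OF n2 rp'(1) H] n2 by (intro conj e_gen_closed) auto
    next
      fix x y assume "reducible (Suc n) (e_gen n * x)" "reducible (Suc n) (e_gen n * y)"
      then show "reducible (Suc n) (e_gen n * (x + y))" by (simp add: distrib_left reducible_add)
    next
      fix x y assume x: "reducible (Suc n) (e_gen n * x)" and "x \<approx>\<^bsub>n\<^esub> y"
      then have "x \<approx>\<^bsub>Suc n\<^esub> y" by (auto intro: cong_mono)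
      then have "e_gen n * x \<approx>\<^bsub>Suc n\<^esub> e_gen n * y" using n by (intro N.cg_left e_gen_closed) auto
      with x show "reducible (Suc n) (e_gen n * y)" by (rule reducible_cong)
    qed
    have "x \<in> spanned l n" using spanned_all[OF Suc.prems(1) n(2)] Suc.prems m by auto
    then show ?thesis unfolding m
    proof induction
      case (base x)
      \<comment> \<open>The length is that of \<open>s_l ... s_n\<close>, whose conjugation maps
        strands \<open>l, ..., n\<close> to \<open>l + 1, ..., n + 1\<close> and frees strand
        \<open>l\<close>.\<close>
      define g where "g = cable l (Suc n - l)"
      have gC: "g \<in> carrier (free_alg (Suc n))" unfolding g_def using n Suc.prems by (intro cable_carrier) auto
      obtain g' where g': "g' \<in> carrier (free_alg (Suc n))" "g' * g \<approx>\<^bsub>Suc n\<^esub> 1" "g * g' \<approx>\<^bsub>Suc n\<^esub> 1"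
        using cable_inverse[of l "Suc n - l" "Suc n"] n Suc.prems by (auto simp: g_def)
      obtain x' where x': "x' \<in> cl (Suc l) (Suc n)" "g * x \<approx>\<^bsub>Suc n\<^esub> x' * g"
        using cable_shift[OF Suc.prems(1) n(2) base] by (auto simp: g_def)
      have C: "x' \<in> carrier (free_alg (Suc n))" "x \<in> carrier (free_alg (Suc n))"
        using cl_carrier[OF x'(1)] up base by auto
      have "reducible (Suc n) x'" using Suc.IH[of "Suc l" "Suc n" x'] x' Suc.prems m by auto
      moreover have "x' \<approx>\<^bsub>Suc n\<^esub> (x' * g) * g'"
        using N.cg_left[OF N.cg_sym[OF g'(3)] C(1)] by (simp add: mult.assoc)
      ultimately have "reducible (Suc n) ((x' * g) * g')" by (rule reducible_cong)
      then have "reducible (Suc n) (g' * (x' * g))" by (rule reducible_commute) (use C gC g' in auto)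
      moreover have "g' * (x' * g) \<approx>\<^bsub>Suc n\<^esub> x"
      proof -
        have "g' * (x' * g) \<approx>\<^bsub>Suc n\<^esub> g' * (g * x)" by (rule N.cg_left[OF N.cg_sym[OF x'(2)] g'(1)])
        also have "\<dots> \<approx>\<^bsub>Suc n\<^esub> x" using N.cg_right[OF g'(2) C(2)] by (simp add: mult.assoc)
        finally show ?thesis .
      qed
      ultimately show ?case by (rule reducible_cong)
    next
      case (s x y)
      then show ?case using up IH[OF cl_mult] n by (intro reducible_stab) auto
    next
      case (e x y)
      have "reducible (Suc n) (e_gen n * y * x)" using E[OF cl_mult[OF e(2,1)]] by (simp add: mult.assoc)
      then have "reducible (Suc n) (x * (e_gen n * y))"
        by (rule reducible_commute) (use up e n in \<open>auto intro!: free_alg_mult_closed e_gen_closed\<close>)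
      then show ?case by (simp add: mult.assoc)
    next
      case (add x y)
      then show ?case by (intro reducible_add)
    next
      case (cong x y)
      then show ?case by (metis reducible_cong)
    qed
  qed
qed

corollary red_total: "1 \<le> n \<Longrightarrow> x \<in> carrier (free_alg n) \<Longrightarrow> \<exists>P. red n x P"
  using reducible_cl[of 1 n n x] unfolding cl_1 by (simp add: reducible_def)

section \<open>Existence and uniqueness of the traces\<close>

text \<open>Value of a formal combination once the symbols have values \<open>\<xi> k\<close>. The
  target of \<open>h\<close> is \<open>R\<close> itself for the traces in question and the complex
  numbers for the quantum traces.\<close>

definition val :: "(coeff \<Rightarrow> 'b::comm_ring_1) \<Rightarrow> (nat \<Rightarrow> 'b) \<Rightarrow> coeff poly \<Rightarrow> 'b" where
  "val h \<xi> P = (\<Sum>k\<le>degree P. h (coeff P k) * \<xi> k)"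

locale coeff_hom =
  fixes h :: "coeff \<Rightarrow> 'b::comm_ring_1"
  assumes h_add: "h (x + y) = h x + h y" and h_mult: "h (x * y) = h x * h y" and h_1: "h 1 = 1"
begin

lemma h_0: "h 0 = 0"
  using h_add[of 0 0] by (metis add_0 add_cancel_right_right)

lemma val_superset:
  assumes "degree P \<le> N"
  shows "val h \<xi> P = (\<Sum>k\<le>N. h (coeff P k) * \<xi> k)"
  unfolding val_def using assms
  by (intro sum.mono_neutral_left) (auto simp: coeff_eq_0 h_0)

lemma val_add: "val h \<xi> (P + Q) = val h \<xi> P + val h \<xi> Q"
proof -
  let ?N = "max (degree P) (degree Q)"
  have "degree (P + Q) \<le> ?N" by (rule degree_add_le_max)
  then show ?thesis
    using val_superset[of "P + Q" ?N \<xi>] val_superset[of P ?N \<xi>] val_superset[of Q ?N \<xi>]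
    by (simp add: h_add distrib_right sum.distrib)
qed

lemma val_smult: "val h \<xi> (smult c P) = h c * val h \<xi> P"
  using val_superset[of "smult c P" "degree P" \<xi>]
  by (simp add: val_def h_mult sum_distrib_left mult.assoc degree_smult_le)

lemma val_0: "val h \<xi> 0 = 0"
  by (simp add: val_def h_0)

lemma val_monom: "val h \<xi> (monom 1 n) = \<xi> n"
proof -
  have "val h \<xi> (monom 1 n) = (\<Sum>k\<le>n. if k = n then \<xi> n else 0)"
    unfolding val_superset[OF degree_monom_le] by (intro sum.cong) (auto simp: h_0 h_1)
  then show ?thesis by simp
qed

end

text \<open>Common frame for a transverse Markov trace, where \<open>h\<close> is the identity, and
  a quantum trace, where \<open>h\<close> is an evaluation; \<open>red_value\<close> thereby serves
  both uniqueness and linear independence.\<close>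

locale trace_functional = coeff_hom h for h :: "coeff \<Rightarrow> 'b::comm_ring_1" +
  fixes T :: "nat \<Rightarrow> free \<Rightarrow> 'b"
  assumes T_add: "1 \<le> n \<Longrightarrow> x \<in> carrier (free_alg n) \<Longrightarrow> y \<in> carrier (free_alg n) \<Longrightarrow> T n (x + y) = T n x + T n y"
    and T_scale: "1 \<le> n \<Longrightarrow> x \<in> carrier (free_alg n) \<Longrightarrow> T n (scalar c * x) = h c * T n x"
    and T_ideal: "1 \<le> n \<Longrightarrow> x \<in> bmw_ideal n \<Longrightarrow> T n x = 0"
    and T_commute: "1 \<le> n \<Longrightarrow> x \<in> carrier (free_alg n) \<Longrightarrow> y \<in> carrier (free_alg n) \<Longrightarrow> T n (x * y) = T n (y * x)"
    and T_stab: "1 \<le> n \<Longrightarrow> x \<in> carrier (free_alg n) \<Longrightarrow> y \<in> carrier (free_alg n) \<Longrightarrow>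
      T (Suc n) (x * s_gen n * y) = h a_par * T n (x * y)"
begin

definition "\<xi> k = (if k = 0 then T 2 (e_gen 1) else T k 1)"

lemma red_value: "red n x P \<Longrightarrow> T n x = val h \<xi> P"
proof (induction rule: red.induct)
  case e
  show ?case unfolding val_monom \<xi>_def by simp
next
  case (one n)
  then show ?case by (simp add: val_monom \<xi>_def)
next
  case (add n x P y Q)
  then show ?case using red_n red_carrier by (metis T_add val_add)
next
  case (scale n x P c)
  then show ?case using red_n red_carrier by (metis T_scale val_smult)
next
  case (ideal n x)
  then show ?case by (simp add: T_ideal val_0)
next
  case (commute n x y)
  have "T n (x * y - y * x + y * x) = T n (x * y - y * x) + T n (y * x)"
    using commute by (intro T_add free_alg_diff_closed free_alg_mult_closed)
  then show ?case using T_commute[OF commute] by (simp add: val_0)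
next
  case (stab n x y P)
  then show ?case by (simp add: T_stab val_smult)
qed

end

section \<open>Linear independence of the basic symbols\<close>

lemma (in bmw_rep) trace_functional: "trace_functional ev \<theta>"
  by unfold_locales (simp_all add: ev_add ev_mult ev_1 \<theta>_add \<theta>_scale \<theta>_ideal \<theta>_commute \<theta>_stab ev_a)

lemma val_diff_zero:
  assumes "trace_functional h T" "red n x P" "red n x Q"
  shows "val h (trace_functional.\<xi> T) (P - Q) = 0"
proof -
  interpret trace_functional h T by (rule assms(1))
  have "val h \<xi> (P - Q) = val h \<xi> P - val h \<xi> Q"
    using val_add[of \<xi> "P - Q" Q] by simp
  then show ?thesis using red_value[OF assms(2)] red_value[OF assms(3)] by simp
qed

text \<open>Every trace functional annihilates \<open>R = P - Q\<close>. For the general linear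
  family this makes each \<open>X N\<close> a root of the specialized part of \<open>R\<close> of
  positive degree; with that part gone, the orthogonal family sees only the coefficient at
  \<open>0\<close>.\<close>

theorem red_unique:
  assumes "red n x P" "red n x Q"
  shows "P = Q"
proof -
  define R where "R = P - Q"
  have point: "ev_point (complex_of_real (r ^ (2 * M - 1))) (complex_of_real r)"
    if "r > 1" for r M
  proof
    have "r * r \<noteq> 1" using that by (metis less_1_mult less_irrefl)
    then show "complex_of_real r * complex_of_real r \<noteq> 1"
      by (metis of_real_1 of_real_eq_iff of_real_mult)
  qed (use that in auto)
  have pos: "coeff R k = 0" if k: "1 \<le> k" for k
  proof (rule coeff_zeroI)
    fix r :: real and M :: nat assume r: "r > 1" and M: "1 \<le> M"
    define a q where "a = complex_of_real (r ^ (2 * M - 1))" and "q = complex_of_real r"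
    interpret ev_point a q unfolding a_def q_def by (rule point[OF r])
    define p where "p = (\<Sum>k\<in>{1..degree R}. monom (ev a q (coeff R k)) k)"
    \<comment> \<open>The quantum dimension of the \<open>N\<close>-dimensional representation, so
      that the symbol \<open>1_k\<close> has the value \<open>X N ^ k\<close>.\<close>
    define X where "X = (\<lambda>N. \<Sum>i\<in>{0<..int N}. a * q * (inverse q ^ N * inverse q ^ N) * w i)"
    have root: "poly p (X N) = 0" if N: "1 \<le> N" for N
    proof -
      interpret H: bmw_rep "{0<..int N}" q "inverse q" a "inverse a" "q - inverse q" "weight q"
        "\<lambda>i. a * q * (inverse q ^ N * inverse q ^ N) * w i" "ev a q" 1
        by (rule hecke_rep[OF N])
      interpret F: trace_functional "ev a q" H.\<theta> by (rule H.trace_functional)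
      have \<xi>: "F.\<xi> k = (if k = 0 then 0 else X N ^ k)" for k
        unfolding F.\<xi>_def H.\<theta>_e H.\<theta>_one X_def by simp
      have "0 = (\<Sum>k\<le>degree R. ev a q (coeff R k) * F.\<xi> k)"
        using val_diff_zero[OF H.trace_functional assms] by (simp add: R_def val_def)
      also have "\<dots> = (\<Sum>k\<in>{1..degree R}. ev a q (coeff R k) * X N ^ k)"
        by (intro sum.mono_neutral_cong_right) (auto simp: \<xi>)
      also have "\<dots> = poly p (X N)"
        by (simp add: p_def poly_sum poly_monom)
      finally show ?thesis by simp
    qed
    \<comment> \<open>In closed form the quantum dimensions are seen to differ for different
      \<open>N\<close>.\<close>
    have X: "(q - inverse q) * X N = a * (1 - inverse q ^ (2 * N))" for N
    proof -
      have "X N = a * q * (inverse q ^ N * inverse q ^ N) * (\<Sum>i\<in>{int 0<..int N}. w i)"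
        by (simp add: X_def sum_distrib_left)
      then have "(q - inverse q) * X N = a * q * (inverse q ^ N * inverse q ^ N) *
          ((q - inverse q) * (\<Sum>i\<in>{int 0<..int N}. w i))"
        by (simp only: mult_ac)
      also have "\<dots> = a * (q * inverse q) * ((inverse q ^ N * q ^ N) * (inverse q ^ N * q ^ N) - inverse q ^ N * inverse q ^ N)"
        unfolding z_pos_sum[OF le0] by (simp add: algebra_simps)
      also have "inverse q ^ N * q ^ N = 1" using q0 by (simp add: power_mult_distrib[symmetric])
      finally show ?thesis using q0 by (simp add: power_add[symmetric] mult_2)
    qed
    have "p = 0"
    proof (rule poly_zero_infinite)
      have "inj (\<lambda>N. X (Suc N))"
      proof (rule injI)
        fix N N' assume "X (Suc N) = X (Suc N')"
        then have "a * (1 - inverse q ^ (2 * Suc N)) = a * (1 - inverse q ^ (2 * Suc N'))"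
          using X by metis
        then have "inverse q ^ (2 * Suc N) = inverse q ^ (2 * Suc N')" using a0 by simp
        then have "q ^ (2 * Suc N) = q ^ (2 * Suc N')" by (simp only: power_inverse inverse_eq_iff_eq)
        then have "complex_of_real (r ^ (2 * Suc N)) = complex_of_real (r ^ (2 * Suc N'))"
          by (simp only: q_def of_real_power)
        then have "2 * Suc N = 2 * Suc N'"
          unfolding of_real_eq_iff power_inject_exp[OF r] .
        then show "N = N'" by simp
      qed
      then show "infinite (range (\<lambda>N. X (Suc N)))" by (rule range_inj_infinite)
      fix b assume "b \<in> range (\<lambda>N. X (Suc N))"
      then obtain N where "b = X (Suc N)" by blast
      then show "poly p b = 0" using root[of "Suc N"] by simp
    qed
    moreover have "coeff p k = (if k \<le> degree R then ev a q (coeff R k) else 0)"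
      using k by (simp add: p_def coeff_sum)
    ultimately have "k \<le> degree R \<Longrightarrow> ev a q (coeff R k) = 0" by simp
    then have "ev a q (coeff R k) = 0"
      using ev_add[of 0 0] by (cases "k \<le> degree R") (simp_all add: coeff_eq_0)
    then show "ev (complex_of_real (r ^ (2 * M - 1))) (complex_of_real r) (coeff R k) = 0"
      by (simp only: a_def q_def)
  qed
  have zero: "coeff R 0 = 0"
  proof (rule coeff_zeroI)
    fix r :: real and M :: nat assume r: "r > 1" and M: "1 \<le> M"
    define a q where "a = complex_of_real (r ^ (2 * M - 1))" and "q = complex_of_real r"
    interpret ev_point a q unfolding a_def q_def by (rule point[OF r])
    have "r ^ (2 * M - 1) = inverse r * (r ^ M * r ^ M)"
    proof -
      obtain M' where "M = Suc M'" using M by (cases M) auto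
      then have "2 * M - 1 = Suc (M' + M')" "M = Suc M'" by simp_all
      then show ?thesis using r by (simp only: power_add power_Suc) simp
    qed
    then have aM: "a = inverse q * (q ^ M * q ^ M)" by (simp add: a_def q_def)
    interpret O: bmw_rep "{- int M..int M} - {0}" q "inverse q" a "inverse a" "q - inverse q" "weight q"
      w "ev a q" 1
      by (rule orthogonal_rep[OF M aM])
    interpret F: trace_functional "ev a q" O.\<theta> by (rule O.trace_functional)
    \<comment> \<open>The weights are positive reals for \<open>r > 1\<close>, so the value at
      \<open>e_1\<close> is a sum of positive squares and cannot vanish.\<close>
    define \<omega> where "\<omega> = (\<lambda>i. if i > 0 then r ^ nat (i - 1) else inverse r ^ nat (- i - 1))"
    have \<omega>: "weight q i = complex_of_real (\<omega> i)" for i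
      by (simp add: weight_def \<omega>_def q_def)
    have "F.\<xi> 0 = (\<Sum>i\<in>{- int M..int M} - {0}. w i)"
      unfolding F.\<xi>_def O.\<theta>_e by (auto intro!: sum.cong)
    also have "\<dots> = complex_of_real (\<Sum>i\<in>{- int M..int M} - {0}. \<omega> i * \<omega> i)"
      by (simp add: \<omega>)
    finally have \<xi>0: "F.\<xi> 0 = complex_of_real (\<Sum>i\<in>{- int M..int M} - {0}. \<omega> i * \<omega> i)" .
    have "(\<Sum>i\<in>{- int M..int M} - {0}. \<omega> i * \<omega> i) > 0"
      using M r by (intro sum_pos) (auto simp: \<omega>_def intro!: exI[of _ 1])
    then have nz: "F.\<xi> 0 \<noteq> 0" unfolding \<xi>0 by (simp only: of_real_eq_0_iff)
    have "0 = (\<Sum>k\<le>degree R. ev a q (coeff R k) * F.\<xi> k)"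
      using val_diff_zero[OF O.trace_functional assms] by (simp add: R_def val_def)
    also have "\<dots> = (\<Sum>k\<in>{0}. ev a q (coeff R k) * F.\<xi> k)"
      using pos F.h_0 by (intro sum.mono_neutral_right) auto
    finally have "ev a q (coeff R 0) = 0" using nz by simp
    then show "ev (complex_of_real (r ^ (2 * M - 1))) (complex_of_real r) (coeff R 0) = 0"
      by (simp only: a_def q_def)
  qed
  have "R = 0"
  proof (rule poly_eqI)
    fix k show "coeff R k = coeff 0 k" using pos[of k] zero by (cases k) auto
  qed
  then show ?thesis by (simp add: R_def)
qed

section \<open>The trace defined by reduction, and its uniqueness\<close>

lemma bmw_class_cong: "x \<approx>\<^bsub>n\<^esub> y \<longleftrightarrow> x \<in> carrier (free_alg n) \<and> y \<in> carrier (free_alg n) \<and> bmw_class n x = bmw_class n y"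
proof
  assume *: "x \<approx>\<^bsub>n\<^esub> y"
  then have d: "x - y \<in> bmw_ideal n" "y - x \<in> bmw_ideal n" using N.cg_sym[OF *] by (simp_all add: N.cg_def)
  have "bmw_class n x \<subseteq> bmw_class n y" if "x - y \<in> bmw_ideal n" for x y
  proof
    fix u assume "u \<in> bmw_class n x"
    then obtain v where "v \<in> bmw_ideal n" "u = v + x" unfolding bmw_class_eq by blast
    then have "u = (v + (x - y)) + y" "v + (x - y) \<in> bmw_ideal n" using that N.I_add by auto
    then show "u \<in> bmw_class n y" unfolding bmw_class_eq by blast
  qed
  then show "x \<in> carrier (free_alg n) \<and> y \<in> carrier (free_alg n) \<and> bmw_class n x = bmw_class n y"
    using d * by (auto simp: N.cg_def)
next
  assume *: "x \<in> carrier (free_alg n) \<and> y \<in> carrier (free_alg n) \<and> bmw_class n x = bmw_class n y"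
  have "0 + x \<in> bmw_class n x" unfolding bmw_class_eq using N.I_zero by blast
  then have "x \<in> bmw_class n y" using * by simp
  then obtain v where "v \<in> bmw_ideal n" "x = v + y" unfolding bmw_class_eq by blast
  then show "x \<approx>\<^bsub>n\<^esub> y" using * by (simp add: N.cg_def)
qed

lemma red_cong: "red n x P \<Longrightarrow> x \<approx>\<^bsub>n\<^esub> y \<Longrightarrow> red n y P"
proof -
  assume x: "red n x P" and "x \<approx>\<^bsub>n\<^esub> y"
  then have "y - x \<in> bmw_ideal n" using N.cg_sym[of n x y] by (simp add: N.cg_def)
  then have "red n (x + (y - x)) (P + 0)"
    using x red_n by (intro red.add red.ideal) auto
  then show ?thesis by simp
qed

text \<open>Any representative and any reduction may be used: congruent elements have the same
  reductions by \<open>red_cong\<close>, and \<open>red_unique\<close> makes the result unique. The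
  restrictions to indices from \<open>1\<close> and to the carriers provide extensionality.\<close>

definition bmw_trace :: "coeff \<Rightarrow> (nat \<Rightarrow> coeff) \<Rightarrow> nat \<Rightarrow> free set \<Rightarrow> coeff" where
  "bmw_trace \<beta> \<alpha> = (\<lambda>n\<in>{1..}. \<lambda>X\<in>carrier (bmw n).
     val (\<lambda>c. c) (\<lambda>k. if k = 0 then \<beta> else \<alpha> k) (THE P. \<exists>x. X = bmw_class n x \<and> red n x P))"

interpretation idh: coeff_hom "\<lambda>c. c"
  by unfold_locales simp_all

lemma bmw_trace_red:
  assumes "red n x P"
  shows "bmw_trace \<beta> \<alpha> n (bmw_class n x) = val (\<lambda>c. c) (\<lambda>k. if k = 0 then \<beta> else \<alpha> k) P"
proof -
  have "(THE P. \<exists>y. bmw_class n x = bmw_class n y \<and> red n y P) = P"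
  proof (rule the_equality)
    show "\<exists>y. bmw_class n x = bmw_class n y \<and> red n y P" using assms by blast
    fix Q assume "\<exists>y. bmw_class n x = bmw_class n y \<and> red n y Q"
    then obtain y where y: "bmw_class n x = bmw_class n y" "red n y Q" by blast
    then have "x \<approx>\<^bsub>n\<^esub> y" using red_carrier assms by (auto simp: bmw_class_cong)
    then have "red n y P" by (rule red_cong[OF assms])
    then show "Q = P" using y red_unique by blast
  qed
  moreover have "bmw_class n x \<in> carrier (bmw n)"
    using red_carrier[OF assms] by (simp add: bmw_carrier)
  ultimately show ?thesis using red_n[OF assms] by (simp add: bmw_trace_def)
qed

lemma bmw_trace_transverse: "transverse_markov_trace (bmw_trace \<beta> \<alpha>)"
proof -
  let ?\<tau> = "bmw_trace \<beta> \<alpha>"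
  have obt: "\<exists>x P. red n x P \<and> x \<in> carrier (free_alg n) \<and> u = bmw_class n x" if "1 \<le> n" "u \<in> carrier (bmw n)" for n u
    using that red_total unfolding bmw_carrier by blast
  show ?thesis
    unfolding transverse_markov_trace_def
  proof (intro conjI allI impI ballI)
    show "?\<tau> \<in> (\<Pi>\<^sub>E n\<in>{1..}. carrier (bmw n) \<rightarrow>\<^sub>E UNIV)"
      unfolding bmw_trace_def by auto
  next
    fix n :: nat and u v assume n: "1 \<le> n" and u: "u \<in> carrier (bmw n)" and v: "v \<in> carrier (bmw n)"
    obtain x P where x: "red n x P" "x \<in> carrier (free_alg n)" "u = bmw_class n x" using obt[OF n u] by blast
    obtain y Q where y: "red n y Q" "y \<in> carrier (free_alg n)" "v = bmw_class n y" using obt[OF n v] by blast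
    show "?\<tau> n (u \<oplus>\<^bsub>bmw n\<^esub> v) = ?\<tau> n u + ?\<tau> n v"
      unfolding x(3) y(3) bmw_class_simps[OF x(2) y(2)]
      by (simp only: bmw_trace_red[OF red.add[OF x(1) y(1)]] bmw_trace_red[OF x(1)] bmw_trace_red[OF y(1)] idh.val_add)
    obtain R where R: "red n (x * y) R" using red_total[OF n free_alg_mult_closed[OF x(2) y(2)]] by blast
    have "red n (x * y + (y * x - x * y)) (R + 0)" by (intro red.add R red.commute n x y)
    then have R': "red n (y * x) R" by simp
    show "?\<tau> n (u \<otimes>\<^bsub>bmw n\<^esub> v) = ?\<tau> n (v \<otimes>\<^bsub>bmw n\<^esub> u)"
      unfolding x(3) y(3) bmw_class_simps[OF x(2) y(2)] bmw_class_simps[OF y(2) x(2)]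
      by (simp only: bmw_trace_red[OF R] bmw_trace_red[OF R'])
    have mono: "carrier (free_alg n) \<subseteq> carrier (free_alg (n + 1))" by (rule free_alg_mono) simp
    have up: "x \<in> carrier (free_alg (n + 1))" "y \<in> carrier (free_alg (n + 1))" "s_gen n \<in> carrier (free_alg (n + 1))"
      using subsetD[OF mono x(2)] subsetD[OF mono y(2)] s_gen_closed[of n "n + 1"] n by simp_all
    show "?\<tau> (n + 1) (bmw_incl n u \<otimes>\<^bsub>bmw (n + 1)\<^esub> bmw_s (n + 1) n \<otimes>\<^bsub>bmw (n + 1)\<^esub> bmw_incl n v)
        = a_par * ?\<tau> n (u \<otimes>\<^bsub>bmw n\<^esub> v)"
      unfolding x(3) y(3) bmw_incl_class bmw_s_def bmw_class_simps[OF up(1,3)]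
        bmw_class_simps[OF free_alg_mult_closed[OF up(1,3)] up(2)] bmw_class_simps[OF x(2) y(2)]
      using bmw_trace_red[OF red.stab[OF n x(2) y(2) R], of \<beta> \<alpha>] bmw_trace_red[OF R, of \<beta> \<alpha>]
      by (simp add: idh.val_smult)
  next
    fix n :: nat and c u assume n: "1 \<le> n" and u: "u \<in> carrier (bmw n)"
    obtain x P where x: "red n x P" "x \<in> carrier (free_alg n)" "u = bmw_class n x" using obt[OF n u] by blast
    show "?\<tau> n (bmw_scale n c u) = c * ?\<tau> n u"
      unfolding x(3) bmw_scale_class[OF x(2)]
      by (simp only: bmw_trace_red[OF red.scale[OF x(1)]] bmw_trace_red[OF x(1)] idh.val_smult)
  qed
qed

lemma transverse_trace_functional:
  assumes "transverse_markov_trace \<tau>"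
  shows "trace_functional (\<lambda>c. c) (\<lambda>n x. \<tau> n (bmw_class n x))"
proof -
  have \<tau>:
    "\<And>n u v. 1 \<le> n \<Longrightarrow> u \<in> carrier (bmw n) \<Longrightarrow> v \<in> carrier (bmw n) \<Longrightarrow> \<tau> n (u \<oplus>\<^bsub>bmw n\<^esub> v) = \<tau> n u + \<tau> n v"
    "\<And>n c u. 1 \<le> n \<Longrightarrow> u \<in> carrier (bmw n) \<Longrightarrow> \<tau> n (bmw_scale n c u) = c * \<tau> n u"
    "\<And>n u v. 1 \<le> n \<Longrightarrow> u \<in> carrier (bmw n) \<Longrightarrow> v \<in> carrier (bmw n) \<Longrightarrow> \<tau> n (u \<otimes>\<^bsub>bmw n\<^esub> v) = \<tau> n (v \<otimes>\<^bsub>bmw n\<^esub> u)"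
    "\<And>n u v. 1 \<le> n \<Longrightarrow> u \<in> carrier (bmw n) \<Longrightarrow> v \<in> carrier (bmw n) \<Longrightarrow>
      \<tau> (n + 1) (bmw_incl n u \<otimes>\<^bsub>bmw (n + 1)\<^esub> bmw_s (n + 1) n \<otimes>\<^bsub>bmw (n + 1)\<^esub> bmw_incl n v)
        = a_par * \<tau> n (u \<otimes>\<^bsub>bmw n\<^esub> v)"
    using assms unfolding transverse_markov_trace_def by blast+
  have C: "bmw_class n x \<in> carrier (bmw n)" if "x \<in> carrier (free_alg n)" for n x
    using that by (simp add: bmw_carrier)
  have add: "\<tau> n (bmw_class n (x + y)) = \<tau> n (bmw_class n x) + \<tau> n (bmw_class n y)"
    if "1 \<le> n" "x \<in> carrier (free_alg n)" "y \<in> carrier (free_alg n)" for n x y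
    using \<tau>(1)[OF that(1) C[OF that(2)] C[OF that(3)]] unfolding bmw_class_simps(2)[OF that(2,3)] .
  show ?thesis
  proof
    fix n x y assume n: "1 \<le> n" and x: "x \<in> carrier (free_alg n)" and y: "y \<in> carrier (free_alg n)"
    show "\<tau> n (bmw_class n (x + y)) = \<tau> n (bmw_class n x) + \<tau> n (bmw_class n y)"
      by (rule add[OF n x y])
    show "\<tau> n (bmw_class n (x * y)) = \<tau> n (bmw_class n (y * x))"
      using \<tau>(3)[OF n C[OF x] C[OF y]] unfolding bmw_class_simps(1)[OF x y] bmw_class_simps(1)[OF y x] .
    have mono: "carrier (free_alg n) \<subseteq> carrier (free_alg (n + 1))" by (rule free_alg_mono) simp
    have up: "x \<in> carrier (free_alg (n + 1))" "y \<in> carrier (free_alg (n + 1))" "s_gen n \<in> carrier (free_alg (n + 1))"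
      using subsetD[OF mono x] subsetD[OF mono y] s_gen_closed[of n "n + 1"] n by simp_all
    have "\<tau> (n + 1) (bmw_incl n (bmw_class n x) \<otimes>\<^bsub>bmw (n + 1)\<^esub> bmw_s (n + 1) n \<otimes>\<^bsub>bmw (n + 1)\<^esub> bmw_incl n (bmw_class n y))
        = a_par * \<tau> n (bmw_class n x \<otimes>\<^bsub>bmw n\<^esub> bmw_class n y)"
      by (rule \<tau>(4)[OF n C[OF x] C[OF y]])
    then show "\<tau> (Suc n) (bmw_class (Suc n) (x * s_gen n * y)) = a_par * \<tau> n (bmw_class n (x * y))"
      unfolding bmw_incl_class bmw_s_def bmw_class_simps[OF up(1,3)]
        bmw_class_simps[OF free_alg_mult_closed[OF up(1,3)] up(2)] bmw_class_simps[OF x y] by simp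
  next
    fix n x c assume n: "1 \<le> n" and x: "x \<in> carrier (free_alg n)"
    show "\<tau> n (bmw_class n (scalar c * x)) = c * \<tau> n (bmw_class n x)"
      using \<tau>(2)[OF n C[OF x], of c] unfolding bmw_scale_class[OF x] .
  next
    fix n x assume n: "1 \<le> n" and x: "x \<in> bmw_ideal n"
    have z: "0 \<in> carrier (free_alg n)" using N.I_C[OF N.I_zero] .
    have "x \<approx>\<^bsub>n\<^esub> 0" using x z N.I_C[OF x] by (simp add: N.cg_def)
    then have "\<tau> n (bmw_class n x) = \<tau> n (bmw_class n 0)" by (simp add: bmw_class_cong)
    also have "\<dots> = 0" using add[OF n z z] by (metis add_0 add_cancel_right_right)
    finally show "\<tau> n (bmw_class n x) = 0" .
  qed
qed

theorem mainTheorem15: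
  fixes \<beta> :: coeff and \<alpha> :: "nat \<Rightarrow> coeff"
  shows "\<exists>!\<tau>. transverse_markov_trace \<tau> \<and> \<tau> 2 (bmw_e 2 1) = \<beta> \<and>
    (\<forall>n\<ge>1. \<tau> n \<one>\<^bsub>bmw n\<^esub> = \<alpha> n)"
proof (rule ex1I[of _ "bmw_trace \<beta> \<alpha>"])
  show "transverse_markov_trace (bmw_trace \<beta> \<alpha>) \<and> bmw_trace \<beta> \<alpha> 2 (bmw_e 2 1) = \<beta> \<and>
    (\<forall>n\<ge>1. bmw_trace \<beta> \<alpha> n \<one>\<^bsub>bmw n\<^esub> = \<alpha> n)"
    using bmw_trace_transverse[of \<beta> \<alpha>] bmw_trace_red[OF red.e, of \<beta> \<alpha>] bmw_trace_red[OF red.one, of _ \<beta> \<alpha>]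
    unfolding idh.val_monom by (simp add: bmw_e_def bmw_one)
next
  fix \<tau> assume \<tau>: "transverse_markov_trace \<tau> \<and> \<tau> 2 (bmw_e 2 1) = \<beta> \<and> (\<forall>n\<ge>1. \<tau> n \<one>\<^bsub>bmw n\<^esub> = \<alpha> n)"
  then interpret F: trace_functional "\<lambda>c. c" "\<lambda>n x. \<tau> n (bmw_class n x)"
    by (intro transverse_trace_functional) blast
  have \<xi>: "F.\<xi> k = (if k = 0 then \<beta> else \<alpha> k)" for k
  proof -
    have "\<tau> 2 (bmw_class 2 (e_gen 1)) = \<beta>" using \<tau> by (simp only: bmw_e_def)
    moreover have "\<tau> k (bmw_class k 1) = \<alpha> k" if "1 \<le> k" using \<tau> that by (simp only: bmw_one)
    ultimately show ?thesis unfolding F.\<xi>_def by (cases "k = 0") simp_all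
  qed
  have E: "\<sigma> \<in> (\<Pi>\<^sub>E n\<in>{1..}. carrier (bmw n) \<rightarrow>\<^sub>E UNIV)" if "transverse_markov_trace \<sigma>" for \<sigma>
    by (rule conjunct1[OF that[unfolded transverse_markov_trace_def]])
  have E1: "\<tau> \<in> (\<Pi>\<^sub>E n\<in>{1..}. carrier (bmw n) \<rightarrow>\<^sub>E UNIV)" using E \<tau> by blast
  have E2: "bmw_trace \<beta> \<alpha> \<in> (\<Pi>\<^sub>E n\<in>{1..}. carrier (bmw n) \<rightarrow>\<^sub>E UNIV)" by (rule E[OF bmw_trace_transverse])
  show "\<tau> = bmw_trace \<beta> \<alpha>"
  proof (rule PiE_ext[OF E1 E2])
    fix n :: nat assume n: "n \<in> {1..}"
    show "\<tau> n = bmw_trace \<beta> \<alpha> n"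
    proof (rule PiE_ext[OF PiE_mem[OF E1 n] PiE_mem[OF E2 n]])
      fix u assume "u \<in> carrier (bmw n)"
      then obtain x where x: "x \<in> carrier (free_alg n)" "u = bmw_class n x" unfolding bmw_carrier by blast
      \<comment> \<open>A reduction of a representative exists, and it expresses both values through
        \<open>\<beta>\<close> and the \<open>\<alpha> k\<close> in the same way.\<close>
      then obtain P where P: "red n x P" using red_total[of n x] n by auto
      show "\<tau> n u = bmw_trace \<beta> \<alpha> n u"
        unfolding x(2) bmw_trace_red[OF P] using F.red_value[OF P] by (simp add: \<xi>[abs_def])
    qed
  qed
qed

end
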